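(* Let $\mathcal C$ be a relative Hermitian-premodular category with grading group $\mathcal G$, singular set $\mathcal X$, translation group $\mathsf Z$, free realization $\lambda\mapsto\sigma_\lambda$ and bilinear map $\psi$. Suppose that there is a bilinear map $\sqrt\psi:\mathcal G\times\mathsf Z\to\mathbb U=\{z\in\Bbbk:\bar zz=1\}$ with $(\sqrt\psi)^2=\psi$, and that $c_{\sigma_\lambda,\sigma_\mu}=\mathrm{Id}_{\sigma_{\lambda+\mu}}$ for all $\lambda,\mu\in\mathsf Z$. Let $\mathcal C^{\mathsf Z}$ be the associated category, and let $\mathsf A$ be the class of generic simple objects of $\mathcal C^{\mathsf Z}$. If there exists a map $\mathsf b:\mathsf A\to\Bbbk^*$, invariant under isomorphism and duality, such that $\mathsf b(V)=\sum_{V_1\in irr(\mathcal C^{\mathsf Z}_{g_1}),V_2\in irr(\mathcal C^{\mathsf Z}_{g_2})}\mathsf b(V_1)\mathsf b(V_2)\dim_\Bbbk\mathrm{Hom}_{\mathcal C^{\mathsf Z}}(V,V_1\otimes V_2)$ for all $g_1,g_2,g_1+g_2\in\mathcal G\setminus\mathcal X$ and $V\in\mathsf A\cap\mathcal C^{\mathsf Z}_{g_1+g_2}$ (where $irr$ denotes representatives of isomorphism classes of simple objects), then $\mathcal C^{\mathsf Z}$ is a relative $\mathcal G$-Hermitian-spherical category.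
   Context: Let $\Bbbk$ be a field with an involutive automorphism $x\mapsto\bar x$, and $(\mathcal G,+)$, $(\mathsf Z,+)$ abelian groups. **Hermitian pivotal/ribbon.** A tensor $\Bbbk$-category has $\Bbbk$-linear homs, bilinear $\circ,\otimes$, and $\Bbbk\cong\mathrm{End}(\mathbb I)$. It is pivotal if every $V$ has a dual $V^*$ and morphisms $\mathrm{coev}_V:\mathbb I\to V\otimes V^*$, $\mathrm{ev}_V:V^*\otimes V\to\mathbb I$, $\widetilde{\mathrm{coev}}_V:\mathbb I\to V^*\otimes V$, $\widetilde{\mathrm{ev}}_V:V\otimes V^*\to\mathbb I$ with the usual compatibilities. It is sesquilinear pivotal if there are bijections $f\mapsto f^\dagger$, $\mathrm{Hom}(V,W)\to\mathrm{Hom}(W,V)$, with $(\mu f+\lambda g)^\dagger=\bar\mu f^\dagger+\bar\lambda g^\dagger$, $(f\otimes g)^\dagger=f^\dagger\otimes g^\dagger$, $(f\circ g)^\dagger=g^\dagger\circ f^\dagger$, $\mathrm{coev}_V^\dagger=\widetilde{\mathrm{ev}}_V$, $\mathrm{ev}_V^\dagger=\widetilde{\mathrm{coev}}_V$, $\widetilde{\mathrm{coev}}_V^\dagger=\mathrm{ev}_V$, $\widetilde{\mathrm{ev}}_V^\dagger=\mathrm{coev}_V$; Hermitian pivotal if moreover $f^{\dagger\dagger}=f$. A ribbon category is a braided pivotal category in which the left and right twists agree; it is Hermitian ribbon if it is Hermitian pivotal and $c_{V,W}^\dagger=c_{V,W}^{-1}$. **Modified trace.** An m-trace on the full subcategory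 $\mathsf{Proj}$ of projective objects is a family of linear maps $\mathsf t_V:\mathrm{End}(V)\to\Bbbk$ ($V\in\mathsf{Proj}$) with $\mathsf t_V(gf)=\mathsf t_U(fg)$ for $f:V\to U$, $g:U\to V$, and, for $U\in\mathsf{Proj}$ and any $W$, $\mathsf t_{U\otimes W}(f)=\mathsf t_U((\mathrm{Id}_U\otimes\widetilde{\mathrm{ev}}_W)(f\otimes\mathrm{Id})(\mathrm{Id}_U\otimes\mathrm{coev}_W))$ and $\mathsf t_{W\otimes U}(f)=\mathsf t_U((\mathrm{ev}_W\otimes\mathrm{Id}_U)(\mathrm{Id}\otimes f)(\widetilde{\mathrm{coev}}_W\otimes\mathrm{Id}_U))$. It is real if $\mathsf t(f^\dagger)=\overline{\mathsf t(f)}$. Put $\mathsf d(V)=\mathsf t_V(\mathrm{Id}_V)$. **Gradings.** $\mathcal C$ is $\mathcal G$-graded if $\mathcal C=\bigoplus_{g\in\mathcal G}\mathcal C_g$ with non-empty full subcategories $\mathcal C_g$, $\mathbb I\in\mathcal C_0$, $\mathcal C_g\otimes\mathcal C_{g'}\subset\mathcal C_{g+g'}$, and $\mathrm{Hom}(V,V')=0$ for $V\in\mathcal C_g,V'\in\mathcal C_{g'}$, $g\ne g'$. $\mathcal X\subset\mathcal G$ is symmetric if $-\mathcal X=\mathcal X$, and small if no finite union of translates of $\mathcal X$ covers $\mathcal G$. $(\mathcal C,\mathcal G,\mathcal X)$ is generically (finitely) $\mathcal G$-semisimple if $\mathcal X$ is small symmetric and for each $g\in\mathcal G\setminus\mathcal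 X$ all objects of $\mathcal C_g$ are semisimple (and $\mathcal C_g$ has finitely many isomorphism classes of simple objects). A generic simple object is a simple object of some $\mathcal C_g$, $g\notin\mathcal X$. **Relative (Hermitian-)premodular.** A free realization of $\mathsf Z$ in a ribbon category is a monoidal functor $\sigma$ from the discrete category $\mathsf Z$ (with tensor product $+$; $\sigma_\lambda\otimes\sigma_\mu=\sigma_{\lambda+\mu}$) such that each $\sigma_\lambda$ has trivial twist and $\otimes\,\sigma_\lambda$ induces a free action on isomorphism classes of simple objects. A relative $\mathcal G$-premodular category is a $\Bbbk$-linear ribbon, generically semisimple category $(\mathcal C,\mathcal G,\mathcal X)$ with a free realization $\sigma:\mathsf Z\to\mathcal C_0$ and a non-zero m-trace on $\mathsf{Proj}$ such that: for each $g\notin\mathcal X$, $\mathcal C_g$ is semisimple and dominated by $\{V_i\otimes\sigma_\lambda: i\in I_g,\lambda\in\mathsf Z\}$ for some finite set of simple projective objects $V_i\in\mathcal C_g$ with epic evaluation (dominated: identities of objects are linear combinations of maps factoring through objects of the set); and there is a bilinear map $\psi:\mathcal G\times\mathsf Z\to\Bbbk^*$ with $c_{\sigma_\lambda,V}c_{V,\sigma_\lambda}=\psi(g,\lambda)\mathrm{Id}_{V\otimes\sigma_\lambda}$ for $V\in\mathcal C_g$. It is relative Hermitian-premodular if it is also a Hermitian ribbon category and the m-trace is real. (Then $\psi$ takes values in $\mathbb U$.) **The category $\mathcal C^{\mathsf Z}$.** For $V\in\mathcal C_g$ put $\mathsf X_{V,\sigma_\lambda}=\sqrt\psi(g,\lambda)^{-1}c_{V,\sigma_\lambda}$.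 $\mathcal C^{\mathsf Z}$ has the objects of $\mathcal C$ and $\mathrm{Hom}_{\mathcal C^{\mathsf Z}}(V,W)=\bigoplus_{\lambda\in\mathsf Z}\mathrm{Hom}_{\mathcal C}(V,\sigma_\lambda\otimes W)$, $f=(f_\lambda)_\lambda$. Composition: $(g\circ f)_\lambda=\sum_{\lambda'+\lambda''=\lambda}(\mathrm{Id}_{\sigma_{\lambda'}}\otimes g_{\lambda''})f_{\lambda'}$. Tensor product of $f:V_1\to V_2$ and $h:V_3\to V_4$: $(f\otimes h)_\lambda=\sum_{\lambda'+\lambda''=\lambda}(\mathrm{Id}_{\sigma_{\lambda'}}\otimes\mathsf X_{V_2,\sigma_{\lambda''}}\otimes\mathrm{Id}_{V_4})(f_{\lambda'}\otimes h_{\lambda''})$. Its grading and duality morphisms are those of $\mathcal C$ (placed in degree $\lambda=0$), and, for $f:V_1\to V_2$, $(f^\dagger)_\lambda=(\mathrm{Id}_{\sigma_\lambda}\otimes(f_{-\lambda})^\dagger)(\widetilde{\mathrm{coev}}_{\sigma_{-\lambda}}\otimes\mathrm{Id}_{V_2})$, where $\sigma_{-\lambda}^*$ is canonically identified with $\sigma_\lambda$. **Relative (Hermitian-)spherical.** A relative $\mathcal G$-spherical category is a $\Bbbk$-linear pivotal, generically finitely $\mathcal G$-semisimple category $(\mathcal D,\mathcal G,\mathcal X)$, with $\mathsf A$ the class of generic simple objects, such that (S1) there is an m-trace on $\mathsf{Proj}$ whose function $\mathsf d(V)=\mathsf t_V(\mathrm{Id}_V)$ restricts to a map $\mathsf A\to\Bbbk^*$;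 (S2) there is a map $\mathsf b:\mathsf A\to\Bbbk^*$, invariant under isomorphism and duality, with $\mathsf b(V)=\sum_{V_1\in irr(\mathcal D_{g_1}),V_2\in irr(\mathcal D_{g_2})}\mathsf b(V_1)\mathsf b(V_2)\dim_\Bbbk\mathrm{Hom}_{\mathcal D}(V,V_1\otimes V_2)$ for all $g_1,g_2,g_1+g_2\in\mathcal G\setminus\mathcal X$ and $V\in\mathsf A\cap\mathcal D_{g_1+g_2}$ ($irr$ denotes representatives of isomorphism classes of simple objects). It is relative $\mathcal G$-Hermitian-spherical if it is moreover Hermitian pivotal and the m-trace is real. *)

theory Defs
  imports Complex_Main "HOL-Library.Poly_Mapping"
begin

text \<open>
  Conventions.  The objects of a category form a type \<open>'o\<close>.  All hom-spaces of a
  \<open>\<bbbk>\<close>-linear category are subspaces of one ambient \<open>\<bbbk>\<close>-vector space \<open>'m\<close>, and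
  \<open>hom V W\<close> and \<open>hom V' W'\<close> meet only in \<open>0\<close> unless \<open>V = V'\<close> and \<open>W = W'\<close>.  Every
  small \<open>\<bbbk>\<close>-linear category has this form (take for \<open>'m\<close> the direct sum of all its
  hom-spaces); the operations on morphisms need no object arguments, and all axioms are
  restricted to typed morphisms.  Tensor categories are strict.
\<close>

section \<open>Linear, tensor and pivotal categories\<close>

record ('k, 'o, 'm) lin_cat =
  scale :: "'k \<Rightarrow> 'm \<Rightarrow> 'm"  (infixr "\<cdot>\<index>" 76)
  hom   :: "'o \<Rightarrow> 'o \<Rightarrow> 'm set"  ("Hom\<index>")
  ident :: "'o \<Rightarrow> 'm"  ("Id\<index>")
  cmp   :: "'m \<Rightarrow> 'm \<Rightarrow> 'm"  (infixl "\<bullet>\<index>" 70)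

record ('k, 'o, 'm) tens_cat = "('k, 'o, 'm) lin_cat" +
  unit_ob :: "'o"  ("\<one>\<index>")
  tens_ob :: "'o \<Rightarrow> 'o \<Rightarrow> 'o"  (infixl "\<otimes>\<index>" 75)
  tens    :: "'m \<Rightarrow> 'm \<Rightarrow> 'm"  (infixl "\<otimes>\<^sub>m\<index>" 75)

text \<open>\<open>coev'\<close> and \<open>ev'\<close> are the morphisms usually written with a tilde.\<close>

record ('k, 'o, 'm) piv_cat = "('k, 'o, 'm) tens_cat" +
  dual  :: "'o \<Rightarrow> 'o"
  coev  :: "'o \<Rightarrow> 'm"
  ev    :: "'o \<Rightarrow> 'm"
  coev' :: "'o \<Rightarrow> 'm"
  ev'   :: "'o \<Rightarrow> 'm"

definition is_iso :: "('k, 'o, 'm, 'x) lin_cat_scheme \<Rightarrow> 'o \<Rightarrow> 'o \<Rightarrow> 'm \<Rightarrow> bool"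
  where "is_iso C V W f \<longleftrightarrow>
    f \<in> Hom V W \<and> (\<exists>g \<in> Hom W V. g \<bullet> f = Id V \<and> f \<bullet> g = Id W)"
  for C (structure)

definition isomorphic :: "('k, 'o, 'm, 'x) lin_cat_scheme \<Rightarrow> 'o \<Rightarrow> 'o \<Rightarrow> bool"
  where "isomorphic C V W \<longleftrightarrow> (\<exists>f. is_iso C V W f)"

definition epi :: "('k, 'o, 'm, 'x) lin_cat_scheme \<Rightarrow> 'o \<Rightarrow> 'o \<Rightarrow> 'm \<Rightarrow> bool"
  where "epi C V W f \<longleftrightarrow>
    f \<in> Hom V W \<and> (\<forall>U. \<forall>a \<in> Hom W U. \<forall>b \<in> Hom W U. a \<bullet> f = b \<bullet> f \<longrightarrow> a = b)"
  for C (structure)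

definition projective :: "('k, 'o, 'm, 'x) lin_cat_scheme \<Rightarrow> 'o \<Rightarrow> bool"
  where "projective C P \<longleftrightarrow>
    (\<forall>V W p f. epi C V W p \<longrightarrow> f \<in> Hom P W \<longrightarrow> (\<exists>h \<in> Hom P V. p \<bullet> h = f))"
  for C (structure)

definition simple :: "('k, 'o, 'm::zero, 'x) lin_cat_scheme \<Rightarrow> 'o \<Rightarrow> bool"
  where "simple C V \<longleftrightarrow> Id V \<noteq> 0 \<and> Hom V V = {a \<cdot> Id V | a. True}"
  for C (structure)

definition direct_sum ::
  "('k, 'o, 'm::comm_monoid_add, 'x) lin_cat_scheme \<Rightarrow> 'o \<Rightarrow> 'j set \<Rightarrow> ('j \<Rightarrow> 'o) \<Rightarrow> bool"
  where "direct_sum C V J W \<longleftrightarrow> finite J \<and>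
    (\<exists>i p. (\<forall>j\<in>J. i j \<in> Hom (W j) V \<and> p j \<in> Hom V (W j)) \<and>
           (\<forall>j\<in>J. \<forall>l\<in>J. p j \<bullet> i l = (if j = l then Id (W j) else 0)) \<and>
           (\<Sum>j\<in>J. i j \<bullet> p j) = Id V)"
  for C (structure)

definition dominated ::
  "('k::comm_ring_1, 'o, 'm::ab_group_add, 'x) lin_cat_scheme \<Rightarrow> 'o \<Rightarrow> 'o set \<Rightarrow> bool"
  where "dominated C V S \<longleftrightarrow>
    Id V \<in> module.span (scale C) {b \<bullet> a | a b U. U \<in> S \<and> a \<in> Hom V U \<and> b \<in> Hom U V}"
  for C (structure)

locale linear_category =
  fixes C :: "('k::field, 'o, 'm::ab_group_add, 'x) lin_cat_scheme" (structure)
  assumes vector_space: "vector_space (scale C)"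
    and subspace_Hom: "module.subspace (scale C) (Hom V W)"
    and Hom_disjoint: "f \<in> Hom V W \<Longrightarrow> f \<in> Hom V' W' \<Longrightarrow> f \<noteq> 0 \<Longrightarrow> V = V' \<and> W = W'"
    and Id_in_Hom: "Id V \<in> Hom V V"
    and cmp_in_Hom: "f \<in> Hom U V \<Longrightarrow> g \<in> Hom V W \<Longrightarrow> g \<bullet> f \<in> Hom U W"
    and cmp_assoc: "f \<in> Hom U V \<Longrightarrow> g \<in> Hom V W \<Longrightarrow> h \<in> Hom W W' \<Longrightarrow>
          (h \<bullet> g) \<bullet> f = h \<bullet> (g \<bullet> f)"
    and cmp_Id_left: "f \<in> Hom U V \<Longrightarrow> Id V \<bullet> f = f"
    and cmp_Id_right: "f \<in> Hom U V \<Longrightarrow> f \<bullet> Id U = f"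
    and cmp_linear_left: "f \<in> Hom U V \<Longrightarrow> g \<in> Hom V W \<Longrightarrow> g' \<in> Hom V W \<Longrightarrow>
          (a \<cdot> g + a' \<cdot> g') \<bullet> f = a \<cdot> (g \<bullet> f) + a' \<cdot> (g' \<bullet> f)"
    and cmp_linear_right: "f \<in> Hom U V \<Longrightarrow> f' \<in> Hom U V \<Longrightarrow> g \<in> Hom V W \<Longrightarrow>
          g \<bullet> (a \<cdot> f + a' \<cdot> f') = a \<cdot> (g \<bullet> f) + a' \<cdot> (g \<bullet> f')"

locale tensor_category = linear_category C
  for C :: "('k::field, 'o, 'm::ab_group_add, 'x) tens_cat_scheme" (structure) +
  assumes tens_in_Hom: "f \<in> Hom V W \<Longrightarrow> f' \<in> Hom V' W' \<Longrightarrow>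
          f \<otimes>\<^sub>m f' \<in> Hom (V \<otimes> V') (W \<otimes> W')"
    and tens_Id: "Id V \<otimes>\<^sub>m Id W = Id (V \<otimes> W)"
    and tens_cmp: "f \<in> Hom U V \<Longrightarrow> g \<in> Hom V W \<Longrightarrow> f' \<in> Hom U' V' \<Longrightarrow> g' \<in> Hom V' W' \<Longrightarrow>
          (g \<bullet> f) \<otimes>\<^sub>m (g' \<bullet> f') = (g \<otimes>\<^sub>m g') \<bullet> (f \<otimes>\<^sub>m f')"
    and tens_linear_left: "f \<in> Hom V W \<Longrightarrow> f' \<in> Hom V W \<Longrightarrow> g \<in> Hom V' W' \<Longrightarrow>
          (a \<cdot> f + a' \<cdot> f') \<otimes>\<^sub>m g = a \<cdot> (f \<otimes>\<^sub>m g) + a' \<cdot> (f' \<otimes>\<^sub>m g)"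
    and tens_linear_right: "f \<in> Hom V W \<Longrightarrow> g \<in> Hom V' W' \<Longrightarrow> g' \<in> Hom V' W' \<Longrightarrow>
          f \<otimes>\<^sub>m (a \<cdot> g + a' \<cdot> g') = a \<cdot> (f \<otimes>\<^sub>m g) + a' \<cdot> (f \<otimes>\<^sub>m g')"
    and tens_ob_assoc: "(U \<otimes> V) \<otimes> W = U \<otimes> (V \<otimes> W)"
    and tens_ob_unit_left: "\<one> \<otimes> V = V"
    and tens_ob_unit_right: "V \<otimes> \<one> = V"
    and tens_assoc: "f \<in> Hom U U' \<Longrightarrow> g \<in> Hom V V' \<Longrightarrow> h \<in> Hom W W' \<Longrightarrow>
          (f \<otimes>\<^sub>m g) \<otimes>\<^sub>m h = f \<otimes>\<^sub>m (g \<otimes>\<^sub>m h)"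
    and tens_unit_left: "f \<in> Hom V W \<Longrightarrow> Id \<one> \<otimes>\<^sub>m f = f"
    and tens_unit_right: "f \<in> Hom V W \<Longrightarrow> f \<otimes>\<^sub>m Id \<one> = f"
    and End_unit: "bij_betw (\<lambda>a. a \<cdot> Id \<one>) UNIV (Hom \<one> \<one>)"

text \<open>
  The compatibilities are: the four zigzag identities, and equality of the left and right
  dual functors, on morphisms and in their monoidal structure
  \<open>W\<^sup>* \<otimes> V\<^sup>* \<rightarrow> (V \<otimes> W)\<^sup>*\<close>.
\<close>

locale pivotal_category = tensor_category C
  for C :: "('k::field, 'o, 'm::ab_group_add, 'x) piv_cat_scheme" (structure) +
  assumes coev_in_Hom: "coev C V \<in> Hom \<one> (V \<otimes> dual C V)"
    and ev_in_Hom: "ev C V \<in> Hom (dual C V \<otimes> V) \<one>"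
    and coev'_in_Hom: "coev' C V \<in> Hom \<one> (dual C V \<otimes> V)"
    and ev'_in_Hom: "ev' C V \<in> Hom (V \<otimes> dual C V) \<one>"
    and zigzag: "(Id V \<otimes>\<^sub>m ev C V) \<bullet> (coev C V \<otimes>\<^sub>m Id V) = Id V"
    and zigzag_dual:
      "(ev C V \<otimes>\<^sub>m Id (dual C V)) \<bullet> (Id (dual C V) \<otimes>\<^sub>m coev C V) = Id (dual C V)"
    and zigzag': "(ev' C V \<otimes>\<^sub>m Id V) \<bullet> (Id V \<otimes>\<^sub>m coev' C V) = Id V"
    and zigzag'_dual:
      "(Id (dual C V) \<otimes>\<^sub>m ev' C V) \<bullet> (coev' C V \<otimes>\<^sub>m Id (dual C V)) = Id (dual C V)"
    and dual_mor_eq: "f \<in> Hom V W \<Longrightarrow>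
      (ev C W \<otimes>\<^sub>m Id (dual C V)) \<bullet> (Id (dual C W) \<otimes>\<^sub>m f \<otimes>\<^sub>m Id (dual C V))
        \<bullet> (Id (dual C W) \<otimes>\<^sub>m coev C V)
      = (Id (dual C V) \<otimes>\<^sub>m ev' C W) \<bullet> (Id (dual C V) \<otimes>\<^sub>m f \<otimes>\<^sub>m Id (dual C W))
        \<bullet> (coev' C V \<otimes>\<^sub>m Id (dual C W))"
    and dual_tens_eq:
      "(ev C W \<otimes>\<^sub>m Id (dual C (V \<otimes> W)))
        \<bullet> (Id (dual C W) \<otimes>\<^sub>m ev C V \<otimes>\<^sub>m Id (W \<otimes> dual C (V \<otimes> W)))
        \<bullet> (Id (dual C W \<otimes> dual C V) \<otimes>\<^sub>m coev C (V \<otimes> W))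
      = (Id (dual C (V \<otimes> W)) \<otimes>\<^sub>m ev' C V)
        \<bullet> (Id (dual C (V \<otimes> W) \<otimes> V) \<otimes>\<^sub>m ev' C W \<otimes>\<^sub>m Id (dual C V))
        \<bullet> (coev' C (V \<otimes> W) \<otimes>\<^sub>m Id (dual C W \<otimes> dual C V))"


section \<open>Hermitian and ribbon structures\<close>

locale field_involution =
  fixes bar :: "'k::field \<Rightarrow> 'k"
  assumes bar_add: "bar (x + y) = bar x + bar y"
    and bar_mult: "bar (x * y) = bar x * bar y"
    and bar_bar: "bar (bar x) = x"

locale sesquilinear_pivotal_category = pivotal_category C + field_involution bar
  for C :: "('k::field, 'o, 'm::ab_group_add, 'x) piv_cat_scheme" (structure)
    and bar :: "'k \<Rightarrow> 'k" +
  fixes dag :: "'m \<Rightarrow> 'm"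
  assumes dag_bij: "bij_betw dag (Hom V W) (Hom W V)"
    and dag_antilinear: "f \<in> Hom V W \<Longrightarrow> g \<in> Hom V W \<Longrightarrow>
          dag (a \<cdot> f + b \<cdot> g) = bar a \<cdot> dag f + bar b \<cdot> dag g"
    and dag_tens: "f \<in> Hom V W \<Longrightarrow> g \<in> Hom V' W' \<Longrightarrow> dag (f \<otimes>\<^sub>m g) = dag f \<otimes>\<^sub>m dag g"
    and dag_cmp: "g \<in> Hom U V \<Longrightarrow> f \<in> Hom V W \<Longrightarrow> dag (f \<bullet> g) = dag g \<bullet> dag f"
    and dag_coev: "dag (coev C V) = ev' C V"
    and dag_ev: "dag (ev C V) = coev' C V"
    and dag_coev': "dag (coev' C V) = ev C V"
    and dag_ev': "dag (ev' C V) = coev C V"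

locale hermitian_pivotal_category = sesquilinear_pivotal_category C bar dag
  for C :: "('k::field, 'o, 'm::ab_group_add, 'x) piv_cat_scheme" (structure)
    and bar :: "'k \<Rightarrow> 'k" and dag :: "'m \<Rightarrow> 'm" +
  assumes dag_dag: "f \<in> Hom V W \<Longrightarrow> dag (dag f) = f"

definition right_twist ::
  "('k, 'o, 'm, 'x) piv_cat_scheme \<Rightarrow> ('o \<Rightarrow> 'o \<Rightarrow> 'm) \<Rightarrow> 'o \<Rightarrow> 'm"
  where "right_twist C c V =
    (Id V \<otimes>\<^sub>m ev' C V) \<bullet> (c V V \<otimes>\<^sub>m Id (dual C V)) \<bullet> (Id V \<otimes>\<^sub>m coev C V)"
  for C (structure)

definition left_twist ::
  "('k, 'o, 'm, 'x) piv_cat_scheme \<Rightarrow> ('o \<Rightarrow> 'o \<Rightarrow> 'm) \<Rightarrow> 'o \<Rightarrow> 'm"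
  where "left_twist C c V =
    (ev C V \<otimes>\<^sub>m Id V) \<bullet> (Id (dual C V) \<otimes>\<^sub>m c V V) \<bullet> (coev' C V \<otimes>\<^sub>m Id V)"
  for C (structure)

locale ribbon_category = pivotal_category C
  for C :: "('k::field, 'o, 'm::ab_group_add, 'x) piv_cat_scheme" (structure) +
  fixes c :: "'o \<Rightarrow> 'o \<Rightarrow> 'm"
  assumes braiding_iso: "is_iso C (V \<otimes> W) (W \<otimes> V) (c V W)"
    and braiding_natural: "f \<in> Hom V W \<Longrightarrow> g \<in> Hom V' W' \<Longrightarrow>
          c W W' \<bullet> (f \<otimes>\<^sub>m g) = (g \<otimes>\<^sub>m f) \<bullet> c V V'"
    and braiding_tens_right: "c U (V \<otimes> W) = (Id V \<otimes>\<^sub>m c U W) \<bullet> (c U V \<otimes>\<^sub>m Id W)"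
    and braiding_tens_left: "c (U \<otimes> V) W = (c U W \<otimes>\<^sub>m Id V) \<bullet> (Id U \<otimes>\<^sub>m c V W)"
    and twists_eq: "left_twist C c V = right_twist C c V"

locale hermitian_ribbon_category =
  hermitian_pivotal_category C bar dag + ribbon_category C c
  for C :: "('k::field, 'o, 'm::ab_group_add, 'x) piv_cat_scheme" (structure)
    and bar :: "'k \<Rightarrow> 'k" and dag :: "'m \<Rightarrow> 'm" and c :: "'o \<Rightarrow> 'o \<Rightarrow> 'm" +
  assumes dag_braiding_left: "dag (c V W) \<bullet> c V W = Id (V \<otimes> W)"
    and dag_braiding_right: "c V W \<bullet> dag (c V W) = Id (W \<otimes> V)"


section \<open>Modified traces\<close>

definition m_trace ::
  "('k::field, 'o, 'm::ab_group_add, 'x) piv_cat_scheme \<Rightarrow> ('o \<Rightarrow> 'm \<Rightarrow> 'k) \<Rightarrow> bool"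
  where "m_trace C t \<longleftrightarrow>
    (\<forall>V a b f g. projective C V \<longrightarrow> f \<in> Hom V V \<longrightarrow> g \<in> Hom V V \<longrightarrow>
       t V (a \<cdot> f + b \<cdot> g) = a * t V f + b * t V g) \<and>
    (\<forall>U V f g. projective C U \<longrightarrow> projective C V \<longrightarrow> f \<in> Hom V U \<longrightarrow> g \<in> Hom U V \<longrightarrow>
       t V (g \<bullet> f) = t U (f \<bullet> g)) \<and>
    (\<forall>U W f. projective C U \<longrightarrow> f \<in> Hom (U \<otimes> W) (U \<otimes> W) \<longrightarrow>
       t (U \<otimes> W) f =
       t U ((Id U \<otimes>\<^sub>m ev' C W) \<bullet> (f \<otimes>\<^sub>m Id (dual C W)) \<bullet> (Id U \<otimes>\<^sub>m coev C W))) \<and>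
    (\<forall>U W f. projective C U \<longrightarrow> f \<in> Hom (W \<otimes> U) (W \<otimes> U) \<longrightarrow>
       t (W \<otimes> U) f =
       t U ((ev C W \<otimes>\<^sub>m Id U) \<bullet> (Id (dual C W) \<otimes>\<^sub>m f) \<bullet> (coev' C W \<otimes>\<^sub>m Id U)))"
  for C (structure)

definition nonzero_m_trace ::
  "('k::field, 'o, 'm::ab_group_add, 'x) piv_cat_scheme \<Rightarrow> ('o \<Rightarrow> 'm \<Rightarrow> 'k) \<Rightarrow> bool"
  where "nonzero_m_trace C t \<longleftrightarrow> m_trace C t \<and>
    (\<exists>V f. projective C V \<and> f \<in> Hom V V \<and> t V f \<noteq> 0)"
  for C (structure)

definition real_m_trace ::
  "('k::field, 'o, 'm::ab_group_add, 'x) piv_cat_scheme \<Rightarrow> ('k \<Rightarrow> 'k) \<Rightarrow> ('m \<Rightarrow> 'm) \<Rightarrow>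
    ('o \<Rightarrow> 'm \<Rightarrow> 'k) \<Rightarrow> bool"
  where "real_m_trace C bar dag t \<longleftrightarrow> m_trace C t \<and>
    (\<forall>V f. projective C V \<longrightarrow> f \<in> Hom V V \<longrightarrow> t V (dag f) = bar (t V f))"
  for C (structure)


section \<open>Gradings and generic semisimplicity\<close>

text \<open>
  A full subcategory is given by its set of objects, not assumed to be closed under
  isomorphism.  \<open>C = \<Oplus>\<^sub>g C\<^sub>g\<close> says that every object is a finite direct sum of objects
  of pairwise distinct degrees.  A subcategory counts as non-empty if it contains a non-zero
  object.
\<close>

locale graded_category = tensor_category C
  for C :: "('k::field, 'o, 'm::ab_group_add, 'x) tens_cat_scheme" (structure) +
  fixes deg :: "'g::ab_group_add \<Rightarrow> 'o set"
  assumes deg_nonzero: "\<exists>V \<in> deg g. Id V \<noteq> 0"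
    and deg_decomp: "\<exists>F W. (\<forall>g\<in>F. W g \<in> deg g) \<and> direct_sum C V F W"
    and deg_unit: "\<one> \<in> deg 0"
    and deg_tens: "V \<in> deg g \<Longrightarrow> W \<in> deg h \<Longrightarrow> V \<otimes> W \<in> deg (g + h)"
    and deg_Hom: "V \<in> deg g \<Longrightarrow> W \<in> deg h \<Longrightarrow> g \<noteq> h \<Longrightarrow> Hom V W = {0}"

definition symmetric_set :: "'g::ab_group_add set \<Rightarrow> bool"
  where "symmetric_set X \<longleftrightarrow> uminus ` X = X"

definition small_set :: "'g::ab_group_add set \<Rightarrow> bool"
  where "small_set X \<longleftrightarrow> \<not> (\<exists>S. finite S \<and> (\<Union>s\<in>S. (\<lambda>x. s + x) ` X) = UNIV)"

text \<open>
  Semisimplicity of \<open>C\<^sub>g\<close>, for a set \<open>D\<close> of objects.  As simplicity means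
  \<open>End(V) = \<bbbk> Id\<^sub>V\<close> and \<open>C\<close> is not assumed to be abelian, the vanishing of morphisms
  between non-isomorphic simple objects is part of the definition.
\<close>

definition semisimple_on ::
  "('k, 'o, 'm::comm_monoid_add, 'x) lin_cat_scheme \<Rightarrow> 'o set \<Rightarrow> bool"
  where "semisimple_on C D \<longleftrightarrow>
    (\<forall>V \<in> D. \<exists>(n::nat) W. (\<forall>j<n. W j \<in> D \<and> simple C (W j)) \<and> direct_sum C V {..<n} W) \<and>
    (\<forall>V \<in> D. \<forall>W \<in> D. simple C V \<longrightarrow> simple C W \<longrightarrow> \<not> isomorphic C V W \<longrightarrow> Hom V W = {0})"
  for C (structure)

locale generically_semisimple_category = graded_category C deg
  for C :: "('k::field, 'o, 'm::ab_group_add, 'x) tens_cat_scheme" (structure)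
    and deg :: "'g::ab_group_add \<Rightarrow> 'o set" +
  fixes X :: "'g set"
  assumes X_symmetric: "symmetric_set X"
    and X_small: "small_set X"
    and generic_semisimple: "g \<notin> X \<Longrightarrow> semisimple_on C (deg g)"

locale generically_finitely_semisimple_category = generically_semisimple_category C deg X
  for C :: "('k::field, 'o, 'm::ab_group_add, 'x) tens_cat_scheme" (structure)
    and deg :: "'g::ab_group_add \<Rightarrow> 'o set" and X :: "'g set" +
  assumes generic_finite: "g \<notin> X \<Longrightarrow>
    \<exists>R. finite R \<and> (\<forall>V \<in> deg g. simple C V \<longrightarrow> (\<exists>W \<in> R. isomorphic C V W))"

definition generic_simples ::
  "('k, 'o, 'm::zero, 'x) lin_cat_scheme \<Rightarrow> ('g \<Rightarrow> 'o set) \<Rightarrow> 'g set \<Rightarrow> 'o set"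
  where "generic_simples C deg X = {V. simple C V \<and> (\<exists>g. g \<notin> X \<and> V \<in> deg g)}"


section \<open>Relative premodular categories\<close>

locale free_realization = ribbon_category C c
  for C :: "('k::field, 'o, 'm::ab_group_add, 'x) piv_cat_scheme" (structure)
    and c :: "'o \<Rightarrow> 'o \<Rightarrow> 'm" +
  fixes \<sigma> :: "'z::ab_group_add \<Rightarrow> 'o"
  assumes \<sigma>_zero: "\<sigma> 0 = \<one>"
    and \<sigma>_add: "\<sigma> \<nu> \<otimes> \<sigma> \<mu> = \<sigma> (\<nu> + \<mu>)"
    and \<sigma>_twist: "right_twist C c (\<sigma> \<nu>) = Id (\<sigma> \<nu>)"
    and \<sigma>_free: "simple C V \<Longrightarrow> isomorphic C (V \<otimes> \<sigma> \<nu>) V \<Longrightarrow> \<nu> = 0"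

definition bilinear_pairing ::
  "('g::ab_group_add \<Rightarrow> 'z::ab_group_add \<Rightarrow> 'k::field) \<Rightarrow> bool"
  where "bilinear_pairing \<psi> \<longleftrightarrow>
    (\<forall>g \<nu>. \<psi> g \<nu> \<noteq> 0) \<and>
    (\<forall>g h \<nu>. \<psi> (g + h) \<nu> = \<psi> g \<nu> * \<psi> h \<nu>) \<and>
    (\<forall>g \<nu> \<mu>. \<psi> g (\<nu> + \<mu>) = \<psi> g \<nu> * \<psi> g \<mu>)"

locale relative_premodular_category =
  ribbon_category C c + generically_semisimple_category C deg X + free_realization C c \<sigma>
  for C :: "('k::field, 'o, 'm::ab_group_add, 'x) piv_cat_scheme" (structure)
    and c :: "'o \<Rightarrow> 'o \<Rightarrow> 'm"
    and deg :: "'g::ab_group_add \<Rightarrow> 'o set" and X :: "'g set"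
    and \<sigma> :: "'z::ab_group_add \<Rightarrow> 'o" +
  fixes t :: "'o \<Rightarrow> 'm \<Rightarrow> 'k"
    and \<psi> :: "'g \<Rightarrow> 'z \<Rightarrow> 'k"
  assumes \<sigma>_deg: "\<sigma> \<nu> \<in> deg 0"
    and trace: "nonzero_m_trace C t"
    and generic_dominated: "g \<notin> X \<Longrightarrow>
      \<exists>I. finite I \<and> I \<subseteq> deg g \<and>
          (\<forall>V\<in>I. simple C V \<and> projective C V \<and> epi C (dual C V \<otimes> V) \<one> (ev C V)) \<and>
          (\<forall>V\<in>deg g. dominated C V {W \<otimes> \<sigma> \<nu> | W \<nu>. W \<in> I})"
    and \<psi>_bilinear: "bilinear_pairing \<psi>"
    and \<psi>_braiding: "V \<in> deg g \<Longrightarrow> c (\<sigma> \<nu>) V \<bullet> c V (\<sigma> \<nu>) = \<psi> g \<nu> \<cdot> Id (V \<otimes> \<sigma> \<nu>)"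

locale relative_hermitian_premodular_category =
  relative_premodular_category C c deg X \<sigma> t \<psi> + hermitian_ribbon_category C bar dag c
  for C :: "('k::field, 'o, 'm::ab_group_add, 'x) piv_cat_scheme" (structure)
    and bar :: "'k \<Rightarrow> 'k" and dag :: "'m \<Rightarrow> 'm"
    and c :: "'o \<Rightarrow> 'o \<Rightarrow> 'm"
    and deg :: "'g::ab_group_add \<Rightarrow> 'o set" and X :: "'g set"
    and \<sigma> :: "'z::ab_group_add \<Rightarrow> 'o"
    and t :: "'o \<Rightarrow> 'm \<Rightarrow> 'k" and \<psi> :: "'g \<Rightarrow> 'z \<Rightarrow> 'k" +
  assumes trace_real: "real_m_trace C bar dag t"


section \<open>The category of graded morphisms\<close>

text \<open>
  The morphism \<open>\<surd>\<psi>(g,\<nu>)\<^sup>-\<^sup>1 c\<^bsub>V,\<sigma>\<^sub>\<nu>\<^esub>\<close> for \<open>V \<in> C\<^sub>g\<close>, extended to arbitrary objects by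
  naturality, that is, additively over the homogeneous components.  Here \<open>r = \<surd>\<psi>\<close>.
\<close>

definition half_braiding ::
  "('k::field, 'o, 'm, 'x) piv_cat_scheme \<Rightarrow> ('o \<Rightarrow> 'o \<Rightarrow> 'm) \<Rightarrow> ('g \<Rightarrow> 'o set) \<Rightarrow>
    ('z \<Rightarrow> 'o) \<Rightarrow> ('g \<Rightarrow> 'z \<Rightarrow> 'k) \<Rightarrow> 'o \<Rightarrow> 'z \<Rightarrow> 'm"
  where "half_braiding C c deg \<sigma> r V \<nu> =
    (THE x. x \<in> Hom (V \<otimes> \<sigma> \<nu>) (\<sigma> \<nu> \<otimes> V) \<and>
       (\<forall>g. \<forall>W \<in> deg g. \<forall>a \<in> Hom W V.
          x \<bullet> (a \<otimes>\<^sub>m Id (\<sigma> \<nu>)) = (Id (\<sigma> \<nu>) \<otimes>\<^sub>m a) \<bullet> (inverse (r g \<nu>) \<cdot> c W (\<sigma> \<nu>))))"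
  for C (structure)

lemma (in relative_premodular_category) half_braiding_homogeneous:
  assumes V: "V \<in> deg g"
  shows "half_braiding C c deg \<sigma> r V \<nu> = inverse (r g \<nu>) \<cdot> c V (\<sigma> \<nu>)"
proof -
  interpret vs: vector_space "scale C" by (rule vector_space)
  let ?s = "inverse (r g \<nu>)"
  have c: "c W (\<sigma> \<nu>) \<in> Hom (W \<otimes> \<sigma> \<nu>) (\<sigma> \<nu> \<otimes> W)" for W
    using braiding_iso[of W "\<sigma> \<nu>"] by (simp add: is_iso_def)
  have sc: "a \<cdot> f \<in> Hom A B" if "f \<in> Hom A B" for a f A B
    using subspace_Hom[of A B] that vs.subspace_scale by blast
  have zero: "0 \<in> Hom A B" for A B
    using subspace_Hom[of A B] vs.subspace_0 by blast
  have cl: "(a \<cdot> h) \<bullet> f = a \<cdot> (h \<bullet> f)" if "f \<in> Hom A B" "h \<in> Hom B D" for a f h A B D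
    using cmp_linear_left[OF that(1) that(2) that(2), of a 0] by simp
  have cr: "h \<bullet> (a \<cdot> f) = a \<cdot> (h \<bullet> f)" if "f \<in> Hom A B" "h \<in> Hom B D" for a f h A B D
    using cmp_linear_right[OF that(1) that(1) that(2), of a 0] by simp
  have z1: "h \<bullet> 0 = 0" if "h \<in> Hom B D" for h B D
    using cr[OF zero that, of 0] by simp
  have z2: "0 \<bullet> f = 0" if "f \<in> Hom A B" for f A B
    using cl[OF that zero, of 0] by simp
  have z3: "0 \<otimes>\<^sub>m f = 0" if "f \<in> Hom A B" for f A B
    using tens_linear_left[OF zero zero that, of 0 0] by simp
  have z4: "f \<otimes>\<^sub>m 0 = 0" if "f \<in> Hom A B" for f A B
    using tens_linear_right[OF that zero zero, of 0 0] by simp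
  show ?thesis
    unfolding half_braiding_def
  proof (rule the_equality, intro conjI allI ballI)
    show "?s \<cdot> c V (\<sigma> \<nu>) \<in> Hom (V \<otimes> \<sigma> \<nu>) (\<sigma> \<nu> \<otimes> V)" by (intro sc c)
  next
    fix h W a assume W: "W \<in> deg h" and a: "a \<in> Hom W V"
    have t1: "a \<otimes>\<^sub>m Id (\<sigma> \<nu>) \<in> Hom (W \<otimes> \<sigma> \<nu>) (V \<otimes> \<sigma> \<nu>)"
      and t2: "Id (\<sigma> \<nu>) \<otimes>\<^sub>m a \<in> Hom (\<sigma> \<nu> \<otimes> W) (\<sigma> \<nu> \<otimes> V)"
      by (intro tens_in_Hom a Id_in_Hom)+
    show "?s \<cdot> c V (\<sigma> \<nu>) \<bullet> (a \<otimes>\<^sub>m Id (\<sigma> \<nu>)) =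
          (Id (\<sigma> \<nu>) \<otimes>\<^sub>m a) \<bullet> (inverse (r h \<nu>) \<cdot> c W (\<sigma> \<nu>))"
    proof (cases "h = g")
      case True
      then show ?thesis
        using cl[OF t1 c] cr[OF c t2] braiding_natural[OF a Id_in_Hom] by simp
    next
      case False
      then have "a = 0" using deg_Hom[OF W V] a by blast
      then show ?thesis
        using z1[OF sc[OF c]] z2[OF sc[OF c]] z3[OF Id_in_Hom] z4[OF Id_in_Hom] by simp
    qed
  next
    fix x
    assume x: "x \<in> Hom (V \<otimes> \<sigma> \<nu>) (\<sigma> \<nu> \<otimes> V) \<and>
       (\<forall>g. \<forall>W \<in> deg g. \<forall>a \<in> Hom W V.
          x \<bullet> (a \<otimes>\<^sub>m Id (\<sigma> \<nu>)) = (Id (\<sigma> \<nu>) \<otimes>\<^sub>m a) \<bullet> (inverse (r g \<nu>) \<cdot> c W (\<sigma> \<nu>)))"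
    then have "x \<bullet> (Id V \<otimes>\<^sub>m Id (\<sigma> \<nu>)) = (Id (\<sigma> \<nu>) \<otimes>\<^sub>m Id V) \<bullet> (?s \<cdot> c V (\<sigma> \<nu>))"
      using V Id_in_Hom by blast
    then show "x = ?s \<cdot> c V (\<sigma> \<nu>)"
      using cmp_Id_left[OF sc[OF c]] cmp_Id_right[OF conjunct1[OF x]] by (simp add: tens_Id)
  qed
qed

text \<open>
  A morphism \<open>V \<rightarrow> W\<close> of \<open>C\<^sup>Z\<close> is a finitely supported family of morphisms
  \<open>f\<^sub>\<nu> : V \<rightarrow> \<sigma>\<^sub>\<nu> \<otimes> W\<close>.  Its target is determined unless it is zero; the operations
  below that use the target are zero on zero morphisms.
\<close>

definition CZ_Hom ::
  "('k, 'o, 'm::zero, 'x) piv_cat_scheme \<Rightarrow> ('z \<Rightarrow> 'o) \<Rightarrow> 'o \<Rightarrow> 'o \<Rightarrow> ('z \<Rightarrow>\<^sub>0 'm) set"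
  where "CZ_Hom C \<sigma> V W = {f. \<forall>\<nu>. Poly_Mapping.lookup f \<nu> \<in> Hom V (\<sigma> \<nu> \<otimes> W)}"
  for C (structure)

definition CZ_target ::
  "('k, 'o, 'm::zero, 'x) piv_cat_scheme \<Rightarrow> ('z \<Rightarrow> 'o) \<Rightarrow> ('z \<Rightarrow>\<^sub>0 'm) \<Rightarrow> 'o"
  where "CZ_target C \<sigma> f = (THE W. \<exists>V. f \<in> CZ_Hom C \<sigma> V W)"

lemma (in free_realization) CZ_target_eq:
  assumes f: "f \<in> CZ_Hom C \<sigma> V W" "f \<noteq> 0"
  shows "CZ_target C \<sigma> f = W"
  unfolding CZ_target_def
proof (rule the_equality)
  show "\<exists>V. f \<in> CZ_Hom C \<sigma> V W" using f by blast
next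
  fix W' assume "\<exists>V. f \<in> CZ_Hom C \<sigma> V W'"
  then obtain V' where f': "f \<in> CZ_Hom C \<sigma> V' W'" by blast
  from f(2) obtain \<nu> where \<nu>: "Poly_Mapping.lookup f \<nu> \<noteq> 0"
    by (metis poly_mapping_eqI lookup_zero)
  have "\<sigma> \<nu> \<otimes> W' = \<sigma> \<nu> \<otimes> W"
    using f(1) f' \<nu> Hom_disjoint unfolding CZ_Hom_def by blast
  then have "\<sigma> (- \<nu>) \<otimes> (\<sigma> \<nu> \<otimes> W') = \<sigma> (- \<nu>) \<otimes> (\<sigma> \<nu> \<otimes> W)" by simp
  then show "W' = W"
    by (simp add: tens_ob_assoc[symmetric] \<sigma>_add \<sigma>_zero tens_ob_unit_left)
qed

definition CZ_cmp ::
  "('k, 'o, 'm::ab_group_add, 'x) piv_cat_scheme \<Rightarrow> ('z::ab_group_add \<Rightarrow> 'o) \<Rightarrow>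
    ('z \<Rightarrow>\<^sub>0 'm) \<Rightarrow> ('z \<Rightarrow>\<^sub>0 'm) \<Rightarrow> ('z \<Rightarrow>\<^sub>0 'm)"
  where "CZ_cmp C \<sigma> g f =
    (\<Sum>\<nu>\<in>Poly_Mapping.keys f. \<Sum>\<mu>\<in>Poly_Mapping.keys g.
       Poly_Mapping.single (\<nu> + \<mu>) ((Id (\<sigma> \<nu>) \<otimes>\<^sub>m Poly_Mapping.lookup g \<mu>) \<bullet> Poly_Mapping.lookup f \<nu>))"
  for C (structure)

definition CZ_tens ::
  "('k::field, 'o, 'm::ab_group_add, 'x) piv_cat_scheme \<Rightarrow> ('o \<Rightarrow> 'o \<Rightarrow> 'm) \<Rightarrow>
    ('g \<Rightarrow> 'o set) \<Rightarrow> ('z::ab_group_add \<Rightarrow> 'o) \<Rightarrow> ('g \<Rightarrow> 'z \<Rightarrow> 'k) \<Rightarrow>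
    ('z \<Rightarrow>\<^sub>0 'm) \<Rightarrow> ('z \<Rightarrow>\<^sub>0 'm) \<Rightarrow> ('z \<Rightarrow>\<^sub>0 'm)"
  where "CZ_tens C c deg \<sigma> r f h =
    (\<Sum>\<nu>\<in>Poly_Mapping.keys f. \<Sum>\<mu>\<in>Poly_Mapping.keys h.
       Poly_Mapping.single (\<nu> + \<mu>)
         ((Id (\<sigma> \<nu>) \<otimes>\<^sub>m half_braiding C c deg \<sigma> r (CZ_target C \<sigma> f) \<mu>
             \<otimes>\<^sub>m Id (CZ_target C \<sigma> h))
          \<bullet> (Poly_Mapping.lookup f \<nu> \<otimes>\<^sub>m Poly_Mapping.lookup h \<mu>)))"
  for C (structure)

definition CZ ::
  "('k::field, 'o, 'm::ab_group_add, 'x) piv_cat_scheme \<Rightarrow> ('o \<Rightarrow> 'o \<Rightarrow> 'm) \<Rightarrow>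
    ('g \<Rightarrow> 'o set) \<Rightarrow> ('z::ab_group_add \<Rightarrow> 'o) \<Rightarrow> ('g \<Rightarrow> 'z \<Rightarrow> 'k) \<Rightarrow>
    ('k, 'o, 'z \<Rightarrow>\<^sub>0 'm) piv_cat"
  where "CZ C c deg \<sigma> r =
    \<lparr> scale = (\<lambda>a. Poly_Mapping.map (scale C a)),
      hom = CZ_Hom C \<sigma>,
      ident = (\<lambda>V. Poly_Mapping.single 0 (ident C V)),
      cmp = CZ_cmp C \<sigma>,
      unit_ob = unit_ob C,
      tens_ob = tens_ob C,
      tens = CZ_tens C c deg \<sigma> r,
      dual = dual C,
      coev = (\<lambda>V. Poly_Mapping.single 0 (coev C V)),
      ev = (\<lambda>V. Poly_Mapping.single 0 (ev C V)),
      coev' = (\<lambda>V. Poly_Mapping.single 0 (coev' C V)),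
      ev' = (\<lambda>V. Poly_Mapping.single 0 (ev' C V)) \<rparr>"

text \<open>
  The canonical isomorphism \<open>\<sigma>\<^bsub>-\<nu>\<^esub>\<^sup>* = \<sigma>\<^bsub>-\<nu>\<^esub>\<^sup>* \<otimes> \<sigma>\<^bsub>-\<nu>\<^esub> \<otimes> \<sigma>\<^sub>\<nu> \<rightarrow> \<sigma>\<^sub>\<nu>\<close>.
\<close>

definition dual_\<sigma>_iso ::
  "('k, 'o, 'm, 'x) piv_cat_scheme \<Rightarrow> ('z::ab_group_add \<Rightarrow> 'o) \<Rightarrow> 'z \<Rightarrow> 'm"
  where "dual_\<sigma>_iso C \<sigma> \<nu> = ev C (\<sigma> (- \<nu>)) \<otimes>\<^sub>m Id (\<sigma> \<nu>)"
  for C (structure)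

text \<open>The summation index is \<open>\<mu> = -\<nu>\<close>.\<close>

definition CZ_dag ::
  "('k, 'o, 'm::ab_group_add, 'x) piv_cat_scheme \<Rightarrow> ('m \<Rightarrow> 'm) \<Rightarrow>
    ('z::ab_group_add \<Rightarrow> 'o) \<Rightarrow> ('z \<Rightarrow>\<^sub>0 'm) \<Rightarrow> ('z \<Rightarrow>\<^sub>0 'm)"
  where "CZ_dag C dag \<sigma> f =
    (\<Sum>\<mu>\<in>Poly_Mapping.keys f.
       Poly_Mapping.single (- \<mu>)
         ((Id (\<sigma> (- \<mu>)) \<otimes>\<^sub>m dag (Poly_Mapping.lookup f \<mu>))
          \<bullet> (((dual_\<sigma>_iso C \<sigma> (- \<mu>) \<otimes>\<^sub>m Id (\<sigma> \<mu>)) \<bullet> coev' C (\<sigma> \<mu>))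
               \<otimes>\<^sub>m Id (CZ_target C \<sigma> f))))"
  for C (structure)


section \<open>Relative spherical categories\<close>

definition irr_representatives ::
  "('k, 'o, 'm::zero, 'x) lin_cat_scheme \<Rightarrow> 'o set \<Rightarrow> 'o set \<Rightarrow> bool"
  where "irr_representatives C D R \<longleftrightarrow>
    R \<subseteq> {V \<in> D. simple C V} \<and>
    (\<forall>V \<in> D. simple C V \<longrightarrow> (\<exists>!W. W \<in> R \<and> isomorphic C V W))"

text \<open>
  The map \<open>b\<close> of the second axiom.  As the \<open>C\<^sub>g\<close> need not be closed under isomorphism,
  duality invariance is stated for every generic simple \<open>W \<cong> V\<^sup>*\<close>.
\<close>

definition spherical_weight ::
  "('k::field, 'o, 'm::ab_group_add, 'x) piv_cat_scheme \<Rightarrow> ('g::ab_group_add \<Rightarrow> 'o set) \<Rightarrow>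
    'g set \<Rightarrow> ('o \<Rightarrow> 'k) \<Rightarrow> bool"
  where "spherical_weight C deg X b \<longleftrightarrow>
    (\<forall>V \<in> generic_simples C deg X. b V \<noteq> 0) \<and>
    (\<forall>V \<in> generic_simples C deg X. \<forall>W \<in> generic_simples C deg X.
       isomorphic C V W \<longrightarrow> b V = b W) \<and>
    (\<forall>V \<in> generic_simples C deg X. \<forall>W \<in> generic_simples C deg X.
       isomorphic C W (dual C V) \<longrightarrow> b W = b V) \<and>
    (\<forall>g\<^sub>1 g\<^sub>2 R\<^sub>1 R\<^sub>2. g\<^sub>1 \<notin> X \<longrightarrow> g\<^sub>2 \<notin> X \<longrightarrow> g\<^sub>1 + g\<^sub>2 \<notin> X \<longrightarrow>
       irr_representatives C (deg g\<^sub>1) R\<^sub>1 \<longrightarrow> irr_representatives C (deg g\<^sub>2) R\<^sub>2 \<longrightarrow>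
       (\<forall>V \<in> generic_simples C deg X \<inter> deg (g\<^sub>1 + g\<^sub>2).
          b V = (\<Sum>V\<^sub>1\<in>R\<^sub>1. \<Sum>V\<^sub>2\<in>R\<^sub>2.
                   b V\<^sub>1 * b V\<^sub>2 * of_nat (vector_space.dim (scale C) (Hom V (V\<^sub>1 \<otimes> V\<^sub>2))))))"
  for C (structure)

definition spherical_trace ::
  "('k::field, 'o, 'm::ab_group_add, 'x) piv_cat_scheme \<Rightarrow> ('g \<Rightarrow> 'o set) \<Rightarrow> 'g set \<Rightarrow>
    ('o \<Rightarrow> 'm \<Rightarrow> 'k) \<Rightarrow> bool"
  where "spherical_trace C deg X t \<longleftrightarrow> m_trace C t \<and>
    (\<forall>V \<in> generic_simples C deg X. projective C V \<and> t V (Id V) \<noteq> 0)"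
  for C (structure)

text \<open>The first axiom asks for some \<open>t\<close>; in the Hermitian case this same trace is real.\<close>

definition relative_spherical ::
  "('k::field, 'o, 'm::ab_group_add, 'x) piv_cat_scheme \<Rightarrow> ('g::ab_group_add \<Rightarrow> 'o set) \<Rightarrow>
    'g set \<Rightarrow> ('o \<Rightarrow> 'm \<Rightarrow> 'k) \<Rightarrow> bool"
  where "relative_spherical C deg X t \<longleftrightarrow>
    pivotal_category C \<and> generically_finitely_semisimple_category C deg X \<and>
    spherical_trace C deg X t \<and> (\<exists>b. spherical_weight C deg X b)"

definition relative_hermitian_spherical ::
  "('k::field, 'o, 'm::ab_group_add, 'x) piv_cat_scheme \<Rightarrow> ('k \<Rightarrow> 'k) \<Rightarrow> ('m \<Rightarrow> 'm) \<Rightarrow>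
    ('g::ab_group_add \<Rightarrow> 'o set) \<Rightarrow> 'g set \<Rightarrow> bool"
  where "relative_hermitian_spherical C bar dag deg X \<longleftrightarrow>
    hermitian_pivotal_category C bar dag \<and>
    (\<exists>t. relative_spherical C deg X t \<and> real_m_trace C bar dag t)"

end

theory Submission
  imports Defs
begin

text \<open>
  Write \<open>\<sigma>\<^sub>\<nu>\<close> for the translation objects.  Since \<open>\<sigma>\<^sub>\<nu> \<otimes> \<sigma>\<^sub>\<mu> = \<sigma>\<^bsub>\<nu>+\<mu>\<^esub>\<close>, tensoring with them is an
  action of the translation group on \<open>C\<close>, and \<open>C\<^sup>Z\<close> is the orbit category of this action: a graded
  morphism is a sum of morphisms \<open>V \<rightarrow> \<sigma>\<^sub>\<nu> \<otimes> W\<close>, and \<open>W\<close> becomes isomorphic to all its translates.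
  All operations are additive, so every identity in \<open>C\<^sup>Z\<close> reduces to graded morphisms of a single
  degree (\<open>zhom_induct\<close>), where it is an identity between string diagrams in \<open>C\<close>.

  The tensor product of \<open>C\<^sup>Z\<close> moves \<open>\<sigma>\<^sub>\<nu>\<close> past an object by the half-braiding, the braiding divided
  by \<open>\<surd>\<psi>\<close>.  It is natural, multiplicative in both arguments and unitary, and it is trivial on the
  translation objects, because they have degree zero and braid trivially among each other.  This gives
  the exchange law (\<open>hb_exchange\<close>), associativity (\<open>hb_assoc\<close>) and compatibility with adjoints
  (\<open>zdag_tens\<close>).  Trivial twist and trivial self-braiding force the dimension of \<open>\<sigma>\<^sub>\<nu>\<close> to be one
  (\<open>\<sigma>_dimension\<close>).  Hence the adjoint of \<open>f\<close> in degree \<open>-\<nu>\<close> is just the translate of the adjoint of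
  the component \<open>f\<^sub>\<nu>\<close>, and the half-braiding turns one coevaluation of \<open>\<sigma>\<^sub>\<nu>\<close> into the other
  (\<open>hb_coev'\<close>), which is what the equality of left and right duals in \<open>C\<^sup>Z\<close> comes down to.

  That \<open>\<one>\<close> has only scalar endomorphisms in \<open>C\<^sup>Z\<close> means \<open>Hom(\<one>, \<sigma>\<^sub>\<nu>) = 0\<close> for \<open>\<nu> \<noteq> 0\<close>.  Degree zero
  may be singular, so the vanishing is first seen after tensoring with a generic simple object with
  epic evaluation (\<open>Hom_unit_\<sigma>\<close>).  In a generic degree, freeness of the action makes the simple
  objects of \<open>C\<close> simple in \<open>C\<^sup>Z\<close>, so direct sum decompositions carry over, and finitely many orbits of
  simple objects give finitely many isomorphism classes.

  The trace of a graded endomorphism is the trace of its component of degree zero.  It is cyclic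
  because translation preserves traces, again by dimension one.  Generic simple objects are projective
  in \<open>C\<^sup>Z\<close> by semisimplicity alone (\<open>generic_simple_projective\<close>), and the trace of their identity is
  not zero because a trace that vanished there would vanish everywhere (\<open>trace_Id_nonzero\<close>).
\<close>


section \<open>Linear algebra of hom-spaces\<close>

sublocale linear_category \<subseteq> vs: vector_space "scale C"
  by (rule vector_space)

context linear_category
begin

lemma zero_in_Hom [simp]: "0 \<in> Hom V W"
  using subspace_Hom vs.subspace_0 by blast

lemma scale_in_Hom: "f \<in> Hom V W \<Longrightarrow> a \<cdot> f \<in> Hom V W"
  using subspace_Hom vs.subspace_scale by blast

lemma add_in_Hom: "f \<in> Hom V W \<Longrightarrow> g \<in> Hom V W \<Longrightarrow> f + g \<in> Hom V W"
  using subspace_Hom vs.subspace_add by blast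

lemma sum_in_Hom: "(\<And>j. j \<in> J \<Longrightarrow> f j \<in> Hom V W) \<Longrightarrow> (\<Sum>j\<in>J. f j) \<in> Hom V W"
  using subspace_Hom vs.subspace_sum by blast

lemma cmp_add_left: "f \<in> Hom U V \<Longrightarrow> g \<in> Hom V W \<Longrightarrow> g' \<in> Hom V W \<Longrightarrow>
    (g + g') \<bullet> f = g \<bullet> f + g' \<bullet> f"
  using cmp_linear_left[of f U V g W g' 1 1] by simp

lemma cmp_add_right: "f \<in> Hom U V \<Longrightarrow> f' \<in> Hom U V \<Longrightarrow> g \<in> Hom V W \<Longrightarrow>
    g \<bullet> (f + f') = g \<bullet> f + g \<bullet> f'"
  using cmp_linear_right[of f U V f' g W 1 1] by simp

lemma cmp_scale_left: "f \<in> Hom U V \<Longrightarrow> g \<in> Hom V W \<Longrightarrow> (a \<cdot> g) \<bullet> f = a \<cdot> (g \<bullet> f)"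
  using cmp_linear_left[of f U V g W g a 0] by simp

lemma cmp_scale_right: "f \<in> Hom U V \<Longrightarrow> g \<in> Hom V W \<Longrightarrow> g \<bullet> (a \<cdot> f) = a \<cdot> (g \<bullet> f)"
  using cmp_linear_right[of f U V f g W a 0] by simp

lemma cmp_zero_left: "f \<in> Hom U V \<Longrightarrow> 0 \<bullet> f = 0"
  using cmp_scale_left[of f U V 0 V 0] by simp

lemma cmp_zero_right: "g \<in> Hom V W \<Longrightarrow> g \<bullet> 0 = 0"
  using cmp_scale_right[of 0 V V g W 0] by simp

lemma cmp_sum_left:
  assumes "f \<in> Hom U V" "\<And>j. j \<in> J \<Longrightarrow> g j \<in> Hom V W"
  shows "(\<Sum>j\<in>J. g j) \<bullet> f = (\<Sum>j\<in>J. g j \<bullet> f)"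
  using assms(2)
  by (induction J rule: infinite_finite_induct)
     (simp_all add: cmp_zero_left[OF assms(1)] cmp_add_left[OF assms(1), of _ W] sum_in_Hom)

lemma cmp_sum_right:
  assumes "g \<in> Hom V W" "\<And>j. j \<in> J \<Longrightarrow> f j \<in> Hom U V"
  shows "g \<bullet> (\<Sum>j\<in>J. f j) = (\<Sum>j\<in>J. g \<bullet> f j)"
  using assms(2)
  by (induction J rule: infinite_finite_induct)
     (simp_all add: cmp_zero_right[OF assms(1)] cmp_add_right[OF _ _ assms(1), of _ U] sum_in_Hom)

text \<open>
  If \<open>V\<close> is cut into pieces, that is \<open>\<Sum>\<^sub>j i\<^sub>j \<bullet> p\<^sub>j = Id\<close>, every morphism into or out of \<open>V\<close>
  is the sum of its restrictions to the pieces.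
\<close>

lemma resolution_of_identity:
  assumes i: "\<And>j. j \<in> J \<Longrightarrow> i j \<in> Hom (W j) V" and p: "\<And>j. j \<in> J \<Longrightarrow> p j \<in> Hom V (W j)"
    and Id: "(\<Sum>j\<in>J. i j \<bullet> p j) = Id V"
  shows "x \<in> Hom U V \<Longrightarrow> x = (\<Sum>j\<in>J. i j \<bullet> (p j \<bullet> x))"
    and "y \<in> Hom V U \<Longrightarrow> y = (\<Sum>j\<in>J. (y \<bullet> i j) \<bullet> p j)"
proof -
  have ip: "i j \<bullet> p j \<in> Hom V V" if "j \<in> J" for j using cmp_in_Hom[OF p i] that by blast
  show "x = (\<Sum>j\<in>J. i j \<bullet> (p j \<bullet> x))" if x: "x \<in> Hom U V"
  proof -
    have "x = (\<Sum>j\<in>J. i j \<bullet> p j) \<bullet> x" using Id x by (simp add: cmp_Id_left)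
    also have "\<dots> = (\<Sum>j\<in>J. (i j \<bullet> p j) \<bullet> x)" by (rule cmp_sum_left[OF x ip])
    also have "\<dots> = (\<Sum>j\<in>J. i j \<bullet> (p j \<bullet> x))" by (intro sum.cong refl cmp_assoc[OF x p i])
    finally show ?thesis .
  qed
  show "y = (\<Sum>j\<in>J. (y \<bullet> i j) \<bullet> p j)" if y: "y \<in> Hom V U"
  proof -
    have "y = y \<bullet> (\<Sum>j\<in>J. i j \<bullet> p j)" using Id y by (simp add: cmp_Id_right)
    also have "\<dots> = (\<Sum>j\<in>J. y \<bullet> (i j \<bullet> p j))" by (rule cmp_sum_right[OF y ip])
    also have "\<dots> = (\<Sum>j\<in>J. (y \<bullet> i j) \<bullet> p j)" by (intro sum.cong refl cmp_assoc[OF p i y, symmetric])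
    finally show ?thesis .
  qed
qed

lemma is_isoI:
  "f \<in> Hom V W \<Longrightarrow> g \<in> Hom W V \<Longrightarrow> g \<bullet> f = Id V \<Longrightarrow> f \<bullet> g = Id W \<Longrightarrow> is_iso C V W f"
  unfolding is_iso_def by blast

lemma is_isoE:
  assumes "is_iso C V W f"
  obtains g where "f \<in> Hom V W" "g \<in> Hom W V" "g \<bullet> f = Id V" "f \<bullet> g = Id W"
  using assms unfolding is_iso_def by blast

lemma isomorphic_sym: "isomorphic C V W \<Longrightarrow> isomorphic C W V"
  unfolding isomorphic_def is_iso_def by blast

lemma isomorphic_trans:
  assumes "isomorphic C U V" "isomorphic C V W"
  shows "isomorphic C U W"
proof -
  obtain f f' where f: "f \<in> Hom U V" "f' \<in> Hom V U" "f' \<bullet> f = Id U" "f \<bullet> f' = Id V"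
    using assms(1) unfolding isomorphic_def by (auto elim: is_isoE)
  obtain g g' where g: "g \<in> Hom V W" "g' \<in> Hom W V" "g' \<bullet> g = Id V" "g \<bullet> g' = Id W"
    using assms(2) unfolding isomorphic_def by (auto elim: is_isoE)
  have "g' \<bullet> (g \<bullet> f) = f"
    using cmp_assoc[OF f(1) g(1,2)] g(3) cmp_Id_left[OF f(1)] by simp
  then have 1: "(f' \<bullet> g') \<bullet> (g \<bullet> f) = Id U"
    using cmp_assoc[OF cmp_in_Hom[OF f(1) g(1)] g(2) f(2)] f(3) by simp
  have "f \<bullet> (f' \<bullet> g') = g'"
    using cmp_assoc[OF g(2) f(2,1)] f(4) cmp_Id_left[OF g(2)] by simp
  then have 2: "(g \<bullet> f) \<bullet> (f' \<bullet> g') = Id W"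
    using cmp_assoc[OF cmp_in_Hom[OF g(2) f(2)] f(1) g(1)] g(4) by simp
  show ?thesis
    unfolding isomorphic_def using is_isoI[OF _ _ 1 2] cmp_in_Hom f g by blast
qed

lemma simple_scalar:
  assumes "simple C V" "f \<in> Hom V V"
  obtains a where "f = a \<cdot> Id V"
  using assms unfolding simple_def by blast

end

context tensor_category
begin

lemma tens_add_left: "f \<in> Hom V W \<Longrightarrow> f' \<in> Hom V W \<Longrightarrow> g \<in> Hom V' W' \<Longrightarrow>
    (f + f') \<otimes>\<^sub>m g = f \<otimes>\<^sub>m g + f' \<otimes>\<^sub>m g"
  using tens_linear_left[of f V W f' g V' W' 1 1] by simp

lemma tens_add_right: "f \<in> Hom V W \<Longrightarrow> g \<in> Hom V' W' \<Longrightarrow> g' \<in> Hom V' W' \<Longrightarrow>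
    f \<otimes>\<^sub>m (g + g') = f \<otimes>\<^sub>m g + f \<otimes>\<^sub>m g'"
  using tens_linear_right[of f V W g V' W' g' 1 1] by simp

lemma tens_scale_left: "f \<in> Hom V W \<Longrightarrow> g \<in> Hom V' W' \<Longrightarrow> (a \<cdot> f) \<otimes>\<^sub>m g = a \<cdot> (f \<otimes>\<^sub>m g)"
  using tens_linear_left[of f V W f g V' W' a 0] by simp

lemma tens_scale_right: "f \<in> Hom V W \<Longrightarrow> g \<in> Hom V' W' \<Longrightarrow> f \<otimes>\<^sub>m (a \<cdot> g) = a \<cdot> (f \<otimes>\<^sub>m g)"
  using tens_linear_right[of f V W g V' W' g a 0] by simp

lemma tens_zero_left: "g \<in> Hom V W \<Longrightarrow> 0 \<otimes>\<^sub>m g = 0"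
  using tens_scale_left[of 0 V V g V W 0] by simp

lemma tens_zero_right: "f \<in> Hom V W \<Longrightarrow> f \<otimes>\<^sub>m 0 = 0"
  using tens_scale_right[of f V W 0 V V 0] by simp

end


section \<open>Arrows that carry their endpoints\<close>

text \<open>
  A morphism of \<open>C\<close> does not determine its source and target when it is zero.  Tagging it
  with both makes composability of a string diagram a condition on the functions \<open>src\<close> and
  \<open>tgt\<close> that rewriting can decide, so that the exchange law can be used as an equation.
\<close>

datatype ('o, 'm) arrow = Arrow (src: 'o) (tgt: 'o) (mor: 'm)

context tensor_category
begin

definition arr :: "('o, 'm) arrow \<Rightarrow> bool"
  where "arr f \<longleftrightarrow> mor f \<in> Hom (src f) (tgt f)"

definition comp :: "('o, 'm) arrow \<Rightarrow> ('o, 'm) arrow \<Rightarrow> ('o, 'm) arrow"  (infixr "\<odot>" 70)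
  where "g \<odot> f = Arrow (src f) (tgt g) (mor g \<bullet> mor f)"

definition tensor :: "('o, 'm) arrow \<Rightarrow> ('o, 'm) arrow \<Rightarrow> ('o, 'm) arrow"  (infixr "\<boxtimes>" 75)
  where "f \<boxtimes> g = Arrow (src f \<otimes> src g) (tgt f \<otimes> tgt g) (mor f \<otimes>\<^sub>m mor g)"

definition idt :: "'o \<Rightarrow> ('o, 'm) arrow"
  where "idt V = Arrow V V (Id V)"

lemma arrow_simps [simp]:
  "src (g \<odot> f) = src f" "tgt (g \<odot> f) = tgt g" "mor (g \<odot> f) = mor g \<bullet> mor f"
  "src (f \<boxtimes> g) = src f \<otimes> src g" "tgt (f \<boxtimes> g) = tgt f \<otimes> tgt g"
  "mor (f \<boxtimes> g) = mor f \<otimes>\<^sub>m mor g"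
  "src (idt V) = V" "tgt (idt V) = V" "mor (idt V) = Id V"
  by (simp_all add: comp_def tensor_def idt_def)

lemmas tens_ob_simps [simp] = tens_ob_assoc tens_ob_unit_left tens_ob_unit_right

lemma arr_Arrow [simp]: "arr (Arrow V W f) \<longleftrightarrow> f \<in> Hom V W"
  by (simp add: arr_def)

lemma arr_idt [simp]: "arr (idt V)"
  by (simp add: arr_def Id_in_Hom)

lemma arr_comp [simp]: "arr f \<Longrightarrow> arr g \<Longrightarrow> tgt f = src g \<Longrightarrow> arr (g \<odot> f)"
  by (auto simp: arr_def intro: cmp_in_Hom)

lemma arr_tensor [simp]: "arr f \<Longrightarrow> arr g \<Longrightarrow> arr (f \<boxtimes> g)"
  by (auto simp: arr_def intro: tens_in_Hom)

lemma comp_assoc [simp]: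
  "arr f \<Longrightarrow> arr g \<Longrightarrow> arr h \<Longrightarrow> tgt f = src g \<Longrightarrow> tgt g = src h \<Longrightarrow>
    (h \<odot> g) \<odot> f = h \<odot> g \<odot> f"
  unfolding arr_def comp_def by simp (metis cmp_assoc)

lemma comp_idt_left [simp]: "arr f \<Longrightarrow> tgt f = V \<Longrightarrow> idt V \<odot> f = f"
  by (cases f) (auto simp: comp_def idt_def cmp_Id_left)

lemma comp_idt_right [simp]: "arr f \<Longrightarrow> src f = V \<Longrightarrow> f \<odot> idt V = f"
  by (cases f) (auto simp: comp_def idt_def cmp_Id_right)

lemma tensor_assoc [simp]: "arr f \<Longrightarrow> arr g \<Longrightarrow> arr h \<Longrightarrow> (f \<boxtimes> g) \<boxtimes> h = f \<boxtimes> g \<boxtimes> h"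
  unfolding arr_def tensor_def by simp (metis tens_assoc)

lemma tensor_idt: "idt V \<boxtimes> idt W = idt (V \<otimes> W)"
  by (simp add: tensor_def idt_def tens_Id)

lemma tensor_idt_idt: "arr f \<Longrightarrow> idt V \<boxtimes> idt W \<boxtimes> f = idt (V \<otimes> W) \<boxtimes> f"
  by (simp add: tensor_assoc[symmetric] tensor_idt del: tensor_assoc)

lemma tensor_unit_left [simp]: "arr f \<Longrightarrow> idt \<one> \<boxtimes> f = f"
  by (cases f) (simp add: tensor_def idt_def tens_unit_left)

lemma tensor_unit_right [simp]: "arr f \<Longrightarrow> f \<boxtimes> idt \<one> = f"
  by (cases f) (simp add: tensor_def idt_def tens_unit_right)

text \<open>The exchange law, oriented so that rewriting merges two layers of a diagram.\<close>

lemma exchange: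
  "arr f \<Longrightarrow> arr g \<Longrightarrow> arr f' \<Longrightarrow> arr g' \<Longrightarrow> tgt f = src g \<Longrightarrow> tgt f' = src g' \<Longrightarrow>
    (g \<boxtimes> g') \<odot> (f \<boxtimes> f') = (g \<odot> f) \<boxtimes> (g' \<odot> f')"
  using tens_cmp[of "mor f" "src f" "src g" "mor g" "tgt g" "mor f'" "src f'" "src g'" "mor g'" "tgt g'"]
  by (simp add: arr_def comp_def tensor_def)

lemma exchange_comp:
  "arr f \<Longrightarrow> arr g \<Longrightarrow> arr f' \<Longrightarrow> arr g' \<Longrightarrow> arr h \<Longrightarrow> tgt f = src g \<Longrightarrow> tgt f' = src g' \<Longrightarrow>
    tgt h = src f \<otimes> src f' \<Longrightarrow>
    (g \<boxtimes> g') \<odot> (f \<boxtimes> f') \<odot> h = ((g \<odot> f) \<boxtimes> (g' \<odot> f')) \<odot> h"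
  by (simp flip: exchange comp_assoc)

lemmas merge = exchange exchange_comp tensor_idt tensor_idt_idt

lemma whisker_left:
  "arr f \<Longrightarrow> arr g \<Longrightarrow> tgt f = src g \<Longrightarrow> idt W \<boxtimes> (g \<odot> f) = (idt W \<boxtimes> g) \<odot> (idt W \<boxtimes> f)"
  by (simp add: exchange)

lemma whisker_right:
  "arr f \<Longrightarrow> arr g \<Longrightarrow> tgt f = src g \<Longrightarrow> (g \<odot> f) \<boxtimes> idt W = (g \<boxtimes> idt W) \<odot> (f \<boxtimes> idt W)"
  by (simp add: exchange)

lemma arrow_eqI: "src f = src g \<Longrightarrow> tgt f = tgt g \<Longrightarrow> mor f = mor g \<Longrightarrow> f = g"
  by (rule arrow.expand) simp

end

section \<open>Automorphisms acting by a scalar in every degree\<close>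

context graded_category
begin

lemma homogeneous_componentsE:
  obtains F W i p where "finite F" "\<And>g. g \<in> F \<Longrightarrow> W g \<in> deg g"
    "\<And>g. g \<in> F \<Longrightarrow> i g \<in> Hom (W g) V" "\<And>g. g \<in> F \<Longrightarrow> p g \<in> Hom V (W g)"
    "(\<Sum>g\<in>F. i g \<bullet> p g) = Id V"
proof -
  obtain F W where W: "\<forall>g\<in>F. W g \<in> deg g" and d: "direct_sum C V F W"
    using deg_decomp[of V] by blast
  from d obtain i p where "finite F" "\<forall>g\<in>F. i g \<in> Hom (W g) V \<and> p g \<in> Hom V (W g)"
    "(\<Sum>g\<in>F. i g \<bullet> p g) = Id V"
    unfolding direct_sum_def by blast
  with W that[of F W i p] show thesis by blast
qed

lemma homogeneous_ext:
  assumes m: "m \<in> Hom V Z" and n: "n \<in> Hom V Z"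
    and eq: "\<And>g W a. W \<in> deg g \<Longrightarrow> a \<in> Hom W V \<Longrightarrow> m \<bullet> a = n \<bullet> a"
  shows "m = n"
proof -
  obtain F W i p where F: "\<And>g. g \<in> F \<Longrightarrow> W g \<in> deg g"
    "\<And>g. g \<in> F \<Longrightarrow> i g \<in> Hom (W g) V" "\<And>g. g \<in> F \<Longrightarrow> p g \<in> Hom V (W g)"
    "(\<Sum>g\<in>F. i g \<bullet> p g) = Id V"
    by (rule homogeneous_componentsE[of V]) blast
  have "(\<Sum>g\<in>F. (m \<bullet> i g) \<bullet> p g) = (\<Sum>g\<in>F. (n \<bullet> i g) \<bullet> p g)"
    by (rule sum.cong) (simp_all add: eq[OF F(1,2)])
  then show ?thesis
    using resolution_of_identity(2)[OF F(2-4) m] resolution_of_identity(2)[OF F(2-4) n] by simp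
qed

text \<open>
  A homogeneous morphism into \<open>V \<otimes> W\<close> is in general not a tensor product of morphisms, so
  extensionality has to be tested against the tensor products of the components of \<open>V\<close> and \<open>W\<close>.
\<close>

lemma homogeneous_tens_ext:
  assumes m: "m \<in> Hom (V \<otimes> W) Z" and n: "n \<in> Hom (V \<otimes> W) Z"
    and eq: "\<And>g h A B a b. A \<in> deg g \<Longrightarrow> B \<in> deg h \<Longrightarrow> a \<in> Hom A V \<Longrightarrow> b \<in> Hom B W \<Longrightarrow>
      m \<bullet> (a \<otimes>\<^sub>m b) = n \<bullet> (a \<otimes>\<^sub>m b)"
  shows "m = n"
proof -
  obtain F A i p where F: "\<And>g. g \<in> F \<Longrightarrow> A g \<in> deg g"
    "\<And>g. g \<in> F \<Longrightarrow> i g \<in> Hom (A g) V" "\<And>g. g \<in> F \<Longrightarrow> p g \<in> Hom V (A g)"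
    "(\<Sum>g\<in>F. i g \<bullet> p g) = Id V"
    by (rule homogeneous_componentsE[of V]) blast
  obtain G B j q where G: "\<And>g. g \<in> G \<Longrightarrow> B g \<in> deg g"
    "\<And>g. g \<in> G \<Longrightarrow> j g \<in> Hom (B g) W" "\<And>g. g \<in> G \<Longrightarrow> q g \<in> Hom W (B g)"
    "(\<Sum>g\<in>G. j g \<bullet> q g) = Id W"
    by (rule homogeneous_componentsE[of W]) blast
  have Id: "Id (V \<otimes> W) = (\<Sum>g\<in>F. \<Sum>h\<in>G. (i g \<otimes>\<^sub>m j h) \<bullet> (p g \<otimes>\<^sub>m q h))"
  proof -
    have l: "(\<Sum>g\<in>F. x g) \<otimes>\<^sub>m y = (\<Sum>g\<in>F. x g \<otimes>\<^sub>m y)"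
      if "\<And>g. g \<in> F \<Longrightarrow> x g \<in> Hom V V" "y \<in> Hom W W" for x y
      using that(1) by (induction F rule: infinite_finite_induct)
        (simp_all add: tens_zero_left[OF that(2)] tens_add_left[OF _ _ that(2), of _ V V] sum_in_Hom)
    have r: "y \<otimes>\<^sub>m (\<Sum>g\<in>G. x g) = (\<Sum>g\<in>G. y \<otimes>\<^sub>m x g)"
      if "\<And>g. g \<in> G \<Longrightarrow> x g \<in> Hom W W" "y \<in> Hom V V" for x y
      using that(1) by (induction G rule: infinite_finite_induct)
        (simp_all add: tens_zero_right[OF that(2)] tens_add_right[OF that(2), of _ W W] sum_in_Hom)
    have "Id (V \<otimes> W) = (\<Sum>g\<in>F. i g \<bullet> p g) \<otimes>\<^sub>m Id W"
      using F(4) by (simp add: tens_Id)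
    also have "\<dots> = (\<Sum>g\<in>F. (i g \<bullet> p g) \<otimes>\<^sub>m (\<Sum>h\<in>G. j h \<bullet> q h))"
      unfolding G(4) by (rule l) (meson F cmp_in_Hom Id_in_Hom)+
    also have "\<dots> = (\<Sum>g\<in>F. \<Sum>h\<in>G. (i g \<bullet> p g) \<otimes>\<^sub>m (j h \<bullet> q h))"
      by (rule sum.cong[OF refl], rule r) (meson F G cmp_in_Hom)+
    also have "\<dots> = (\<Sum>g\<in>F. \<Sum>h\<in>G. (i g \<otimes>\<^sub>m j h) \<bullet> (p g \<otimes>\<^sub>m q h))"
      by (intro sum.cong refl) (rule tens_cmp, use F G in auto)
    finally show ?thesis .
  qed
  let ?i = "\<lambda>(g, h). i g \<otimes>\<^sub>m j h" and ?p = "\<lambda>(g, h). p g \<otimes>\<^sub>m q h" and ?A = "\<lambda>(g, h). A g \<otimes> B h"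
  have ip: "?i k \<in> Hom (?A k) (V \<otimes> W)" "?p k \<in> Hom (V \<otimes> W) (?A k)" if "k \<in> F \<times> G" for k
    using that F G by (auto intro: tens_in_Hom)
  have "(\<Sum>k\<in>F \<times> G. ?i k \<bullet> ?p k) = Id (V \<otimes> W)"
    by (simp add: Id sum.cartesian_product split_def)
  note res = resolution_of_identity(2)[of "F \<times> G" ?i ?A "V \<otimes> W" ?p, OF ip this]
  have "(\<Sum>k\<in>F \<times> G. (m \<bullet> ?i k) \<bullet> ?p k) = (\<Sum>k\<in>F \<times> G. (n \<bullet> ?i k) \<bullet> ?p k)"
    by (rule sum.cong[OF refl]) (auto simp: eq[OF F(1) G(1) F(2) G(2)])
  then show ?thesis using res[OF _ _ m] res[OF _ _ n] by simp
qed

text \<open>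
  A function \<open>\<chi>\<close> on the grading group defines a natural endomorphism of the identity functor,
  multiplication by \<open>\<chi> g\<close> in degree \<open>g\<close>.  It is monoidal when \<open>\<chi>\<close> is multiplicative.
\<close>

definition degree_action :: "('g \<Rightarrow> 'k) \<Rightarrow> 'o \<Rightarrow> 'm"
  where "degree_action \<chi> V =
    (THE x. x \<in> Hom V V \<and> (\<forall>g. \<forall>W \<in> deg g. \<forall>a \<in> Hom W V. x \<bullet> a = \<chi> g \<cdot> a))"

lemma degree_action:
  shows degree_action_in_Hom: "degree_action \<chi> V \<in> Hom V V"
    and degree_action_cmp: "W \<in> deg g \<Longrightarrow> a \<in> Hom W V \<Longrightarrow> degree_action \<chi> V \<bullet> a = \<chi> g \<cdot> a"
proof -
  obtain F W i p where F: "\<And>g. g \<in> F \<Longrightarrow> W g \<in> deg g"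
    "\<And>g. g \<in> F \<Longrightarrow> i g \<in> Hom (W g) V" "\<And>g. g \<in> F \<Longrightarrow> p g \<in> Hom V (W g)"
    "(\<Sum>g\<in>F. i g \<bullet> p g) = Id V"
    by (rule homogeneous_componentsE[of V]) blast
  have ip: "i g \<bullet> p g \<in> Hom V V" if "g \<in> F" for g using F that cmp_in_Hom by blast
  define x where "x = (\<Sum>g\<in>F. \<chi> g \<cdot> (i g \<bullet> p g))"
  have x: "x \<in> Hom V V" unfolding x_def by (intro sum_in_Hom scale_in_Hom ip)
  have "x \<bullet> a = \<chi> h \<cdot> a" if A: "A \<in> deg h" and a: "a \<in> Hom A V" for h A a
  proof -
    have in_degree_h: "\<chi> g \<cdot> ((i g \<bullet> p g) \<bullet> a) = \<chi> h \<cdot> ((i g \<bullet> p g) \<bullet> a)" if g: "g \<in> F" for g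
    proof (cases "g = h")
      case False
      have "p g \<bullet> a \<in> Hom A (W g)" using a F(3)[OF g] cmp_in_Hom by blast
      then have "p g \<bullet> a = 0" using deg_Hom[OF A F(1)[OF g]] False by auto
      then have "(i g \<bullet> p g) \<bullet> a = 0"
        using cmp_assoc[OF a F(3)[OF g] F(2)[OF g]] cmp_zero_right[OF F(2)[OF g]] by simp
      then show ?thesis by simp
    qed simp
    have "x \<bullet> a = (\<Sum>g\<in>F. \<chi> g \<cdot> ((i g \<bullet> p g) \<bullet> a))"
      unfolding x_def using cmp_sum_left[OF a, of F "\<lambda>g. \<chi> g \<cdot> (i g \<bullet> p g)" V]
      by (simp add: scale_in_Hom ip cmp_scale_left[OF a ip])
    also have "\<dots> = (\<Sum>g\<in>F. \<chi> h \<cdot> ((i g \<bullet> p g) \<bullet> a))"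
      using in_degree_h by (intro sum.cong refl)
    also have "\<dots> = \<chi> h \<cdot> ((\<Sum>g\<in>F. i g \<bullet> p g) \<bullet> a)"
      by (simp add: vs.scale_sum_right cmp_sum_left[OF a ip])
    finally show ?thesis using F(4) a by (simp add: cmp_Id_left)
  qed
  then have ex: "\<exists>!x. x \<in> Hom V V \<and> (\<forall>g. \<forall>W \<in> deg g. \<forall>a \<in> Hom W V. x \<bullet> a = \<chi> g \<cdot> a)"
    using x by (intro ex1I[of _ x] conjI allI ballI) (auto intro: homogeneous_ext)
  show "degree_action \<chi> V \<in> Hom V V"
    using theI'[OF ex] by (simp add: degree_action_def)
  show "degree_action \<chi> V \<bullet> a = \<chi> g \<cdot> a" if "W \<in> deg g" "a \<in> Hom W V" for W g a
    using theI'[OF ex] that by (simp add: degree_action_def)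
qed

lemma degree_action_natural:
  assumes f: "f \<in> Hom V W"
  shows "degree_action \<chi> W \<bullet> f = f \<bullet> degree_action \<chi> V"
proof (rule homogeneous_ext)
  show "degree_action \<chi> W \<bullet> f \<in> Hom V W" "f \<bullet> degree_action \<chi> V \<in> Hom V W"
    using f degree_action_in_Hom cmp_in_Hom by blast+
  show "(degree_action \<chi> W \<bullet> f) \<bullet> a = (f \<bullet> degree_action \<chi> V) \<bullet> a"
    if A: "A \<in> deg g" and a: "a \<in> Hom A V" for g A a
    using cmp_assoc[OF a f degree_action_in_Hom] cmp_assoc[OF a degree_action_in_Hom f]
    by (simp add: degree_action_cmp[OF A] cmp_in_Hom[OF a f] a cmp_scale_right[OF a f])
qed

lemma degree_action_homogeneous: "V \<in> deg g \<Longrightarrow> degree_action \<chi> V = \<chi> g \<cdot> Id V"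
  using degree_action_cmp[OF _ Id_in_Hom] cmp_Id_right[OF degree_action_in_Hom] by metis

lemma degree_action_one: "degree_action (\<lambda>_. 1) V = Id V"
  by (rule homogeneous_ext[OF degree_action_in_Hom Id_in_Hom])
    (simp add: degree_action_cmp cmp_Id_left)

lemma degree_action_mult:
  "degree_action \<chi> V \<bullet> degree_action \<chi>' V = degree_action (\<lambda>g. \<chi> g * \<chi>' g) V"
proof (rule homogeneous_ext)
  show "(degree_action \<chi> V \<bullet> degree_action \<chi>' V) \<bullet> a = degree_action (\<lambda>g. \<chi> g * \<chi>' g) V \<bullet> a"
    if A: "A \<in> deg g" and a: "a \<in> Hom A V" for g A a
    using cmp_assoc[OF a degree_action_in_Hom degree_action_in_Hom]
    by (simp add: degree_action_cmp[OF A a] cmp_scale_right[OF a degree_action_in_Hom] mult.commute)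
qed (rule cmp_in_Hom[OF degree_action_in_Hom degree_action_in_Hom], rule degree_action_in_Hom)

lemma degree_action_tens:
  assumes \<chi>: "\<And>g h. \<chi> (g + h) = \<chi> g * \<chi> h"
  shows "degree_action \<chi> (V \<otimes> W) = degree_action \<chi> V \<otimes>\<^sub>m degree_action \<chi> W"
proof (rule homogeneous_tens_ext)
  show "degree_action \<chi> (V \<otimes> W) \<bullet> (a \<otimes>\<^sub>m b) = (degree_action \<chi> V \<otimes>\<^sub>m degree_action \<chi> W) \<bullet> (a \<otimes>\<^sub>m b)"
    if "A \<in> deg g" "B \<in> deg h" "a \<in> Hom A V" "b \<in> Hom B W" for g h A B a b
    using degree_action_cmp[OF deg_tens[OF that(1,2)] tens_in_Hom[OF that(3,4)]]
      tens_cmp[OF that(3) degree_action_in_Hom that(4) degree_action_in_Hom]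
      tens_scale_left[OF that(3) scale_in_Hom[OF that(4)]] tens_scale_right[OF that(3,4)]
    by (simp add: degree_action_cmp[OF that(1,3)] degree_action_cmp[OF that(2,4)] \<chi>)
qed (rule degree_action_in_Hom, intro degree_action_in_Hom tens_in_Hom)

end


section \<open>The half-braiding with the translation objects\<close>

context ribbon_category
begin

definition brd :: "'o \<Rightarrow> 'o \<Rightarrow> ('o, 'm) arrow"
  where "brd V W = Arrow (V \<otimes> W) (W \<otimes> V) (c V W)"

lemma braiding_in_Hom: "c V W \<in> Hom (V \<otimes> W) (W \<otimes> V)"
  using braiding_iso unfolding is_iso_def by blast

lemma brd_simps [simp]:
  "src (brd V W) = V \<otimes> W" "tgt (brd V W) = W \<otimes> V" "arr (brd V W)" "mor (brd V W) = c V W"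
  by (simp_all add: brd_def braiding_in_Hom)

lemma brd_natural:
  "arr f \<Longrightarrow> arr g \<Longrightarrow> brd (tgt f) (tgt g) \<odot> (f \<boxtimes> g) = (g \<boxtimes> f) \<odot> brd (src f) (src g)"
  using braiding_natural[of "mor f" "src f" "tgt f" "mor g" "src g" "tgt g"]
  by (intro arrow_eqI) (simp_all add: arr_def)

lemma brd_tens_right: "brd U (V \<otimes> W) = (idt V \<boxtimes> brd U W) \<odot> (brd U V \<boxtimes> idt W)"
  by (intro arrow_eqI) (simp_all add: braiding_tens_right)

lemma brd_tens_left: "brd (U \<otimes> V) W = (brd U W \<boxtimes> idt V) \<odot> (idt U \<boxtimes> brd V W)"
  by (intro arrow_eqI) (simp_all add: braiding_tens_left)

lemma braiding_unit_right: "c V \<one> = Id V"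
proof -
  have c: "c V \<one> \<in> Hom V V" using braiding_in_Hom[of V \<one>] by simp
  obtain d where d: "d \<in> Hom V V" "d \<bullet> c V \<one> = Id V"
    using braiding_iso[of V \<one>] by (auto elim!: is_isoE)
  have "c V \<one> = c V \<one> \<bullet> c V \<one>"
    using braiding_tens_right[of V \<one> \<one>] c by (simp add: tens_unit_left tens_unit_right)
  then have "d \<bullet> c V \<one> = (d \<bullet> c V \<one>) \<bullet> c V \<one>"
    using cmp_assoc[OF c c d(1)] by simp
  then show ?thesis using d c by (simp add: cmp_Id_left)
qed

end

text \<open>
  Here \<open>r\<close> is the square root \<open>\<surd>\<psi>\<close>.
\<close>

locale orbit_setting = relative_hermitian_premodular_category C bar dag c deg X \<sigma> t \<psi>
  for C :: "('k::field, 'o, 'm::ab_group_add, 'x) piv_cat_scheme" (structure)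
    and bar :: "'k \<Rightarrow> 'k" and dag :: "'m \<Rightarrow> 'm"
    and c :: "'o \<Rightarrow> 'o \<Rightarrow> 'm"
    and deg :: "'g::ab_group_add \<Rightarrow> 'o set" and X :: "'g set"
    and \<sigma> :: "'z::ab_group_add \<Rightarrow> 'o"
    and t :: "'o \<Rightarrow> 'm \<Rightarrow> 'k" and \<psi> :: "'g \<Rightarrow> 'z \<Rightarrow> 'k" +
  fixes r :: "'g \<Rightarrow> 'z \<Rightarrow> 'k"
  assumes r_bilinear: "bilinear_pairing r"
    and r_unitary: "bar (r g \<nu>) * r g \<nu> = 1"
    and \<sigma>_braiding: "c (\<sigma> \<nu>) (\<sigma> \<mu>) = Id (\<sigma> (\<nu> + \<mu>))"
begin

lemma r_nonzero: "r g \<nu> \<noteq> 0"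
  and r_add_left: "r (g + h) \<nu> = r g \<nu> * r h \<nu>"
  and r_add_right: "r g (\<nu> + \<mu>) = r g \<nu> * r g \<mu>"
  using r_bilinear unfolding bilinear_pairing_def by blast+

lemma r_zero_left: "r 0 \<nu> = 1"
  using r_add_left[of 0 0 \<nu>] r_nonzero[of 0 \<nu>] by simp

lemma r_zero_right: "r g 0 = 1"
  using r_add_right[of g 0 0] r_nonzero[of g 0] by simp

lemma \<sigma>_simps [simp]: "\<sigma> 0 = \<one>" "\<sigma> \<nu> \<otimes> \<sigma> \<mu> = \<sigma> (\<nu> + \<mu>)"
  "\<sigma> \<nu> \<otimes> (\<sigma> \<mu> \<otimes> V) = \<sigma> (\<nu> + \<mu>) \<otimes> V"
  by (simp_all add: \<sigma>_zero \<sigma>_add flip: tens_ob_assoc)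

text \<open>
  The factor \<open>\<surd>\<psi>(g,\<nu>)\<^sup>-\<^sup>1\<close> of the half-braiding as a natural automorphism.  Separating it from the
  braiding splits each property of the half-braiding into one of the braiding and one of \<open>r\<close>.
\<close>

definition scl :: "'z \<Rightarrow> 'o \<Rightarrow> ('o, 'm) arrow"
  where "scl \<nu> V = Arrow V V (degree_action (\<lambda>g. inverse (r g \<nu>)) V)"

lemma scl_simps [simp]: "src (scl \<nu> V) = V" "tgt (scl \<nu> V) = V" "arr (scl \<nu> V)"
  by (simp_all add: scl_def degree_action_in_Hom)

lemma scl_natural: "arr f \<Longrightarrow> scl \<nu> (tgt f) \<odot> f = f \<odot> scl \<nu> (src f)"
  by (intro arrow_eqI) (simp_all add: scl_def arr_def degree_action_natural)

lemma scl_tens: "scl \<nu> (V \<otimes> W) = scl \<nu> V \<boxtimes> scl \<nu> W"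
  by (intro arrow_eqI) (simp_all add: scl_def degree_action_tens r_add_left)

lemma scl_add: "scl (\<nu> + \<mu>) V = scl \<mu> V \<odot> scl \<nu> V"
  by (intro arrow_eqI) (simp_all add: scl_def degree_action_mult r_add_right mult.commute)

lemma scl_zero: "scl 0 V = idt V"
  by (intro arrow_eqI) (simp_all add: scl_def r_zero_right degree_action_one)

lemma scl_degree_zero: "V \<in> deg 0 \<Longrightarrow> scl \<nu> V = idt V"
  by (intro arrow_eqI) (simp_all add: scl_def degree_action_homogeneous r_zero_left)

definition hb :: "'o \<Rightarrow> 'z \<Rightarrow> ('o, 'm) arrow"
  where "hb V \<nu> = brd V (\<sigma> \<nu>) \<odot> (scl \<nu> V \<boxtimes> idt (\<sigma> \<nu>))"

lemma hb_simps [simp]: "src (hb V \<nu>) = V \<otimes> \<sigma> \<nu>" "tgt (hb V \<nu>) = \<sigma> \<nu> \<otimes> V" "arr (hb V \<nu>)"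
  by (simp_all add: hb_def)

text \<open>
  The naturality that characterises the half-braiding only mentions homogeneous sources; it
  determines a morphism because every object is a sum of homogeneous ones.
\<close>

lemma half_braiding_eq: "half_braiding C c deg \<sigma> r V \<nu> = mor (hb V \<nu>)"
proof -
  let ?P = "\<lambda>x. \<forall>g. \<forall>W \<in> deg g. \<forall>a \<in> Hom W V.
    x \<bullet> (a \<otimes>\<^sub>m Id (\<sigma> \<nu>)) = (Id (\<sigma> \<nu>) \<otimes>\<^sub>m a) \<bullet> (inverse (r g \<nu>) \<cdot> c W (\<sigma> \<nu>))"
  have hb: "mor (hb V \<nu>) \<in> Hom (V \<otimes> \<sigma> \<nu>) (\<sigma> \<nu> \<otimes> V)"
    using hb_simps[of V \<nu>] unfolding arr_def by simp
  have P: "?P (mor (hb V \<nu>))"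
  proof (intro allI ballI)
    fix g W a assume W: "W \<in> deg g" and a: "a \<in> Hom W V"
    let ?a = "Arrow W V a"
    have sa: "scl \<nu> V \<odot> ?a = Arrow W V (inverse (r g \<nu>) \<cdot> a)"
      by (intro arrow_eqI) (simp_all add: scl_def degree_action_cmp[OF W a])
    have "hb V \<nu> \<odot> (?a \<boxtimes> idt (\<sigma> \<nu>)) = brd V (\<sigma> \<nu>) \<odot> ((scl \<nu> V \<odot> ?a) \<boxtimes> idt (\<sigma> \<nu>))"
      using a by (simp add: hb_def merge)
    also have "\<dots> = (idt (\<sigma> \<nu>) \<boxtimes> Arrow W V (inverse (r g \<nu>) \<cdot> a)) \<odot> brd W (\<sigma> \<nu>)"
      unfolding sa using brd_natural[of "Arrow W V (inverse (r g \<nu>) \<cdot> a)" "idt (\<sigma> \<nu>)"] a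
      by (simp add: scale_in_Hom)
    finally have eq: "mor (hb V \<nu>) \<bullet> (a \<otimes>\<^sub>m Id (\<sigma> \<nu>))
        = (Id (\<sigma> \<nu>) \<otimes>\<^sub>m (inverse (r g \<nu>) \<cdot> a)) \<bullet> c W (\<sigma> \<nu>)"
      by (metis arrow.sel(3) arrow_simps(3,6,9) brd_simps(4))
    show "mor (hb V \<nu>) \<bullet> (a \<otimes>\<^sub>m Id (\<sigma> \<nu>))
        = (Id (\<sigma> \<nu>) \<otimes>\<^sub>m a) \<bullet> (inverse (r g \<nu>) \<cdot> c W (\<sigma> \<nu>))"
      unfolding eq
      using cmp_scale_left[OF braiding_in_Hom tens_in_Hom[OF Id_in_Hom a]]
        cmp_scale_right[OF braiding_in_Hom tens_in_Hom[OF Id_in_Hom a]]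
      by (simp add: tens_scale_right[OF Id_in_Hom a])
  qed
  have "x = mor (hb V \<nu>)" if x: "x \<in> Hom (V \<otimes> \<sigma> \<nu>) (\<sigma> \<nu> \<otimes> V)" and Px: "?P x" for x
  proof (rule homogeneous_tens_ext[OF x hb])
    fix g h A B a b
    assume A: "A \<in> deg g" and a: "a \<in> Hom A V" and b: "b \<in> Hom B (\<sigma> \<nu>)"
    have ab: "a \<otimes>\<^sub>m b = (a \<otimes>\<^sub>m Id (\<sigma> \<nu>)) \<bullet> (Id A \<otimes>\<^sub>m b)"
      using tens_cmp[OF Id_in_Hom a b Id_in_Hom] a b by (simp add: cmp_Id_left cmp_Id_right)
    have "x \<bullet> (a \<otimes>\<^sub>m Id (\<sigma> \<nu>)) = mor (hb V \<nu>) \<bullet> (a \<otimes>\<^sub>m Id (\<sigma> \<nu>))"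
      using P Px A a by simp
    then show "x \<bullet> (a \<otimes>\<^sub>m b) = mor (hb V \<nu>) \<bullet> (a \<otimes>\<^sub>m b)"
      unfolding ab
      using cmp_assoc[OF tens_in_Hom[OF Id_in_Hom b] tens_in_Hom[OF a Id_in_Hom] x]
        cmp_assoc[OF tens_in_Hom[OF Id_in_Hom b] tens_in_Hom[OF a Id_in_Hom] hb]
      by simp
  qed
  then show ?thesis
    unfolding half_braiding_def using hb P by (intro the_equality) blast+
qed

lemma hb_natural:
  assumes "arr f"
  shows "hb (tgt f) \<nu> \<odot> (f \<boxtimes> idt (\<sigma> \<nu>)) = (idt (\<sigma> \<nu>) \<boxtimes> f) \<odot> hb (src f) \<nu>"
proof -
  have "hb (tgt f) \<nu> \<odot> (f \<boxtimes> idt (\<sigma> \<nu>)) = brd (tgt f) (\<sigma> \<nu>) \<odot> (f \<boxtimes> idt (\<sigma> \<nu>)) \<odot> (scl \<nu> (src f) \<boxtimes> idt (\<sigma> \<nu>))"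
    using assms by (simp add: hb_def merge scl_natural)
  also have "\<dots> = (brd (tgt f) (\<sigma> \<nu>) \<odot> (f \<boxtimes> idt (\<sigma> \<nu>))) \<odot> (scl \<nu> (src f) \<boxtimes> idt (\<sigma> \<nu>))"
    using assms by simp
  also have "\<dots> = (idt (\<sigma> \<nu>) \<boxtimes> f) \<odot> hb (src f) \<nu>"
    using brd_natural[OF assms, of "idt (\<sigma> \<nu>)"] assms by (simp add: hb_def)
  finally show ?thesis .
qed

lemma hb_zero: "hb V 0 = idt V"
  using braiding_unit_right
  by (intro arrow_eqI) (simp_all add: hb_def scl_zero tens_unit_right Id_in_Hom cmp_Id_left)

text \<open>
  The hexagon identities of the braiding, combined with the bilinearity of \<open>r\<close>, make the
  half-braiding multiplicative in both arguments.
\<close>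

lemma hb_add: "hb V (\<nu> + \<mu>) = (idt (\<sigma> \<nu>) \<boxtimes> hb V \<mu>) \<odot> (hb V \<nu> \<boxtimes> idt (\<sigma> \<mu>))"
proof -
  have n: "(idt (\<sigma> \<nu>) \<boxtimes> scl \<mu> V) \<odot> brd V (\<sigma> \<nu>) = brd V (\<sigma> \<nu>) \<odot> (scl \<mu> V \<boxtimes> idt (\<sigma> \<nu>))"
    using brd_natural[of "scl \<mu> V" "idt (\<sigma> \<nu>)"] by simp
  have "(idt (\<sigma> \<nu>) \<boxtimes> hb V \<mu>) \<odot> (hb V \<nu> \<boxtimes> idt (\<sigma> \<mu>))
    = (idt (\<sigma> \<nu>) \<boxtimes> brd V (\<sigma> \<mu>)) \<odot> (((idt (\<sigma> \<nu>) \<boxtimes> scl \<mu> V) \<odot> brd V (\<sigma> \<nu>)) \<boxtimes> idt (\<sigma> \<mu>))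
        \<odot> ((scl \<nu> V \<boxtimes> idt (\<sigma> \<nu>)) \<boxtimes> idt (\<sigma> \<mu>))"
    by (simp add: hb_def whisker_left whisker_right)
  also have "\<dots> = (idt (\<sigma> \<nu>) \<boxtimes> brd V (\<sigma> \<mu>)) \<odot> (brd V (\<sigma> \<nu>) \<boxtimes> idt (\<sigma> \<mu>))
        \<odot> ((scl \<mu> V \<odot> scl \<nu> V) \<boxtimes> idt (\<sigma> (\<nu> + \<mu>)))"
    unfolding n by (simp add: whisker_right tensor_idt)
  also have "\<dots> = hb V (\<nu> + \<mu>)"
    using brd_tens_right[of V "\<sigma> \<nu>" "\<sigma> \<mu>"] by (simp add: hb_def scl_add)
  finally show ?thesis by simp
qed

lemma hb_tens: "hb (V \<otimes> W) \<nu> = (hb V \<nu> \<boxtimes> idt W) \<odot> (idt V \<boxtimes> hb W \<nu>)"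
proof -
  have "(hb V \<nu> \<boxtimes> idt W) \<odot> (idt V \<boxtimes> hb W \<nu>)
     = (brd V (\<sigma> \<nu>) \<boxtimes> idt W) \<odot> (scl \<nu> V \<boxtimes> idt (\<sigma> \<nu> \<otimes> W)) \<odot> (idt V \<boxtimes> hb W \<nu>)"
    by (simp add: hb_def[of V] whisker_right tensor_idt)
  also have "\<dots> = (brd V (\<sigma> \<nu>) \<boxtimes> idt W) \<odot> (idt V \<boxtimes> brd W (\<sigma> \<nu>)) \<odot> (scl \<nu> V \<boxtimes> scl \<nu> W \<boxtimes> idt (\<sigma> \<nu>))"
    by (simp add: merge hb_def)
  also have "\<dots> = hb (V \<otimes> W) \<nu>"
    by (simp add: hb_def brd_tens_left scl_tens)
  finally show ?thesis by simp
qed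

text \<open>
  The translation objects have degree zero, where \<open>r\<close> is one, and they braid trivially.
\<close>

lemma hb_\<sigma>: "hb (\<sigma> \<mu>) \<nu> = idt (\<sigma> (\<mu> + \<nu>))"
proof -
  have "brd (\<sigma> \<mu>) (\<sigma> \<nu>) = idt (\<sigma> (\<mu> + \<nu>))"
    by (intro arrow_eqI) (simp_all add: \<sigma>_braiding add.commute)
  then show ?thesis by (simp add: hb_def scl_degree_zero[OF \<sigma>_deg] tensor_idt)
qed

lemma hb_unit: "hb \<one> \<nu> = idt (\<sigma> \<nu>)"
  using hb_\<sigma>[of 0] by simp

lemma hb_\<sigma>_tens: "hb (\<sigma> \<mu> \<otimes> V) \<nu> = idt (\<sigma> \<mu>) \<boxtimes> hb V \<nu>"
  by (simp add: hb_tens hb_\<sigma> tensor_idt add.commute)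

end

section \<open>Adjoints and dimensions of the translation objects\<close>

context field_involution
begin

lemma bar_one: "bar 1 = 1"
  using bar_mult[of 1 "bar 1"] bar_bar[of 1] by simp

lemma bar_zero: "bar 0 = 0"
  using bar_add[of 0 0] add_left_cancel[of "bar 0" "bar 0" 0] by simp

end

context pivotal_category
begin

definition coevA where "coevA V = Arrow \<one> (V \<otimes> dual C V) (coev C V)"
definition evA where "evA V = Arrow (dual C V \<otimes> V) \<one> (ev C V)"
definition coevA' where "coevA' V = Arrow \<one> (dual C V \<otimes> V) (coev' C V)"
definition evA' where "evA' V = Arrow (V \<otimes> dual C V) \<one> (ev' C V)"

lemma duality_simps [simp]:
  "src (coevA V) = \<one>" "tgt (coevA V) = V \<otimes> dual C V" "mor (coevA V) = coev C V" "arr (coevA V)"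
  "src (evA V) = dual C V \<otimes> V" "tgt (evA V) = \<one>" "mor (evA V) = ev C V" "arr (evA V)"
  "src (coevA' V) = \<one>" "tgt (coevA' V) = dual C V \<otimes> V" "mor (coevA' V) = coev' C V" "arr (coevA' V)"
  "src (evA' V) = V \<otimes> dual C V" "tgt (evA' V) = \<one>" "mor (evA' V) = ev' C V" "arr (evA' V)"
  by (simp_all add: coevA_def evA_def coevA'_def evA'_def
      coev_in_Hom ev_in_Hom coev'_in_Hom ev'_in_Hom)

lemma zigzags:
  "(idt V \<boxtimes> evA V) \<odot> (coevA V \<boxtimes> idt V) = idt V"
  "(evA V \<boxtimes> idt (dual C V)) \<odot> (idt (dual C V) \<boxtimes> coevA V) = idt (dual C V)"
  "(evA' V \<boxtimes> idt V) \<odot> (idt V \<boxtimes> coevA' V) = idt V"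
  "(idt (dual C V) \<boxtimes> evA' V) \<odot> (coevA' V \<boxtimes> idt (dual C V)) = idt (dual C V)"
  by (rule arrow_eqI; simp add: zigzag zigzag_dual zigzag' zigzag'_dual)+

end

context hermitian_pivotal_category
begin

lemma dag_in_Hom: "f \<in> Hom V W \<Longrightarrow> dag f \<in> Hom W V"
  using dag_bij bij_betwE by blast

lemma dag_add: "f \<in> Hom V W \<Longrightarrow> g \<in> Hom V W \<Longrightarrow> dag (f + g) = dag f + dag g"
  using dag_antilinear[of f V W g 1 1] by (simp add: bar_one)

lemma dag_scale: "f \<in> Hom V W \<Longrightarrow> dag (a \<cdot> f) = bar a \<cdot> dag f"
  using dag_antilinear[of f V W f a 0] by (simp add: bar_zero)

lemma dag_zero: "dag 0 = 0"
  using dag_scale[of 0 undefined undefined 0] by (simp add: bar_zero)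

lemma dag_Id: "dag (Id V) = Id V"
  using dag_cmp[OF Id_in_Hom dag_in_Hom[OF Id_in_Hom], of V] dag_in_Hom[OF Id_in_Hom, of V]
  by (simp add: cmp_Id_right dag_dag[OF Id_in_Hom])

definition adj :: "('o, 'm) arrow \<Rightarrow> ('o, 'm) arrow"
  where "adj f = Arrow (tgt f) (src f) (dag (mor f))"

lemma adj_simps [simp]:
  "src (adj f) = tgt f" "tgt (adj f) = src f" "mor (adj f) = dag (mor f)"
  "arr f \<Longrightarrow> arr (adj f)" "arr f \<Longrightarrow> adj (adj f) = f" "adj (idt V) = idt V"
  by (auto simp: adj_def arr_def dag_in_Hom dag_dag dag_Id intro!: arrow_eqI)

lemma adj_comp: "arr f \<Longrightarrow> arr g \<Longrightarrow> tgt f = src g \<Longrightarrow> adj (g \<odot> f) = adj f \<odot> adj g"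
  using dag_cmp[of "mor f" "src f" "tgt f" "mor g" "tgt g"]
  by (intro arrow_eqI) (simp_all add: arr_def)

lemma adj_tensor: "arr f \<Longrightarrow> arr g \<Longrightarrow> adj (f \<boxtimes> g) = adj f \<boxtimes> adj g"
  by (intro arrow_eqI) (simp_all add: arr_def dag_tens)

end

lemma (in hermitian_ribbon_category) brd_adj:
  "adj (brd V W) \<odot> brd V W = idt (V \<otimes> W)" "brd V W \<odot> adj (brd V W) = idt (W \<otimes> V)"
  by (rule arrow_eqI; simp add: dag_braiding_left dag_braiding_right)+

context orbit_setting
begin

text \<open>
  For \<open>a : A \<rightarrow> V\<close> with \<open>A\<close> homogeneous, the claim is the adjoint of the naturality of the action
  with respect to the adjoint of \<open>a\<close>.
\<close>

lemma dag_degree_action: "dag (degree_action \<chi> V) = degree_action (\<lambda>g. bar (\<chi> g)) V"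
proof (rule homogeneous_ext)
  show "dag (degree_action \<chi> V) \<bullet> a = degree_action (\<lambda>g. bar (\<chi> g)) V \<bullet> a"
    if A: "A \<in> deg g" and a: "a \<in> Hom A V" for g A a
  proof -
    have a': "dag a \<in> Hom V A" using a by (rule dag_in_Hom)
    have "dag a \<bullet> degree_action \<chi> V = \<chi> g \<cdot> dag a"
      using degree_action_natural[OF a', of \<chi>] degree_action_homogeneous[OF A, of \<chi>]
      by (simp add: cmp_scale_left[OF a' Id_in_Hom] cmp_Id_left[OF a'])
    then have "dag (dag a \<bullet> degree_action \<chi> V) = bar (\<chi> g) \<cdot> a"
      using dag_scale[OF a'] dag_dag[OF a] by simp
    then show ?thesis
      using dag_cmp[OF degree_action_in_Hom a'] dag_dag[OF a] degree_action_cmp[OF A a] by simp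
  qed
qed (rule dag_in_Hom[OF degree_action_in_Hom], rule degree_action_in_Hom)

lemma bar_inverse_r: "bar (inverse (r g \<nu>)) = inverse (r g (- \<nu>))"
proof -
  have "bar (inverse (r g \<nu>)) * bar (r g \<nu>) = 1"
    using bar_mult[of "inverse (r g \<nu>)" "r g \<nu>"] r_nonzero[of g \<nu>] by (simp add: bar_one)
  then have "bar (inverse (r g \<nu>)) = r g \<nu>"
    using r_unitary[of g \<nu>]
    by (metis (no_types, lifting) mult.commute mult.left_commute mult.right_neutral)
  moreover have "r g \<nu> * r g (- \<nu>) = 1"
    using r_add_right[of g \<nu> "- \<nu>"] by (simp add: r_zero_right)
  ultimately show ?thesis using inverse_unique[of "r g (- \<nu>)" "r g \<nu>"] by (simp add: mult.commute)
qed

lemma adj_scl: "adj (scl \<nu> V) = scl (- \<nu>) V"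
  by (intro arrow_eqI) (simp_all add: scl_def dag_degree_action bar_inverse_r)

text \<open>
  The braiding is unitary by assumption, and the scalar factor because \<open>r\<close> takes values of norm one.
\<close>

lemma hb_adj:
  shows "adj (hb V \<nu>) \<odot> hb V \<nu> = idt (V \<otimes> \<sigma> \<nu>)" and "hb V \<nu> \<odot> adj (hb V \<nu>) = idt (\<sigma> \<nu> \<otimes> V)"
proof -
  have scl: "scl (- \<nu>) V \<odot> scl \<nu> V = idt V" "scl \<nu> V \<odot> scl (- \<nu>) V = idt V"
    using scl_add[of \<nu> "- \<nu>"] scl_add[of "- \<nu>" \<nu>] by (simp_all add: scl_zero)
  have b: "adj (brd V (\<sigma> \<nu>)) \<odot> brd V (\<sigma> \<nu>) \<odot> f = f" if "arr f" "tgt f = V \<otimes> \<sigma> \<nu>" for f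
    using that brd_adj[of V "\<sigma> \<nu>"] by (simp flip: comp_assoc)
  have s: "(scl \<nu> V \<boxtimes> idt (\<sigma> \<nu>)) \<odot> (scl (- \<nu>) V \<boxtimes> idt (\<sigma> \<nu>)) \<odot> f = f"
    if "arr f" "tgt f = V \<otimes> \<sigma> \<nu>" for f
    using that by (simp add: merge scl)
  show "adj (hb V \<nu>) \<odot> hb V \<nu> = idt (V \<otimes> \<sigma> \<nu>)"
    by (simp add: hb_def adj_comp adj_tensor adj_scl b) (simp add: merge scl)
  show "hb V \<nu> \<odot> adj (hb V \<nu>) = idt (\<sigma> \<nu> \<otimes> V)"
    by (simp add: hb_def adj_comp adj_tensor adj_scl s brd_adj)
qed

lemma brd_\<sigma>: "brd (\<sigma> \<nu>) (\<sigma> \<nu>) = idt (\<sigma> (\<nu> + \<nu>))"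
  by (intro arrow_eqI) (simp_all add: \<sigma>_braiding)

lemma translate_cancel:
  assumes "arr f" "arr g" "idt (\<sigma> \<nu>) \<boxtimes> f = idt (\<sigma> \<nu>) \<boxtimes> g"
  shows "f = g"
proof -
  have "idt (\<sigma> (- \<nu>)) \<boxtimes> idt (\<sigma> \<nu>) \<boxtimes> f = idt (\<sigma> (- \<nu>)) \<boxtimes> idt (\<sigma> \<nu>) \<boxtimes> g"
    using assms(3) by simp
  then show ?thesis using assms(1,2) by (simp add: tensor_idt_idt)
qed

lemma translate_cancel_right:
  assumes "arr f" "arr g" "f \<boxtimes> idt (\<sigma> \<nu>) = g \<boxtimes> idt (\<sigma> \<nu>)"
  shows "f = g"
proof -
  have "(f \<boxtimes> idt (\<sigma> \<nu>)) \<boxtimes> idt (\<sigma> (- \<nu>)) = (g \<boxtimes> idt (\<sigma> \<nu>)) \<boxtimes> idt (\<sigma> (- \<nu>))"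
    using assms(3) by simp
  then show ?thesis using assms(1,2) by (simp add: tensor_idt)
qed

text \<open>
  A translation object braids trivially with itself, so its twist is the identity tensored
  with its dimension; as the twist is trivial, the dimension is one.
\<close>

lemma \<sigma>_dimension:
  shows "evA' (\<sigma> \<nu>) \<odot> coevA (\<sigma> \<nu>) = idt \<one>" and "evA (\<sigma> \<nu>) \<odot> coevA' (\<sigma> \<nu>) = idt \<one>"
proof -
  let ?s = "\<sigma> \<nu>"
  have "((idt ?s \<boxtimes> evA' ?s) \<odot> (brd ?s ?s \<boxtimes> idt (dual C ?s))) \<odot> (idt ?s \<boxtimes> coevA ?s) = idt ?s"
    by (rule arrow_eqI) (simp_all add: \<sigma>_twist[unfolded right_twist_def] del: comp_assoc)
  then have "idt ?s \<boxtimes> (evA' ?s \<odot> coevA ?s) = idt ?s \<boxtimes> idt \<one>"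
    by (simp add: brd_\<sigma> merge)
  then show "evA' ?s \<odot> coevA ?s = idt \<one>"
    by (rule translate_cancel[rotated 2]) simp_all
next
  let ?s = "\<sigma> \<nu>"
  have left: "left_twist C c ?s = Id ?s" using twists_eq \<sigma>_twist by simp
  have "((evA ?s \<boxtimes> idt ?s) \<odot> (idt (dual C ?s) \<boxtimes> brd ?s ?s)) \<odot> (coevA' ?s \<boxtimes> idt ?s) = idt ?s"
    by (rule arrow_eqI) (simp_all add: left[unfolded left_twist_def] del: comp_assoc)
  then have "(evA ?s \<odot> coevA' ?s) \<boxtimes> idt ?s = idt \<one> \<boxtimes> idt ?s"
    by (simp add: brd_\<sigma> merge)
  then show "evA ?s \<odot> coevA' ?s = idt \<one>"
    by (rule translate_cancel_right[rotated 2]) simp_all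
qed

end


section \<open>Bilinear extension to finitely supported families\<close>

abbreviation component :: "('z \<Rightarrow>\<^sub>0 'm::zero) \<Rightarrow> 'z \<Rightarrow> 'm"
  where "component \<equiv> Poly_Mapping.lookup"

text \<open>
  Composition and tensor product of graded morphisms are both of this form, with different \<open>T\<close>.
\<close>

definition bext :: "('z::ab_group_add \<Rightarrow> 'z \<Rightarrow> 'm::ab_group_add \<Rightarrow> 'm \<Rightarrow> 'm) \<Rightarrow>
    ('z \<Rightarrow>\<^sub>0 'm) \<Rightarrow> ('z \<Rightarrow>\<^sub>0 'm) \<Rightarrow> ('z \<Rightarrow>\<^sub>0 'm)"
  where "bext T f g = (\<Sum>\<nu>\<in>Poly_Mapping.keys f. \<Sum>\<mu>\<in>Poly_Mapping.keys g.
    Poly_Mapping.single (\<nu> + \<mu>) (T \<nu> \<mu> (component f \<nu>) (component g \<mu>)))"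

text \<open>
  The operations of \<open>C\<close> are only additive on hom-spaces, hence the restriction to the
  families \<open>H\<close> and \<open>K\<close>.
\<close>

definition biadditive ::
  "('z \<Rightarrow> 'm::ab_group_add set) \<Rightarrow> ('z \<Rightarrow> 'm set) \<Rightarrow> ('z \<Rightarrow> 'z \<Rightarrow> 'm \<Rightarrow> 'm \<Rightarrow> 'm) \<Rightarrow> bool"
  where "biadditive H K T \<longleftrightarrow>
    (\<forall>\<nu>. 0 \<in> H \<nu>) \<and> (\<forall>\<mu>. 0 \<in> K \<mu>) \<and>
    (\<forall>\<nu> \<mu>. \<forall>x\<in>H \<nu>. \<forall>x'\<in>H \<nu>. \<forall>y\<in>K \<mu>. T \<nu> \<mu> (x + x') y = T \<nu> \<mu> x y + T \<nu> \<mu> x' y) \<and>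
    (\<forall>\<nu> \<mu>. \<forall>x\<in>H \<nu>. \<forall>y\<in>K \<mu>. \<forall>y'\<in>K \<mu>. T \<nu> \<mu> x (y + y') = T \<nu> \<mu> x y + T \<nu> \<mu> x y')"

lemma biadditiveD:
  assumes "biadditive H K T"
  shows "x \<in> H \<nu> \<Longrightarrow> x' \<in> H \<nu> \<Longrightarrow> y \<in> K \<mu> \<Longrightarrow> T \<nu> \<mu> (x + x') y = T \<nu> \<mu> x y + T \<nu> \<mu> x' y"
    and "x \<in> H \<nu> \<Longrightarrow> y \<in> K \<mu> \<Longrightarrow> y' \<in> K \<mu> \<Longrightarrow> T \<nu> \<mu> x (y + y') = T \<nu> \<mu> x y + T \<nu> \<mu> x y'"
    and "y \<in> K \<mu> \<Longrightarrow> T \<nu> \<mu> 0 y = 0" and "x \<in> H \<nu> \<Longrightarrow> T \<nu> \<mu> x 0 = 0"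
proof -
  show l: "T \<nu> \<mu> (x + x') y = T \<nu> \<mu> x y + T \<nu> \<mu> x' y" if "x \<in> H \<nu>" "x' \<in> H \<nu>" "y \<in> K \<mu>" for x x' y
    using assms that unfolding biadditive_def by blast
  show r: "T \<nu> \<mu> x (y + y') = T \<nu> \<mu> x y + T \<nu> \<mu> x y'" if "x \<in> H \<nu>" "y \<in> K \<mu>" "y' \<in> K \<mu>" for x y y'
    using assms that unfolding biadditive_def by blast
  have "0 \<in> H \<nu>" "0 \<in> K \<mu>" using assms unfolding biadditive_def by blast+
  then show "y \<in> K \<mu> \<Longrightarrow> T \<nu> \<mu> 0 y = 0" "x \<in> H \<nu> \<Longrightarrow> T \<nu> \<mu> x 0 = 0"
    using l[of 0 0 y] r[of x 0 0] by simp_all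
qed

lemma bext_superset:
  assumes T: "biadditive H K T"
    and f: "\<And>\<nu>. component f \<nu> \<in> H \<nu>" and g: "\<And>\<mu>. component g \<mu> \<in> K \<mu>"
    and A: "finite A" "Poly_Mapping.keys f \<subseteq> A" and B: "finite B" "Poly_Mapping.keys g \<subseteq> B"
  shows "bext T f g = (\<Sum>\<nu>\<in>A. \<Sum>\<mu>\<in>B.
    Poly_Mapping.single (\<nu> + \<mu>) (T \<nu> \<mu> (component f \<nu>) (component g \<mu>)))"
proof -
  have "(\<Sum>\<mu>\<in>Poly_Mapping.keys g.
        Poly_Mapping.single (\<nu> + \<mu>) (T \<nu> \<mu> (component f \<nu>) (component g \<mu>)))
    = (\<Sum>\<mu>\<in>B. Poly_Mapping.single (\<nu> + \<mu>) (T \<nu> \<mu> (component f \<nu>) (component g \<mu>)))"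
    for \<nu>
    by (rule sum.mono_neutral_left[OF B])
       (simp add: biadditiveD(4)[OF T f] in_keys_iff)
  moreover have "component f \<nu> = 0" if "\<nu> \<in> A - Poly_Mapping.keys f" for \<nu>
    using that by (simp add: in_keys_iff)
  ultimately show ?thesis
    unfolding bext_def by (intro sum.mono_neutral_cong_left[OF A]) (simp_all add: biadditiveD(3)[OF T g])
qed

lemma bext_add_left:
  assumes T: "biadditive H K T"
    and f: "\<And>\<nu>. component f \<nu> \<in> H \<nu>" "\<And>\<nu>. component f' \<nu> \<in> H \<nu>"
    and ff': "\<And>\<nu>. component (f + f') \<nu> \<in> H \<nu>"
    and g: "\<And>\<mu>. component g \<mu> \<in> K \<mu>"
  shows "bext T (f + f') g = bext T f g + bext T f' g"
proof -
  let ?A = "Poly_Mapping.keys f \<union> Poly_Mapping.keys f'" and ?B = "Poly_Mapping.keys g"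
  have k: "Poly_Mapping.keys (f + f') \<subseteq> ?A" by (rule Poly_Mapping.keys_add)
  show ?thesis
    using bext_superset[OF T ff' g, of ?A ?B] bext_superset[OF T f(1) g, of ?A ?B]
      bext_superset[OF T f(2) g, of ?A ?B] k
    by (simp add: lookup_add biadditiveD(1)[OF T f g] single_add sum.distrib)
qed

lemma bext_add_right:
  assumes T: "biadditive H K T"
    and f: "\<And>\<nu>. component f \<nu> \<in> H \<nu>"
    and g: "\<And>\<mu>. component g \<mu> \<in> K \<mu>" "\<And>\<mu>. component g' \<mu> \<in> K \<mu>"
    and gg': "\<And>\<mu>. component (g + g') \<mu> \<in> K \<mu>"
  shows "bext T f (g + g') = bext T f g + bext T f g'"
proof -
  let ?A = "Poly_Mapping.keys f" and ?B = "Poly_Mapping.keys g \<union> Poly_Mapping.keys g'"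
  have k: "Poly_Mapping.keys (g + g') \<subseteq> ?B" by (rule Poly_Mapping.keys_add)
  show ?thesis
    using bext_superset[OF T f gg', of ?A ?B] bext_superset[OF T f g(1), of ?A ?B]
      bext_superset[OF T f g(2), of ?A ?B] k
    by (simp add: lookup_add biadditiveD(2)[OF T f g] single_add sum.distrib)
qed

lemma bext_single:
  assumes T: "biadditive H K T" and x: "x \<in> H \<nu>" and y: "y \<in> K \<mu>"
  shows "bext T (Poly_Mapping.single \<nu> x) (Poly_Mapping.single \<mu> y)
    = Poly_Mapping.single (\<nu> + \<mu>) (T \<nu> \<mu> x y)"
  using biadditiveD(3)[OF T y] biadditiveD(4)[OF T x]
  by (cases "x = 0"; cases "y = 0") (simp_all add: bext_def)

section \<open>Graded morphisms and their composition\<close>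

context orbit_setting
begin

abbreviation "zhom \<equiv> CZ_Hom C \<sigma>"
abbreviation "orbit \<equiv> CZ C c deg \<sigma> r"
abbreviation "zcmp \<equiv> CZ_cmp C \<sigma>"
abbreviation "ztens \<equiv> CZ_tens C c deg \<sigma> r"
abbreviation zscale :: "'k \<Rightarrow> ('z \<Rightarrow>\<^sub>0 'm) \<Rightarrow> 'z \<Rightarrow>\<^sub>0 'm"
  where "zscale a \<equiv> Poly_Mapping.map (scale C a)"
abbreviation sing :: "'z \<Rightarrow> 'm \<Rightarrow> 'z \<Rightarrow>\<^sub>0 'm"
  where "sing \<equiv> Poly_Mapping.single"

lemma zhom_iff: "f \<in> zhom V W \<longleftrightarrow> (\<forall>\<nu>. component f \<nu> \<in> Hom V (\<sigma> \<nu> \<otimes> W))"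
  by (simp add: CZ_Hom_def)

lemma zhom_lookup: "f \<in> zhom V W \<Longrightarrow> component f \<nu> \<in> Hom V (\<sigma> \<nu> \<otimes> W)"
  by (simp add: zhom_iff)

lemma zhom_zero [simp]: "0 \<in> zhom V W"
  by (simp add: zhom_iff)

lemma zhom_add: "f \<in> zhom V W \<Longrightarrow> g \<in> zhom V W \<Longrightarrow> f + g \<in> zhom V W"
  by (simp add: zhom_iff lookup_add add_in_Hom)

lemma zhom_single: "x \<in> Hom V (\<sigma> \<nu> \<otimes> W) \<Longrightarrow> sing \<nu> x \<in> zhom V W"
  by (simp add: zhom_iff lookup_single when_def)

lemma lookup_zscale: "component (zscale a f) \<nu> = a \<cdot> component f \<nu>"
  by (simp add: map.rep_eq when_def)

lemma zscale_single: "zscale a (sing \<nu> x) = sing \<nu> (a \<cdot> x)"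
  by (rule poly_mapping_eqI) (simp add: lookup_zscale lookup_single when_def)

lemma zscale_add: "zscale a (f + g) = zscale a f + zscale a g"
  by (rule poly_mapping_eqI) (simp add: lookup_zscale lookup_add vs.scale_right_distrib)

lemma zscale_zero [simp]: "zscale a 0 = 0"
  by (rule poly_mapping_eqI) (simp add: lookup_zscale)

lemma zhom_scale: "f \<in> zhom V W \<Longrightarrow> zscale a f \<in> zhom V W"
  by (simp add: zhom_iff lookup_zscale scale_in_Hom)

text \<open>
  The graded morphism with \<open>F : V \<rightarrow> \<sigma>\<^sub>\<nu> \<otimes> W\<close> in degree \<open>\<nu>\<close> and zero elsewhere.  The argument is a whole
  arrow, so that the diagram calculus applies below \<open>zmor\<close>.
\<close>

definition zmor :: "'z \<Rightarrow> ('o, 'm) arrow \<Rightarrow> 'z \<Rightarrow>\<^sub>0 'm"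
  where "zmor \<nu> F = sing \<nu> (mor F)"

lemma zmor_in_zhom: "arr F \<Longrightarrow> src F = V \<Longrightarrow> tgt F = \<sigma> \<nu> \<otimes> W \<Longrightarrow> zmor \<nu> F \<in> zhom V W"
  unfolding zmor_def arr_def by (auto intro: zhom_single)

text \<open>An additive statement about graded morphisms only has to be checked in a single degree.\<close>

lemma zhom_induct [consumes 1, case_names zero single add]:
  assumes f: "f \<in> zhom V W"
    and zero: "P 0"
    and single: "\<And>\<nu> F. arr F \<Longrightarrow> src F = V \<Longrightarrow> tgt F = \<sigma> \<nu> \<otimes> W \<Longrightarrow> P (zmor \<nu> F)"
    and add: "\<And>f g. f \<in> zhom V W \<Longrightarrow> g \<in> zhom V W \<Longrightarrow> P f \<Longrightarrow> P g \<Longrightarrow> P (f + g)"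
  shows "P f"
proof -
  have f_eq: "f = (\<Sum>\<nu>\<in>Poly_Mapping.keys f. sing \<nu> (component f \<nu>))"
    by (rule poly_mapping_eqI)
       (simp add: lookup_sum lookup_single when_def in_keys_iff sum.delta)
  have "P (\<Sum>\<nu>\<in>A. sing \<nu> (component f \<nu>)) \<and> (\<Sum>\<nu>\<in>A. sing \<nu> (component f \<nu>)) \<in> zhom V W"
    if "finite A" for A
    using that
  proof induction
    case (insert \<nu> A)
    have "P (sing \<nu> (component f \<nu>))" "sing \<nu> (component f \<nu>) \<in> zhom V W"
      using single[of "Arrow V (\<sigma> \<nu> \<otimes> W) (component f \<nu>)"] zhom_lookup[OF f]
      by (simp_all add: zhom_single zmor_def)
    then show ?case using insert by (simp add: add zhom_add)
  qed (simp add: zero)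
  then show ?thesis using f_eq by (metis finite_keys)
qed

lemma zscale_sum: "zscale a (\<Sum>j\<in>J. f j) = (\<Sum>j\<in>J. zscale a (f j))"
  by (induction J rule: infinite_finite_induct) (simp_all add: zscale_add)

lemma keys_zscale: "Poly_Mapping.keys (zscale a f) \<subseteq> Poly_Mapping.keys f"
  by (auto simp: in_keys_iff lookup_zscale)

lemma bext_scale_left:
  assumes T: "biadditive H K T"
    and f: "\<And>\<nu>. component f \<nu> \<in> H \<nu>" "\<And>\<nu>. component (zscale a f) \<nu> \<in> H \<nu>"
    and g: "\<And>\<mu>. component g \<mu> \<in> K \<mu>"
    and scale: "\<And>\<nu> \<mu> x y. x \<in> H \<nu> \<Longrightarrow> y \<in> K \<mu> \<Longrightarrow> T \<nu> \<mu> (a \<cdot> x) y = a \<cdot> T \<nu> \<mu> x y"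
  shows "bext T (zscale a f) g = zscale a (bext T f g)"
  using bext_superset[OF T f(2) g finite_keys keys_zscale finite_keys order_refl]
  by (simp add: bext_def[of T f] zscale_sum zscale_single lookup_zscale scale[OF f(1) g])

lemma bext_scale_right:
  assumes T: "biadditive H K T"
    and f: "\<And>\<nu>. component f \<nu> \<in> H \<nu>"
    and g: "\<And>\<mu>. component g \<mu> \<in> K \<mu>" "\<And>\<mu>. component (zscale a g) \<mu> \<in> K \<mu>"
    and scale: "\<And>\<nu> \<mu> x y. x \<in> H \<nu> \<Longrightarrow> y \<in> K \<mu> \<Longrightarrow> T \<nu> \<mu> x (a \<cdot> y) = a \<cdot> T \<nu> \<mu> x y"
  shows "bext T f (zscale a g) = zscale a (bext T f g)"
  using bext_superset[OF T f g(2) finite_keys order_refl finite_keys keys_zscale]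
  by (simp add: bext_def[of T f g] zscale_sum zscale_single lookup_zscale scale[OF f g(1)])

lemma zcmp_bext: "zcmp g f = bext (\<lambda>\<nu> \<mu> x y. (Id (\<sigma> \<nu>) \<otimes>\<^sub>m y) \<bullet> x) f g"
  by (simp add: CZ_cmp_def bext_def)

lemma zcmp_biadditive:
  "biadditive (\<lambda>\<nu>. Hom U (\<sigma> \<nu> \<otimes> V)) (\<lambda>\<mu>. Hom V (\<sigma> \<mu> \<otimes> W)) (\<lambda>\<nu> \<mu> x y. (Id (\<sigma> \<nu>) \<otimes>\<^sub>m y) \<bullet> x)"
  unfolding biadditive_def
proof (intro conjI allI ballI)
  fix \<nu> \<mu> x x' y y'
  assume x: "x \<in> Hom U (\<sigma> \<nu> \<otimes> V)" and y: "y \<in> Hom V (\<sigma> \<mu> \<otimes> W)"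
  note ty = tens_in_Hom[OF Id_in_Hom y, of "\<sigma> \<nu>"]
  show "(Id (\<sigma> \<nu>) \<otimes>\<^sub>m y) \<bullet> (x + x') = (Id (\<sigma> \<nu>) \<otimes>\<^sub>m y) \<bullet> x + (Id (\<sigma> \<nu>) \<otimes>\<^sub>m y) \<bullet> x'"
    if "x' \<in> Hom U (\<sigma> \<nu> \<otimes> V)" by (rule cmp_add_right[OF x that ty])
  show "(Id (\<sigma> \<nu>) \<otimes>\<^sub>m (y + y')) \<bullet> x = (Id (\<sigma> \<nu>) \<otimes>\<^sub>m y) \<bullet> x + (Id (\<sigma> \<nu>) \<otimes>\<^sub>m y') \<bullet> x"
    if y': "y' \<in> Hom V (\<sigma> \<mu> \<otimes> W)"
    by (simp add: tens_add_right[OF Id_in_Hom y y'] cmp_add_left[OF x ty tens_in_Hom[OF Id_in_Hom y']])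
qed simp_all

lemma zcmp_add_left:
  "f \<in> zhom U V \<Longrightarrow> g \<in> zhom V W \<Longrightarrow> g' \<in> zhom V W \<Longrightarrow> zcmp (g + g') f = zcmp g f + zcmp g' f"
  unfolding zcmp_bext by (rule bext_add_right[OF zcmp_biadditive]) (rule zhom_lookup zhom_add; assumption?)+

lemma zcmp_add_right:
  "f \<in> zhom U V \<Longrightarrow> f' \<in> zhom U V \<Longrightarrow> g \<in> zhom V W \<Longrightarrow> zcmp g (f + f') = zcmp g f + zcmp g f'"
  unfolding zcmp_bext by (rule bext_add_left[OF zcmp_biadditive]) (rule zhom_lookup zhom_add; assumption?)+

lemma zcmp_zero [simp]: "zcmp 0 f = 0" "zcmp g 0 = 0"
  by (simp_all add: CZ_cmp_def)

text \<open>
  Every object is a translate of another one, so the target of \<open>G\<close> automatically has the form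
  \<open>\<sigma>\<^sub>\<mu> \<otimes> W\<close>.
\<close>

lemma zcmp_zmor:
  assumes "arr F" "arr G" "tgt F = \<sigma> \<nu> \<otimes> src G"
  shows "zcmp (zmor \<mu> G) (zmor \<nu> F) = zmor (\<nu> + \<mu>) ((idt (\<sigma> \<nu>) \<boxtimes> G) \<odot> F)"
  using bext_single[OF zcmp_biadditive, of "mor F" "src F" \<nu> "src G" "mor G" \<mu> "\<sigma> (- \<mu>) \<otimes> tgt G"] assms
  by (simp add: zcmp_bext arr_def zmor_def)

lemma zcmp_in_zhom:
  assumes f: "f \<in> zhom U V" and g: "g \<in> zhom V W"
  shows "zcmp g f \<in> zhom U W"
  using f
proof (induction rule: zhom_induct)
  case (single \<nu> F)
  note F = this
  from g show ?case
  proof (induction rule: zhom_induct)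
    case (single \<mu> G)
    then show ?case using F by (simp add: zcmp_zmor zmor_in_zhom)
  next
    case (add g g')
    then show ?case using zcmp_add_left[OF zmor_in_zhom[OF F] add(1,2)] by (simp add: zhom_add)
  qed simp
next
  case (add f f')
  then show ?case by (simp add: zcmp_add_right[OF _ _ g] zhom_add)
qed simp

lemma zcmp_scale:
  assumes f: "f \<in> zhom U V" and g: "g \<in> zhom V W"
  shows "zcmp (zscale a g) f = zscale a (zcmp g f)" "zcmp g (zscale a f) = zscale a (zcmp g f)"
proof -
  note ty = zhom_lookup[OF f] zhom_lookup[OF g] zhom_lookup[OF zhom_scale[OF f]]
    zhom_lookup[OF zhom_scale[OF g]]
  show "zcmp (zscale a g) f = zscale a (zcmp g f)"
    unfolding zcmp_bext
    by (rule bext_scale_right[OF zcmp_biadditive ty(1,2,4)])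
       (simp only: tens_scale_right[OF Id_in_Hom] cmp_scale_left[OF _ tens_in_Hom[OF Id_in_Hom]])
  show "zcmp g (zscale a f) = zscale a (zcmp g f)"
    unfolding zcmp_bext
    by (rule bext_scale_left[OF zcmp_biadditive ty(1,3,2)])
       (simp only: cmp_scale_right[OF _ tens_in_Hom[OF Id_in_Hom]])
qed

lemma zcmp_assoc:
  assumes f: "f \<in> zhom U V" and g: "g \<in> zhom V W" and h: "h \<in> zhom W W'"
  shows "zcmp (zcmp h g) f = zcmp h (zcmp g f)"
  using f
proof (induction rule: zhom_induct)
  case (single \<nu> F)
  note F = this
  note F' = zmor_in_zhom[OF F]
  from g show ?case
  proof (induction rule: zhom_induct)
    case (single \<mu> G)
    note G = this
    note G' = zmor_in_zhom[OF G]
    from h show ?case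
    proof (induction rule: zhom_induct)
      case (single \<kappa> H)
      then show ?case using F G by (simp add: zcmp_zmor whisker_left tensor_idt_idt add.assoc)
    next
      case (add h h')
      then show ?case
        by (simp add: zcmp_add_left[OF G' add(1,2)] zcmp_add_left[OF zcmp_in_zhom[OF F' G'] add(1,2)]
          zcmp_add_left[OF F' zcmp_in_zhom[OF G' add(1)] zcmp_in_zhom[OF G' add(2)]])
    qed simp
  next
    case (add g g')
    then show ?case
      by (simp add: zcmp_add_right[OF add(1,2) h] zcmp_add_left[OF F' add(1,2)]
        zcmp_add_left[OF F' zcmp_in_zhom[OF add(1) h] zcmp_in_zhom[OF add(2) h]]
        zcmp_add_right[OF zcmp_in_zhom[OF F' add(1)] zcmp_in_zhom[OF F' add(2)] h])
  qed simp
next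
  case (add f f')
  then show ?case
    by (simp add: zcmp_add_right[OF add(1,2) g] zcmp_add_right[OF add(1,2) zcmp_in_zhom[OF g h]]
      zcmp_add_right[OF zcmp_in_zhom[OF add(1) g] zcmp_in_zhom[OF add(2) g] h])
qed simp

lemma zmor_idt: "zmor 0 (idt V) = sing 0 (Id V)"
  by (simp add: zmor_def)

lemma zId_in_zhom: "sing 0 (Id V) \<in> zhom V V"
  unfolding zmor_idt[symmetric] by (rule zmor_in_zhom) simp_all

lemma zcmp_Id:
  assumes f: "f \<in> zhom V W"
  shows "zcmp (sing 0 (Id W)) f = f" and "zcmp f (sing 0 (Id V)) = f"
proof -
  have "zcmp (sing 0 (Id W)) f = f \<and> zcmp f (sing 0 (Id V)) = f"
    using f
  proof (induction rule: zhom_induct)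
    case (single \<nu> F)
    then show ?case by (simp add: zmor_idt[symmetric] zcmp_zmor tensor_idt)
  next
    case (add f g)
    then show ?case
      by (simp add: zcmp_add_right[OF add(1,2) zId_in_zhom] zcmp_add_left[OF zId_in_zhom add(1,2)])
  qed simp
  then show "zcmp (sing 0 (Id W)) f = f" "zcmp f (sing 0 (Id V)) = f" by simp_all
qed

lemma CZ_simps [simp]:
  "scale orbit = zscale" "hom orbit = zhom"
  "ident orbit V = sing 0 (Id V)" "cmp orbit = zcmp"
  "unit_ob orbit = \<one>" "tens_ob orbit = tens_ob C"
  "tens orbit = ztens" "dual orbit = dual C"
  "coev orbit V = sing 0 (coev C V)" "ev orbit V = sing 0 (ev C V)"
  "coev' orbit V = sing 0 (coev' C V)" "ev' orbit V = sing 0 (ev' C V)"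
  by (simp_all add: CZ_def)

lemma zhom_disjoint:
  assumes f: "f \<in> zhom V W" "f \<in> zhom V' W'" "f \<noteq> 0"
  shows "V = V' \<and> W = W'"
proof -
  obtain \<nu> where "component f \<nu> \<noteq> 0"
    using f(3) by (metis poly_mapping_eqI lookup_zero)
  then have "V = V'" using Hom_disjoint zhom_lookup f(1,2) by blast
  then show ?thesis using CZ_target_eq f by metis
qed

lemma CZ_linear_category: "linear_category orbit"
proof -
  have vs: "vector_space zscale"
    by unfold_locales
       (auto intro!: poly_mapping_eqI simp: lookup_zscale lookup_add vs.scale_right_distrib vs.scale_left_distrib)
  then interpret z: vector_space zscale .
  have sub: "z.subspace (zhom V W)" for V W
    by (simp add: z.subspace_def zhom_add zhom_scale)
  show ?thesis
  proof (rule linear_category.intro, unfold CZ_simps)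
    show "zcmp (zscale a g + zscale a' g') f = zscale a (zcmp g f) + zscale a' (zcmp g' f)"
      if "f \<in> zhom U V" "g \<in> zhom V W" "g' \<in> zhom V W" for f U V g W g' a a'
      using that zcmp_add_left[OF that(1) zhom_scale[OF that(2)] zhom_scale[OF that(3)]]
      by (simp add: zcmp_scale)
    show "zcmp g (zscale a f + zscale a' f') = zscale a (zcmp g f) + zscale a' (zcmp g f')"
      if "f \<in> zhom U V" "f' \<in> zhom U V" "g \<in> zhom V W" for f U V f' g W a a'
      using that zcmp_add_right[OF zhom_scale[OF that(1)] zhom_scale[OF that(2)] that(3)]
      by (simp add: zcmp_scale)
  qed (rule vs sub zId_in_zhom zhom_disjoint zcmp_in_zhom zcmp_assoc zcmp_Id; assumption?)+
qed

end

section \<open>The tensor product of graded morphisms\<close>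

context orbit_setting
begin

text \<open>
  The target that enters the definition of the tensor product is only determined for non-zero
  morphisms; if one factor is zero, both sides are empty sums.
\<close>

lemma ztens_bext:
  assumes f: "f \<in> zhom U V" and h: "h \<in> zhom U' V'"
  shows "ztens f h = bext (\<lambda>\<nu> \<mu> x y. (Id (\<sigma> \<nu>) \<otimes>\<^sub>m mor (hb V \<mu>) \<otimes>\<^sub>m Id V') \<bullet> (x \<otimes>\<^sub>m y)) f h"
proof (cases "f = 0 \<or> h = 0")
  case True
  then show ?thesis by (auto simp: CZ_tens_def bext_def)
next
  case False
  then show ?thesis
    using CZ_target_eq[OF f] CZ_target_eq[OF h] by (simp add: CZ_tens_def bext_def half_braiding_eq)
qed

lemma ztens_factor_in_Hom: "Id (\<sigma> \<nu>) \<otimes>\<^sub>m mor (hb V \<mu>) \<otimes>\<^sub>m Id V'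
    \<in> Hom ((\<sigma> \<nu> \<otimes> V) \<otimes> (\<sigma> \<mu> \<otimes> V')) (\<sigma> (\<nu> + \<mu>) \<otimes> (V \<otimes> V'))"
proof -
  have "arr ((idt (\<sigma> \<nu>) \<boxtimes> hb V \<mu>) \<boxtimes> idt V')" by simp
  then show ?thesis unfolding arr_def by (simp del: tensor_assoc)
qed

lemma ztens_biadditive:
  "biadditive (\<lambda>\<nu>. Hom U (\<sigma> \<nu> \<otimes> V)) (\<lambda>\<mu>. Hom U' (\<sigma> \<mu> \<otimes> V'))
    (\<lambda>\<nu> \<mu> x y. (Id (\<sigma> \<nu>) \<otimes>\<^sub>m mor (hb V \<mu>) \<otimes>\<^sub>m Id V') \<bullet> (x \<otimes>\<^sub>m y))"
  unfolding biadditive_def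
proof (intro conjI allI ballI)
  fix \<nu> \<mu> x x' y y'
  assume x: "x \<in> Hom U (\<sigma> \<nu> \<otimes> V)" and y: "y \<in> Hom U' (\<sigma> \<mu> \<otimes> V')"
  let ?L = "Id (\<sigma> \<nu>) \<otimes>\<^sub>m mor (hb V \<mu>) \<otimes>\<^sub>m Id V'"
  note L = ztens_factor_in_Hom[of \<nu> V \<mu> V']
  show "?L \<bullet> ((x + x') \<otimes>\<^sub>m y) = ?L \<bullet> (x \<otimes>\<^sub>m y) + ?L \<bullet> (x' \<otimes>\<^sub>m y)"
    if x': "x' \<in> Hom U (\<sigma> \<nu> \<otimes> V)"
    by (simp only: tens_add_left[OF x x' y] cmp_add_right[OF tens_in_Hom[OF x y] tens_in_Hom[OF x' y] L])
  show "?L \<bullet> (x \<otimes>\<^sub>m (y + y')) = ?L \<bullet> (x \<otimes>\<^sub>m y) + ?L \<bullet> (x \<otimes>\<^sub>m y')"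
    if y': "y' \<in> Hom U' (\<sigma> \<mu> \<otimes> V')"
    by (simp only: tens_add_right[OF x y y'] cmp_add_right[OF tens_in_Hom[OF x y] tens_in_Hom[OF x y'] L])
qed simp_all

lemma ztens_zero [simp]: "ztens 0 h = 0" "ztens f 0 = 0"
  by (simp_all add: CZ_tens_def)

lemma ztens_add_left:
  assumes "f \<in> zhom U V" "f' \<in> zhom U V" "h \<in> zhom U' V'"
  shows "ztens (f + f') h = ztens f h + ztens f' h"
  unfolding ztens_bext[OF assms(1,3)] ztens_bext[OF assms(2,3)] ztens_bext[OF zhom_add[OF assms(1,2)] assms(3)]
  by (rule bext_add_left[OF ztens_biadditive]) (use assms zhom_lookup zhom_add in blast)+

lemma ztens_add_right:
  assumes "f \<in> zhom U V" "h \<in> zhom U' V'" "h' \<in> zhom U' V'"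
  shows "ztens f (h + h') = ztens f h + ztens f h'"
  unfolding ztens_bext[OF assms(1,2)] ztens_bext[OF assms(1,3)] ztens_bext[OF assms(1) zhom_add[OF assms(2,3)]]
  by (rule bext_add_right[OF ztens_biadditive]) (use assms zhom_lookup zhom_add in blast)+

lemma ztens_zmor:
  assumes "arr F" "arr H"
  shows "ztens (zmor \<nu> F) (zmor \<mu> H) = zmor (\<nu> + \<mu>)
    ((idt (\<sigma> \<nu>) \<boxtimes> hb (\<sigma> (- \<nu>) \<otimes> tgt F) \<mu> \<boxtimes> idt (\<sigma> (- \<mu>) \<otimes> tgt H)) \<odot> (F \<boxtimes> H))"
proof -
  let ?V = "\<sigma> (- \<nu>) \<otimes> tgt F" and ?W = "\<sigma> (- \<mu>) \<otimes> tgt H"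
  have F: "mor F \<in> Hom (src F) (\<sigma> \<nu> \<otimes> ?V)" and H: "mor H \<in> Hom (src H) (\<sigma> \<mu> \<otimes> ?W)"
    using assms by (simp_all add: arr_def)
  have "ztens (zmor \<nu> F) (zmor \<mu> H)
      = sing (\<nu> + \<mu>) ((Id (\<sigma> \<nu>) \<otimes>\<^sub>m mor (hb ?V \<mu>) \<otimes>\<^sub>m Id ?W) \<bullet> (mor F \<otimes>\<^sub>m mor H))"
    using bext_single[OF ztens_biadditive F H] ztens_bext[OF zhom_single[OF F] zhom_single[OF H]]
    by (simp add: zmor_def)
  also have "Id (\<sigma> \<nu>) \<otimes>\<^sub>m mor (hb ?V \<mu>) \<otimes>\<^sub>m Id ?W = mor ((idt (\<sigma> \<nu>) \<boxtimes> hb ?V \<mu>) \<boxtimes> idt ?W)"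
    by (simp del: tensor_assoc)
  finally show ?thesis by (simp add: zmor_def)
qed

lemma ztens_in_zhom:
  assumes f: "f \<in> zhom U V" and h: "h \<in> zhom U' V'"
  shows "ztens f h \<in> zhom (U \<otimes> U') (V \<otimes> V')"
  using f
proof (induction rule: zhom_induct)
  case (single \<nu> F)
  note F = this
  from h show ?case
  proof (induction rule: zhom_induct)
    case (single \<mu> H)
    then show ?case using F by (simp add: ztens_zmor zmor_in_zhom)
  next
    case (add h h')
    then show ?case using ztens_add_right[OF zmor_in_zhom[OF F] add(1,2)] by (simp add: zhom_add)
  qed simp
next
  case (add f f')
  then show ?case by (simp add: ztens_add_left[OF _ _ h] zhom_add)
qed simp

lemma ztens_scale:
  assumes f: "f \<in> zhom U V" and h: "h \<in> zhom U' V'"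
  shows "ztens (zscale a f) h = zscale a (ztens f h)" "ztens f (zscale a h) = zscale a (ztens f h)"
proof -
  note ty = zhom_lookup[OF f] zhom_lookup[OF h] zhom_lookup[OF zhom_scale[OF f]]
    zhom_lookup[OF zhom_scale[OF h]]
  show "ztens (zscale a f) h = zscale a (ztens f h)"
    unfolding ztens_bext[OF f h] ztens_bext[OF zhom_scale[OF f] h]
    by (rule bext_scale_left[OF ztens_biadditive ty(1,3,2)])
       (simp only: tens_scale_left cmp_scale_right[OF tens_in_Hom ztens_factor_in_Hom])
  show "ztens f (zscale a h) = zscale a (ztens f h)"
    unfolding ztens_bext[OF f h] ztens_bext[OF f zhom_scale[OF h]]
    by (rule bext_scale_right[OF ztens_biadditive ty(1,2,4)])
       (simp only: tens_scale_right cmp_scale_right[OF tens_in_Hom ztens_factor_in_Hom])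
qed

text \<open>
  The exchange law in homogeneous degrees.  The half-braiding with \<open>\<sigma>\<^bsub>\<nu>'+\<mu>'\<^esub>\<close> factors into two; the
  factor for \<open>\<nu>'\<close> moves past \<open>G\<close> by naturality.  The target of \<open>G\<close> carries an extra \<open>\<sigma>\<^sub>\<mu>\<close>, which is
  harmless because \<open>\<sigma>\<^sub>\<mu>\<close> half-braids trivially.
\<close>

lemma hb_exchange:
  assumes F: "arr F" "tgt F = \<sigma> \<nu> \<otimes> src G" and G: "arr G" "tgt G = \<sigma> \<mu> \<otimes> V"
    and F': "arr F'" "tgt F' = \<sigma> \<nu>' \<otimes> src G'" and G': "arr G'" "tgt G' = \<sigma> \<mu>' \<otimes> V'"
  shows "(idt (\<sigma> (\<nu> + \<mu>)) \<boxtimes> hb V (\<nu>' + \<mu>') \<boxtimes> idt V')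
        \<odot> (((idt (\<sigma> \<nu>) \<boxtimes> G) \<odot> F) \<boxtimes> ((idt (\<sigma> \<nu>') \<boxtimes> G') \<odot> F'))
    = (idt (\<sigma> (\<nu> + \<nu>')) \<boxtimes> ((idt (\<sigma> \<mu>) \<boxtimes> hb V \<mu>' \<boxtimes> idt V') \<odot> (G \<boxtimes> G')))
        \<odot> (idt (\<sigma> \<nu>) \<boxtimes> hb (src G) \<nu>' \<boxtimes> idt (src G')) \<odot> (F \<boxtimes> F')" (is "?L = ?R")
proof -
  let ?T = "idt (\<sigma> (\<nu> + \<mu> + \<nu>')) \<boxtimes> hb V \<mu>' \<boxtimes> idt V'"
  let ?M = "idt (\<sigma> (\<nu> + \<mu>)) \<boxtimes> hb V \<nu>' \<boxtimes> idt (\<sigma> \<mu>' \<otimes> V')"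
  let ?K = "(idt (\<sigma> \<nu>) \<boxtimes> G) \<boxtimes> (idt (\<sigma> \<nu>') \<boxtimes> G')"
  let ?N = "idt (\<sigma> \<nu>) \<boxtimes> hb (src G) \<nu>' \<boxtimes> idt (src G')"
  have 1: "idt (\<sigma> (\<nu> + \<mu>)) \<boxtimes> hb V (\<nu>' + \<mu>') \<boxtimes> idt V' = ?T \<odot> ?M"
    by (simp add: hb_add whisker_left whisker_right tensor_idt tensor_idt_idt add.assoc)
  have 2: "((idt (\<sigma> \<nu>) \<boxtimes> G) \<odot> F) \<boxtimes> ((idt (\<sigma> \<nu>') \<boxtimes> G') \<odot> F') = ?K \<odot> (F \<boxtimes> F')"
    using exchange[of F "idt (\<sigma> \<nu>) \<boxtimes> G" F' "idt (\<sigma> \<nu>') \<boxtimes> G'"] assms by simp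
  have "?M \<odot> ?K = (idt (\<sigma> \<nu>) \<boxtimes> hb (\<sigma> \<mu> \<otimes> V) \<nu>' \<boxtimes> idt (\<sigma> \<mu>' \<otimes> V'))
      \<odot> (idt (\<sigma> \<nu>) \<boxtimes> (G \<boxtimes> idt (\<sigma> \<nu>')) \<boxtimes> G')"
    using G G' by (simp add: hb_\<sigma>_tens tensor_idt_idt)
  also have "\<dots> = idt (\<sigma> \<nu>) \<boxtimes> (hb (\<sigma> \<mu> \<otimes> V) \<nu>' \<odot> (G \<boxtimes> idt (\<sigma> \<nu>'))) \<boxtimes> G'"
    using G G' by (simp add: merge del: tensor_assoc)
  also have "hb (\<sigma> \<mu> \<otimes> V) \<nu>' \<odot> (G \<boxtimes> idt (\<sigma> \<nu>')) = (idt (\<sigma> \<nu>') \<boxtimes> G) \<odot> hb (src G) \<nu>'"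
    using hb_natural[OF G(1)] G(2) by simp
  also have "idt (\<sigma> \<nu>) \<boxtimes> ((idt (\<sigma> \<nu>') \<boxtimes> G) \<odot> hb (src G) \<nu>') \<boxtimes> G'
     = (idt (\<sigma> \<nu>) \<boxtimes> (idt (\<sigma> \<nu>') \<boxtimes> G) \<boxtimes> G') \<odot> ?N"
    using G G' by (simp add: merge del: tensor_assoc)
  finally have 3: "?M \<odot> ?K = (idt (\<sigma> (\<nu> + \<nu>')) \<boxtimes> G \<boxtimes> G') \<odot> ?N"
    using G G' by (simp add: tensor_idt_idt)
  have "?L = ?T \<odot> (?M \<odot> ?K) \<odot> (F \<boxtimes> F')"
    unfolding 1 2 using assms by (simp add: add_ac)
  also have "\<dots> = ?T \<odot> (idt (\<sigma> (\<nu> + \<nu>')) \<boxtimes> G \<boxtimes> G') \<odot> ?N \<odot> (F \<boxtimes> F')"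
    unfolding 3 using assms by (simp add: add_ac)
  also have "\<dots> = ?R"
    using assms by (simp add: whisker_left tensor_idt_idt add_ac)
  finally show ?thesis .
qed

lemma ztens_cmp:
  assumes f: "f \<in> zhom U V" and g: "g \<in> zhom V W" and f': "f' \<in> zhom U' V'" and g': "g' \<in> zhom V' W'"
  shows "ztens (zcmp g f) (zcmp g' f') = zcmp (ztens g g') (ztens f f')"
proof -
  \<comment> \<open>instantiated completely, since rewriting cannot guess the endpoints of the morphisms\<close>
  note mem = zcmp_in_zhom[where U=U and V=V and W=W] zcmp_in_zhom[where U=U' and V=V' and W=W']
    ztens_in_zhom[of _ U V _ U' V']
    ztens_in_zhom[of _ V W _ V' W'] zmor_in_zhom
  note dist = zcmp_add_left[where U=U and V=V and W=W] zcmp_add_right[where U=U and V=V and W=W]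
    zcmp_add_left[where U=U' and V=V' and W=W'] zcmp_add_right[where U=U' and V=V' and W=W']
    zcmp_add_left[where U="U \<otimes> U'" and V="V \<otimes> V'" and W="W \<otimes> W'"]
    zcmp_add_right[where U="U \<otimes> U'" and V="V \<otimes> V'" and W="W \<otimes> W'"]
    ztens_add_left[of _ U V _ _ U' V']
    ztens_add_right[of _ U V _ U' V']
    ztens_add_left[of _ V W _ _ V' W']
    ztens_add_right[of _ V W _ V' W']
    ztens_add_left[of _ U W _ _ U' W']
    ztens_add_right[of _ U W _ U' W']
  from f show ?thesis
  proof (induction rule: zhom_induct)
    case (single \<nu> F)
    note F = this
    from g show ?case
    proof (induction rule: zhom_induct)
      case (single \<mu> G)
      note G = this
      from f' show ?case
      proof (induction rule: zhom_induct)
        case (single \<nu>' F')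
        note F' = this
        from g' show ?case
        proof (induction rule: zhom_induct)
          case (single \<mu>' G')
          then show ?case
            using F G F' hb_exchange[of F \<nu> G \<mu> W F' \<nu>' G' \<mu>' W']
            by (simp add: zcmp_zmor ztens_zmor) (simp add: add_ac)
        qed (use F G F' in \<open>simp_all add: dist mem\<close>)
      qed (use F G g' in \<open>simp_all add: dist mem\<close>)
    qed (use F f' g' in \<open>simp_all add: dist mem\<close>)
  qed (use g f' g' in \<open>simp_all add: dist mem\<close>)
qed

text \<open>
  Associativity in homogeneous degrees: both sides consist of the half-braidings of \<open>U\<close> past
  \<open>\<sigma>\<^sub>\<mu>\<close> and \<open>\<sigma>\<^sub>\<kappa>\<close> and of \<open>V\<close> past \<open>\<sigma>\<^sub>\<kappa>\<close>, and the ones at \<open>U, \<sigma>\<^sub>\<mu>\<close> and at \<open>V, \<sigma>\<^sub>\<kappa>\<close> commute.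
\<close>

lemma hb_assoc:
  assumes F: "arr F" "tgt F = \<sigma> \<nu> \<otimes> U" and G: "arr G" "tgt G = \<sigma> \<mu> \<otimes> V"
    and H: "arr H" "tgt H = \<sigma> \<kappa> \<otimes> W"
  shows "(idt (\<sigma> (\<nu> + \<mu>)) \<boxtimes> hb (U \<otimes> V) \<kappa> \<boxtimes> idt W)
      \<odot> (((idt (\<sigma> \<nu>) \<boxtimes> hb U \<mu> \<boxtimes> idt V) \<odot> (F \<boxtimes> G)) \<boxtimes> H)
    = (idt (\<sigma> \<nu>) \<boxtimes> hb U (\<mu> + \<kappa>) \<boxtimes> idt (V \<otimes> W))
      \<odot> (F \<boxtimes> ((idt (\<sigma> \<mu>) \<boxtimes> hb V \<kappa> \<boxtimes> idt W) \<odot> (G \<boxtimes> H)))" (is "?L = ?R")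
proof -
  let ?T = "idt (\<sigma> (\<nu> + \<mu>)) \<boxtimes> hb U \<kappa> \<boxtimes> idt (V \<otimes> W)"
  have "?L = ?T \<odot> ((idt (\<sigma> (\<nu> + \<mu>)) \<boxtimes> idt U \<boxtimes> hb V \<kappa> \<boxtimes> idt W)
      \<odot> (idt (\<sigma> \<nu>) \<boxtimes> hb U \<mu> \<boxtimes> idt (V \<otimes> \<sigma> \<kappa> \<otimes> W))) \<odot> (F \<boxtimes> G \<boxtimes> H)"
  proof -
    have "((idt (\<sigma> \<nu>) \<boxtimes> hb U \<mu> \<boxtimes> idt V) \<odot> (F \<boxtimes> G)) \<boxtimes> H
       = ((idt (\<sigma> \<nu>) \<boxtimes> hb U \<mu> \<boxtimes> idt V) \<boxtimes> idt (\<sigma> \<kappa> \<otimes> W)) \<odot> ((F \<boxtimes> G) \<boxtimes> H)"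
      using assms by (simp add: exchange del: tensor_assoc)
    then show ?thesis using assms
      by (simp add: hb_tens whisker_left whisker_right tensor_idt tensor_idt_idt)
  qed
  also have "(idt (\<sigma> (\<nu> + \<mu>)) \<boxtimes> idt U \<boxtimes> hb V \<kappa> \<boxtimes> idt W)
      \<odot> (idt (\<sigma> \<nu>) \<boxtimes> hb U \<mu> \<boxtimes> idt (V \<otimes> \<sigma> \<kappa> \<otimes> W))
    = idt (\<sigma> \<nu>) \<boxtimes> hb U \<mu> \<boxtimes> hb V \<kappa> \<boxtimes> idt W"
  proof -
    have "idt (\<sigma> (\<nu> + \<mu>)) \<boxtimes> idt U \<boxtimes> hb V \<kappa> \<boxtimes> idt W
        = idt (\<sigma> \<nu>) \<boxtimes> idt (\<sigma> \<mu> \<otimes> U) \<boxtimes> (hb V \<kappa> \<boxtimes> idt W)"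
      by (simp add: tensor_idt_idt)
    then show ?thesis by (simp add: exchange)
  qed
  also have "\<dots> = (idt (\<sigma> \<nu>) \<boxtimes> hb U \<mu> \<boxtimes> idt (\<sigma> \<kappa> \<otimes> V \<otimes> W))
      \<odot> (idt (\<sigma> \<nu>) \<boxtimes> idt (U \<otimes> \<sigma> \<mu>) \<boxtimes> (hb V \<kappa> \<boxtimes> idt W))"
    by (simp add: exchange)
  also have "?T \<odot> \<dots> \<odot> (F \<boxtimes> G \<boxtimes> H) = ?R"
  proof -
    have "F \<boxtimes> ((idt (\<sigma> \<mu>) \<boxtimes> hb V \<kappa> \<boxtimes> idt W) \<odot> (G \<boxtimes> H))
      = (idt (\<sigma> \<nu> \<otimes> U) \<boxtimes> (idt (\<sigma> \<mu>) \<boxtimes> hb V \<kappa> \<boxtimes> idt W)) \<odot> (F \<boxtimes> (G \<boxtimes> H))"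
      using assms by (simp add: exchange)
    then show ?thesis using assms
      by (simp add: hb_add whisker_left whisker_right tensor_idt tensor_idt_idt)
  qed
  finally show ?thesis .
qed

lemma ztens_assoc:
  assumes f: "f \<in> zhom U U'" and g: "g \<in> zhom V V'" and h: "h \<in> zhom W W'"
  shows "ztens (ztens f g) h = ztens f (ztens g h)"
proof -
  note mem = ztens_in_zhom[of _ U U' _ V V']
    ztens_in_zhom[of _ V V' _ W W'] zmor_in_zhom
  note dist =
    ztens_add_left[of _ U U' _ _ V V']
    ztens_add_right[of _ U U' _ V V']
    ztens_add_left[of _ V V' _ _ W W']
    ztens_add_right[of _ V V' _ W W']
    ztens_add_left[of _ "U \<otimes> V" "U' \<otimes> V'" _ _ W W']
    ztens_add_right[of _ "U \<otimes> V" "U' \<otimes> V'" _ W W']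
    ztens_add_left[of _ U U' _ _ "V \<otimes> W" "V' \<otimes> W'"]
    ztens_add_right[of _ U U' _ "V \<otimes> W" "V' \<otimes> W'"]
  from f show ?thesis
  proof (induction rule: zhom_induct)
    case (single \<nu> F)
    note F = this
    from g show ?case
    proof (induction rule: zhom_induct)
      case (single \<mu> G)
      note G = this
      from h show ?case
      proof (induction rule: zhom_induct)
        case (single \<kappa> H)
        then show ?case
          using F G hb_assoc[of F \<nu> U' G \<mu> V' H \<kappa> W'] by (simp add: ztens_zmor add.assoc)
      qed (use F G in \<open>simp_all add: dist mem\<close>)
    qed (use F h in \<open>simp_all add: dist mem\<close>)
  qed (use g h in \<open>simp_all add: dist mem\<close>)
qed

lemma ztens_unit:
  assumes f: "f \<in> zhom V W"
  shows "ztens (sing 0 (Id \<one>)) f = f" and "ztens f (sing 0 (Id \<one>)) = f"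
proof -
  have "ztens (sing 0 (Id \<one>)) f = f \<and> ztens f (sing 0 (Id \<one>)) = f"
    using f
  proof (induction rule: zhom_induct)
    case (single \<nu> F)
    then show ?case by (simp add: zmor_idt[symmetric] ztens_zmor hb_unit hb_zero tensor_idt)
  next
    case (add f g)
    then show ?case
      by (simp add: ztens_add_right[OF zId_in_zhom add(1,2)] ztens_add_left[OF add(1,2) zId_in_zhom])
  qed simp
  then show "ztens (sing 0 (Id \<one>)) f = f" "ztens f (sing 0 (Id \<one>)) = f" by simp_all
qed

text \<open>
  So \<open>C\<close> embeds into \<open>C\<^sup>Z\<close> as the part of degree zero, and identities between its structure morphisms
  carry over.
\<close>

lemma zcmp_degree_zero:
  "arr F \<Longrightarrow> arr G \<Longrightarrow> tgt F = src G \<Longrightarrow> zcmp (zmor 0 G) (zmor 0 F) = zmor 0 (G \<odot> F)"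
  by (simp add: zcmp_zmor)

lemma ztens_degree_zero: "arr F \<Longrightarrow> arr G \<Longrightarrow> ztens (zmor 0 F) (zmor 0 G) = zmor 0 (F \<boxtimes> G)"
  by (simp add: ztens_zmor hb_zero tensor_idt)


end


section \<open>Duality of graded morphisms\<close>

context pivotal_category
begin

text \<open>
  The left dual of \<open>f\<close>; by the pivotal structure it is also its right dual.
\<close>

definition dual_mor :: "('o, 'm) arrow \<Rightarrow> ('o, 'm) arrow"
  where "dual_mor f = (evA (tgt f) \<boxtimes> idt (dual C (src f)))
    \<odot> (idt (dual C (tgt f)) \<boxtimes> f \<boxtimes> idt (dual C (src f))) \<odot> (idt (dual C (tgt f)) \<boxtimes> coevA (src f))"

lemma dual_mor_simps [simp]:
  "src (dual_mor f) = dual C (tgt f)" "tgt (dual_mor f) = dual C (src f)"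
  "arr f \<Longrightarrow> arr (dual_mor f)"
  by (simp_all add: dual_mor_def)

lemma dual_mor_right:
  assumes "arr f"
  shows "dual_mor f = (idt (dual C (src f)) \<boxtimes> evA' (tgt f))
    \<odot> (idt (dual C (src f)) \<boxtimes> f \<boxtimes> idt (dual C (tgt f))) \<odot> (coevA' (src f) \<boxtimes> idt (dual C (tgt f)))"
    (is "_ = ?a \<odot> ?b \<odot> ?c")
proof -
  let ?a' = "evA (tgt f) \<boxtimes> idt (dual C (src f))"
    and ?b' = "(idt (dual C (tgt f)) \<boxtimes> f) \<boxtimes> idt (dual C (src f))"
    and ?c' = "idt (dual C (tgt f)) \<boxtimes> coevA (src f)"
    and ?b = "(idt (dual C (src f)) \<boxtimes> f) \<boxtimes> idt (dual C (tgt f))"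
  have "mor ((?a' \<odot> ?b') \<odot> ?c') = mor ((?a \<odot> ?b) \<odot> ?c)"
    using dual_mor_eq[of "mor f" "src f" "tgt f"] assms
    by (simp add: arr_def del: tensor_assoc comp_assoc)
  then have "(?a' \<odot> ?b') \<odot> ?c' = (?a \<odot> ?b) \<odot> ?c"
    by (intro arrow_eqI) simp_all
  then show ?thesis using assms by (simp add: dual_mor_def)
qed

text \<open>
  A morphism slides along a coevaluation, at the price of being replaced by its dual; this is the
  zigzag identity.
\<close>

lemma coev_slide:
  assumes f: "arr f"
  shows "(f \<boxtimes> idt (dual C (src f))) \<odot> coevA (src f) = (idt (tgt f) \<boxtimes> dual_mor f) \<odot> coevA (tgt f)"
proof -
  let ?A = "tgt f" and ?V = "src f"
  let ?y = "(f \<boxtimes> idt (dual C ?V)) \<odot> coevA ?V"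
  have "(idt ?A \<boxtimes> dual_mor f) \<odot> coevA ?A
    = (idt ?A \<boxtimes> evA ?A \<boxtimes> idt (dual C ?V)) \<odot> (idt (?A \<otimes> dual C ?A) \<boxtimes> ?y) \<odot> (coevA ?A \<boxtimes> idt \<one>)"
    using f by (simp add: dual_mor_def whisker_left tensor_idt_idt)
  also have "\<dots> = (idt ?A \<boxtimes> evA ?A \<boxtimes> idt (dual C ?V)) \<odot> (coevA ?A \<boxtimes> ?y)"
    using f exchange[of "coevA ?A" "idt (?A \<otimes> dual C ?A)" "idt \<one>" ?y] by simp
  also have "coevA ?A \<boxtimes> ?y = ((coevA ?A \<boxtimes> idt ?A) \<boxtimes> idt (dual C ?V)) \<odot> ?y"
    using f exchange[of "idt \<one>" "coevA ?A" ?y "idt (?A \<otimes> dual C ?V)"] by (simp add: tensor_idt)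
  also have "(idt ?A \<boxtimes> evA ?A \<boxtimes> idt (dual C ?V)) \<odot> \<dots>
    = (((idt ?A \<boxtimes> evA ?A) \<odot> (coevA ?A \<boxtimes> idt ?A)) \<boxtimes> idt (dual C ?V)) \<odot> ?y"
    using f by (simp add: whisker_right)
  finally show ?thesis using f by (simp add: zigzags tensor_idt)
qed

lemma coev'_slide:
  assumes f: "arr f"
  shows "(idt (dual C (src f)) \<boxtimes> f) \<odot> coevA' (src f) = (dual_mor f \<boxtimes> idt (tgt f)) \<odot> coevA' (tgt f)"
proof -
  let ?A = "tgt f" and ?V = "src f"
  let ?y = "(idt (dual C ?V) \<boxtimes> f) \<odot> coevA' ?V"
  have "(dual_mor f \<boxtimes> idt ?A) \<odot> coevA' ?A
    = (idt (dual C ?V) \<boxtimes> evA' ?A \<boxtimes> idt ?A) \<odot> (?y \<boxtimes> idt (dual C ?A \<otimes> ?A)) \<odot> (idt \<one> \<boxtimes> coevA' ?A)"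
    using f by (simp add: dual_mor_right whisker_right tensor_idt)
  also have "\<dots> = (idt (dual C ?V) \<boxtimes> evA' ?A \<boxtimes> idt ?A) \<odot> (?y \<boxtimes> coevA' ?A)"
    using f exchange[of "idt \<one>" ?y "coevA' ?A" "idt (dual C ?A \<otimes> ?A)"] by simp
  also have "?y \<boxtimes> coevA' ?A = (idt (dual C ?V) \<boxtimes> idt ?A \<boxtimes> coevA' ?A) \<odot> ?y"
    using f exchange[of ?y "idt (dual C ?V \<otimes> ?A)" "idt \<one>" "coevA' ?A"] by (simp add: tensor_idt_idt)
  also have "(idt (dual C ?V) \<boxtimes> evA' ?A \<boxtimes> idt ?A) \<odot> \<dots>
    = (idt (dual C ?V) \<boxtimes> ((evA' ?A \<boxtimes> idt ?A) \<odot> (idt ?A \<boxtimes> coevA' ?A))) \<odot> ?y"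
    using f by (simp add: whisker_left)
  finally show ?thesis using f by (simp add: zigzags tensor_idt)
qed

text \<open>
  The canonical isomorphism from \<open>W\<^sup>* \<otimes> V\<^sup>*\<close> to \<open>(V \<otimes> W)\<^sup>*\<close>.
\<close>

definition dual_tens :: "'o \<Rightarrow> 'o \<Rightarrow> ('o, 'm) arrow"
  where "dual_tens V W = (evA W \<boxtimes> idt (dual C (V \<otimes> W)))
    \<odot> (idt (dual C W) \<boxtimes> evA V \<boxtimes> idt (W \<otimes> dual C (V \<otimes> W)))
    \<odot> (idt (dual C W \<otimes> dual C V) \<boxtimes> coevA (V \<otimes> W))"

lemma dual_tens_simps [simp]:
  "src (dual_tens V W) = dual C W \<otimes> dual C V" "tgt (dual_tens V W) = dual C (V \<otimes> W)"
  "arr (dual_tens V W)"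
  by (simp_all add: dual_tens_def)

lemma dual_tens_right:
  "dual_tens V W = (idt (dual C (V \<otimes> W)) \<boxtimes> evA' V)
    \<odot> (idt (dual C (V \<otimes> W) \<otimes> V) \<boxtimes> evA' W \<boxtimes> idt (dual C V))
    \<odot> (coevA' (V \<otimes> W) \<boxtimes> idt (dual C W \<otimes> dual C V))" (is "_ = ?a \<odot> ?b \<odot> ?c")
proof -
  let ?A = "dual C (V \<otimes> W)"
  let ?a' = "evA W \<boxtimes> idt ?A"
    and ?b' = "(idt (dual C W) \<boxtimes> evA V) \<boxtimes> idt (W \<otimes> ?A)"
    and ?c' = "idt (dual C W \<otimes> dual C V) \<boxtimes> coevA (V \<otimes> W)"
    and ?b = "(idt (?A \<otimes> V) \<boxtimes> evA' W) \<boxtimes> idt (dual C V)"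
  have "mor ((?a' \<odot> ?b') \<odot> ?c') = mor ((?a \<odot> ?b) \<odot> ?c)"
    using dual_tens_eq[of W V] by (simp del: tensor_assoc comp_assoc)
  then have "(?a' \<odot> ?b') \<odot> ?c' = (?a \<odot> ?b) \<odot> ?c"
    by (intro arrow_eqI) simp_all
  then show ?thesis by (simp add: dual_tens_def)
qed

end

context orbit_setting
begin

text \<open>
  Both sides become the identity after the isomorphism of \<open>\<sigma>\<^sub>\<nu>\<^sup>*\<close> with \<open>\<sigma>\<^bsub>-\<nu>\<^esub>\<close>: the left one
  by naturality of the half-braiding and because \<open>\<sigma>\<^sub>\<nu>\<close> has dimension one, the right one by a
  zigzag.
\<close>

lemma hb_coev': "hb (dual C (\<sigma> \<nu>)) \<nu> \<odot> coevA' (\<sigma> \<nu>) = coevA (\<sigma> \<nu>)"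
proof -
  let ?s = "\<sigma> \<nu>" and ?t = "\<sigma> (- \<nu>)"
  let ?J = "evA ?s \<boxtimes> idt ?t" and ?K = "idt ?t \<boxtimes> coevA ?s"
  have J: "src ?J = dual C ?s" "tgt ?J = ?t" by simp_all
  have K: "src ?K = ?t" "tgt ?K = dual C ?s" by simp_all
  have KJ: "?K \<odot> ?J = idt (dual C ?s)"
  proof -
    have "?K \<odot> ?J = evA ?s \<boxtimes> (idt ?t \<boxtimes> coevA ?s)"
      using exchange[of "evA ?s" "idt \<one>" "idt ?t" ?K] by simp
    also have "\<dots> = (evA ?s \<boxtimes> idt (dual C ?s)) \<odot> (idt (dual C ?s \<otimes> ?s) \<boxtimes> (idt ?t \<boxtimes> coevA ?s))"
      using exchange[of "idt (dual C ?s \<otimes> ?s)" "evA ?s" ?K "idt (dual C ?s)"] by simp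
    also have "idt (dual C ?s \<otimes> ?s) \<boxtimes> (idt ?t \<boxtimes> coevA ?s) = idt (dual C ?s) \<boxtimes> coevA ?s"
      by (simp add: tensor_idt_idt)
    finally show ?thesis by (simp add: zigzags)
  qed
  have cancel: "f = g"
    if "arr f" "arr g" "tgt f = ?s \<otimes> dual C ?s" "tgt g = ?s \<otimes> dual C ?s"
      "(idt ?s \<boxtimes> ?J) \<odot> f = (idt ?s \<boxtimes> ?J) \<odot> g" for f g
  proof -
    have "(idt ?s \<boxtimes> ?K) \<odot> (idt ?s \<boxtimes> ?J) = idt (?s \<otimes> dual C ?s)"
      using whisker_left[of ?J ?K ?s] KJ by (simp add: tensor_idt)
    then have "f = (idt ?s \<boxtimes> ?K) \<odot> (idt ?s \<boxtimes> ?J) \<odot> f" "g = (idt ?s \<boxtimes> ?K) \<odot> (idt ?s \<boxtimes> ?J) \<odot> g"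
      using that(1-4) by (simp_all flip: comp_assoc)
    then show ?thesis using that(5) by simp
  qed
  have "(idt ?s \<boxtimes> ?J) \<odot> hb (dual C ?s) \<nu> = evA ?s"
    using hb_natural[of ?J \<nu>] by (simp add: hb_\<sigma> tensor_idt)
  then have l: "(idt ?s \<boxtimes> ?J) \<odot> hb (dual C ?s) \<nu> \<odot> coevA' ?s = idt \<one>"
    using \<sigma>_dimension(2) by (simp flip: comp_assoc)
  have "(idt ?s \<boxtimes> ?J) \<odot> coevA ?s = (idt ?s \<boxtimes> evA ?s \<boxtimes> idt ?t) \<odot> ((coevA ?s \<boxtimes> idt ?s) \<boxtimes> idt ?t)"
    by (simp add: tensor_idt)
  also have "\<dots> = idt ?s \<boxtimes> idt ?t"
    using whisker_right[of "coevA ?s \<boxtimes> idt ?s" "idt ?s \<boxtimes> evA ?s" ?t] zigzags(1)[of ?s] by simp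
  finally have r: "(idt ?s \<boxtimes> ?J) \<odot> coevA ?s = idt \<one>" by (simp add: tensor_idt)
  show ?thesis by (rule cancel) (simp_all add: l r)
qed

text \<open>
  The equality of left and right duals for the identity of \<open>\<sigma>\<^sub>\<nu> \<otimes> W\<close>, seen as a graded morphism to
  \<open>W\<close>.  Computing the canonical isomorphism \<open>D\<close> with left duals exhibits one side, and with right duals the
  other side, as the translate of \<open>D\<close> applied to a coevaluation of \<open>\<sigma>\<^sub>\<nu>\<close> half-braided past \<open>W\<^sup>*\<close>; the two
  coevaluations agree by \<open>hb_coev'\<close>.
\<close>

lemma hb_dual_tens:
  fixes W \<nu>
  defines "A \<equiv> \<sigma> \<nu> \<otimes> W"
  shows "(idt (\<sigma> \<nu>) \<boxtimes> evA W \<boxtimes> idt (dual C A)) \<odot> (hb (dual C W) \<nu> \<boxtimes> idt (W \<otimes> dual C A))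
      \<odot> (idt (dual C W) \<boxtimes> coevA A)
    = (idt (\<sigma> \<nu> \<otimes> dual C A) \<boxtimes> evA' W) \<odot> (hb (dual C A) \<nu> \<boxtimes> idt (W \<otimes> dual C W))
      \<odot> (coevA' A \<boxtimes> idt (dual C W))" (is "?L = ?R")
proof -
  let ?s = "\<sigma> \<nu>" and ?A' = "dual C A" and ?W' = "dual C W" and ?s' = "dual C (\<sigma> \<nu>)"
  define D where "D = dual_tens ?s W"
  have D: "src D = ?W' \<otimes> ?s'" "tgt D = ?A'" "arr D" by (simp_all add: D_def A_def)
  define R' where "R' = (idt (?A' \<otimes> ?s) \<boxtimes> evA' W) \<odot> (coevA' A \<boxtimes> idt ?W')"
  have R'[simp]: "src R' = ?W'" "tgt R' = ?A' \<otimes> ?s" "arr R'" by (simp_all add: R'_def A_def)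
  \<comment> \<open>the right-hand side before the half-braiding is applied\<close>
  have R'_D: "R' = (D \<boxtimes> idt ?s) \<odot> (idt ?W' \<boxtimes> coevA' ?s)"
  proof -
    have "D = (idt ?A' \<boxtimes> evA' ?s) \<odot> (R' \<boxtimes> idt ?s')"
      by (simp add: D_def dual_tens_right R'_def A_def whisker_right tensor_idt)
    then have "(D \<boxtimes> idt ?s) \<odot> (idt ?W' \<boxtimes> coevA' ?s)
        = (idt ?A' \<boxtimes> evA' ?s \<boxtimes> idt ?s) \<odot> (R' \<boxtimes> idt (?s' \<otimes> ?s)) \<odot> (idt ?W' \<boxtimes> coevA' ?s)"
      by (simp add: whisker_right tensor_idt)
    also have "(R' \<boxtimes> idt (?s' \<otimes> ?s)) \<odot> (idt ?W' \<boxtimes> coevA' ?s) = (idt (?A' \<otimes> ?s) \<boxtimes> coevA' ?s) \<odot> (R' \<boxtimes> idt \<one>)"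
      by (simp add: exchange del: tensor_unit_right)
    also have "(idt ?A' \<boxtimes> evA' ?s \<boxtimes> idt ?s) \<odot> \<dots>
        = (idt ?A' \<boxtimes> ((evA' ?s \<boxtimes> idt ?s) \<odot> (idt ?s \<boxtimes> coevA' ?s))) \<odot> R'"
      by (simp add: whisker_left tensor_idt_idt)
    finally show ?thesis by (simp add: zigzags tensor_idt)
  qed
  have "?R = hb ?A' \<nu> \<odot> R'"
  proof -
    have "(idt (?s \<otimes> ?A') \<boxtimes> evA' W) \<odot> (hb ?A' \<nu> \<boxtimes> idt (W \<otimes> ?W')) = hb ?A' \<nu> \<boxtimes> evA' W"
      by (simp add: exchange)
    also have "\<dots> = (hb ?A' \<nu> \<boxtimes> idt \<one>) \<odot> (idt (?A' \<otimes> ?s) \<boxtimes> evA' W)"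
      by (simp add: exchange del: tensor_unit_right)
    finally show ?thesis by (simp add: R'_def A_def flip: comp_assoc)
  qed
  also have "\<dots> = (hb ?A' \<nu> \<odot> (D \<boxtimes> idt ?s)) \<odot> (idt ?W' \<boxtimes> coevA' ?s)"
    using D by (simp add: R'_D)
  also have "hb ?A' \<nu> \<odot> (D \<boxtimes> idt ?s) = (idt ?s \<boxtimes> D) \<odot> hb (?W' \<otimes> ?s') \<nu>"
    using hb_natural[of D \<nu>] D by simp
  also have "((idt ?s \<boxtimes> D) \<odot> hb (?W' \<otimes> ?s') \<nu>) \<odot> (idt ?W' \<boxtimes> coevA' ?s)
      = (idt ?s \<boxtimes> D) \<odot> (hb ?W' \<nu> \<boxtimes> idt ?s') \<odot> (idt ?W' \<boxtimes> (hb ?s' \<nu> \<odot> coevA' ?s))"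
    using D by (simp add: hb_tens whisker_left)
  also have "\<dots> = (idt ?s \<boxtimes> D) \<odot> (hb ?W' \<nu> \<boxtimes> idt ?s') \<odot> (idt ?W' \<boxtimes> coevA ?s)"
    by (simp add: hb_coev')
  also have "\<dots> = ?L"
  proof -
    have "(idt ?s \<boxtimes> D) \<odot> (hb ?W' \<nu> \<boxtimes> idt ?s') \<odot> (idt ?W' \<boxtimes> coevA ?s)
      = (idt ?s \<boxtimes> evA W \<boxtimes> idt ?A') \<odot> (idt (?s \<otimes> ?W') \<boxtimes> evA ?s \<boxtimes> idt (W \<otimes> ?A'))
        \<odot> (idt (?s \<otimes> ?W' \<otimes> ?s') \<boxtimes> coevA A) \<odot> (((hb ?W' \<nu> \<boxtimes> idt ?s') \<odot> (idt ?W' \<boxtimes> coevA ?s)) \<boxtimes> idt \<one>)"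
      by (simp add: D_def dual_tens_def A_def whisker_left tensor_idt_idt)
    also have "(idt (?s \<otimes> ?W' \<otimes> ?s') \<boxtimes> coevA A) \<odot> (((hb ?W' \<nu> \<boxtimes> idt ?s') \<odot> (idt ?W' \<boxtimes> coevA ?s)) \<boxtimes> idt \<one>)
      = (((hb ?W' \<nu> \<boxtimes> idt ?s') \<odot> (idt ?W' \<boxtimes> coevA ?s)) \<boxtimes> idt (A \<otimes> ?A')) \<odot> (idt ?W' \<boxtimes> coevA A)"
      by (simp add: exchange del: tensor_unit_right)
    also have "\<dots> = (hb ?W' \<nu> \<boxtimes> idt (?s' \<otimes> A \<otimes> ?A')) \<odot> (idt ?W' \<boxtimes> coevA ?s \<boxtimes> idt (A \<otimes> ?A')) \<odot> (idt ?W' \<boxtimes> coevA A)"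
      by (simp add: whisker_right tensor_idt)
    also have "(idt (?s \<otimes> ?W') \<boxtimes> evA ?s \<boxtimes> idt (W \<otimes> ?A')) \<odot> \<dots>
      = ((idt (?s \<otimes> ?W') \<boxtimes> (evA ?s \<boxtimes> idt (W \<otimes> ?A'))) \<odot> (hb ?W' \<nu> \<boxtimes> idt (?s' \<otimes> A \<otimes> ?A')))
         \<odot> (idt ?W' \<boxtimes> coevA ?s \<boxtimes> idt (A \<otimes> ?A')) \<odot> (idt ?W' \<boxtimes> coevA A)"
      by (simp add: A_def)
    also have "(idt (?s \<otimes> ?W') \<boxtimes> (evA ?s \<boxtimes> idt (W \<otimes> ?A'))) \<odot> (hb ?W' \<nu> \<boxtimes> idt (?s' \<otimes> A \<otimes> ?A'))
      = (hb ?W' \<nu> \<boxtimes> idt (W \<otimes> ?A')) \<odot> (idt (?W' \<otimes> ?s) \<boxtimes> (evA ?s \<boxtimes> idt (W \<otimes> ?A')))"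
      by (simp add: exchange A_def)
    also have "((hb ?W' \<nu> \<boxtimes> idt (W \<otimes> ?A')) \<odot> (idt (?W' \<otimes> ?s) \<boxtimes> (evA ?s \<boxtimes> idt (W \<otimes> ?A'))))
         \<odot> (idt ?W' \<boxtimes> coevA ?s \<boxtimes> idt (A \<otimes> ?A')) \<odot> (idt ?W' \<boxtimes> coevA A)
      = (hb ?W' \<nu> \<boxtimes> idt (W \<otimes> ?A'))
         \<odot> (idt ?W' \<boxtimes> ((idt ?s \<boxtimes> evA ?s) \<odot> (coevA ?s \<boxtimes> idt ?s)) \<boxtimes> idt (W \<otimes> ?A')) \<odot> (idt ?W' \<boxtimes> coevA A)"
      by (simp add: A_def whisker_left whisker_right tensor_idt tensor_idt_idt)
    finally show ?thesis by (simp add: zigzags tensor_idt A_def)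
  qed
  finally show ?thesis by simp
qed

text \<open>
  Sliding \<open>F : V \<rightarrow> \<sigma>\<^sub>\<nu> \<otimes> W\<close> along the coevaluations on both sides leaves the case of the identity of
  \<open>\<sigma>\<^sub>\<nu> \<otimes> W\<close>, followed by the translate of the dual of \<open>F\<close>.
\<close>

lemma hb_dual_mor:
  assumes F: "arr F" "src F = V" "tgt F = \<sigma> \<nu> \<otimes> W"
  shows "(idt (\<sigma> \<nu>) \<boxtimes> evA W \<boxtimes> idt (dual C V)) \<odot> (hb (dual C W) \<nu> \<boxtimes> idt (W \<otimes> dual C V))
      \<odot> (idt (dual C W) \<boxtimes> F \<boxtimes> idt (dual C V)) \<odot> (idt (dual C W) \<boxtimes> coevA V)
    = (idt (\<sigma> \<nu> \<otimes> dual C V) \<boxtimes> evA' W) \<odot> (hb (dual C V) \<nu> \<boxtimes> idt (W \<otimes> dual C W))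
      \<odot> (idt (dual C V) \<boxtimes> F \<boxtimes> idt (dual C W)) \<odot> (coevA' V \<boxtimes> idt (dual C W))" (is "?L = ?R")
proof -
  let ?s = "\<sigma> \<nu>" and ?W' = "dual C W" and ?V' = "dual C V"
  define A where "A = ?s \<otimes> W"
  let ?A' = "dual C A" and ?F = "dual_mor F"
  have F': "src ?F = ?A'" "tgt ?F = ?V'" "arr ?F" using F by (simp_all add: A_def)
  have "?L = (idt ?s \<boxtimes> evA W \<boxtimes> idt ?V') \<odot> (hb ?W' \<nu> \<boxtimes> idt (W \<otimes> ?V'))
      \<odot> (idt ?W' \<boxtimes> ((F \<boxtimes> idt ?V') \<odot> coevA V))"
    using F by (simp add: whisker_left)
  also have "(F \<boxtimes> idt ?V') \<odot> coevA V = (idt A \<boxtimes> ?F) \<odot> coevA A"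
    using coev_slide[OF F(1)] F by (simp add: A_def)
  also have "(idt ?s \<boxtimes> evA W \<boxtimes> idt ?V') \<odot> (hb ?W' \<nu> \<boxtimes> idt (W \<otimes> ?V')) \<odot> (idt ?W' \<boxtimes> ((idt A \<boxtimes> ?F) \<odot> coevA A))
    = (idt ?s \<boxtimes> ?F) \<odot> (idt ?s \<boxtimes> evA W \<boxtimes> idt ?A') \<odot> (hb ?W' \<nu> \<boxtimes> idt (W \<otimes> ?A')) \<odot> (idt ?W' \<boxtimes> coevA A)"
  proof -
    let ?Q = "(idt ?s \<boxtimes> evA W) \<odot> (hb ?W' \<nu> \<boxtimes> idt W)"
    have "(idt ?s \<boxtimes> evA W \<boxtimes> idt Z) \<odot> (hb ?W' \<nu> \<boxtimes> idt (W \<otimes> Z)) = ?Q \<boxtimes> idt Z" for Z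
      by (simp add: whisker_right tensor_idt)
    then have Q: "(idt ?s \<boxtimes> evA W \<boxtimes> idt Z) \<odot> (hb ?W' \<nu> \<boxtimes> idt (W \<otimes> Z)) \<odot> f = (?Q \<boxtimes> idt Z) \<odot> f"
      if "arr f" "tgt f = ?W' \<otimes> A \<otimes> Z" for f Z
      using that by (simp add: A_def flip: comp_assoc)
    have "(?Q \<boxtimes> idt ?V') \<odot> (idt (?W' \<otimes> A) \<boxtimes> ?F) = (idt ?s \<boxtimes> ?F) \<odot> (?Q \<boxtimes> idt ?A')"
      using F' by (simp add: exchange A_def)
    then have "(?Q \<boxtimes> idt ?V') \<odot> (idt (?W' \<otimes> A) \<boxtimes> ?F) \<odot> (idt ?W' \<boxtimes> coevA A)
        = (idt ?s \<boxtimes> ?F) \<odot> (?Q \<boxtimes> idt ?A') \<odot> (idt ?W' \<boxtimes> coevA A)"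
      using F' by (simp add: A_def flip: comp_assoc)
    then show ?thesis
      using F' by (simp add: Q whisker_left tensor_idt_idt)
  qed
  also have "\<dots> = (idt ?s \<boxtimes> ?F) \<odot> (idt (?s \<otimes> ?A') \<boxtimes> evA' W) \<odot> (hb ?A' \<nu> \<boxtimes> idt (W \<otimes> ?W')) \<odot> (coevA' A \<boxtimes> idt ?W')"
    unfolding A_def hb_dual_tens ..
  also have "\<dots> = (idt (?s \<otimes> ?V') \<boxtimes> evA' W) \<odot> (hb ?V' \<nu> \<boxtimes> idt (W \<otimes> ?W'))
      \<odot> (((?F \<boxtimes> idt A) \<odot> coevA' A) \<boxtimes> idt ?W')"
  proof -
    have 1: "(idt ?s \<boxtimes> ?F) \<odot> (idt (?s \<otimes> ?A') \<boxtimes> evA' W)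
        = (idt (?s \<otimes> ?V') \<boxtimes> evA' W) \<odot> ((idt ?s \<boxtimes> ?F) \<boxtimes> idt (W \<otimes> ?W'))"
      using F' exchange[of "idt (?s \<otimes> ?A')" "idt ?s \<boxtimes> ?F" "evA' W" "idt \<one>"]
        exchange[of "idt ?s \<boxtimes> ?F" "idt (?s \<otimes> ?V')" "idt (W \<otimes> ?W')" "evA' W"] by simp
    have 2: "((idt ?s \<boxtimes> ?F) \<boxtimes> idt (W \<otimes> ?W')) \<odot> (hb ?A' \<nu> \<boxtimes> idt (W \<otimes> ?W'))
        = (hb ?V' \<nu> \<boxtimes> idt (W \<otimes> ?W')) \<odot> (?F \<boxtimes> idt (?s \<otimes> W \<otimes> ?W'))"
      using F' hb_natural[of ?F \<nu>] whisker_right[of "hb ?A' \<nu>" "idt ?s \<boxtimes> ?F" "W \<otimes> ?W'"]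
        whisker_right[of "?F \<boxtimes> idt ?s" "hb ?V' \<nu>" "W \<otimes> ?W'"] by (simp add: tensor_idt)
    have "(idt ?s \<boxtimes> ?F) \<odot> (idt (?s \<otimes> ?A') \<boxtimes> evA' W) \<odot> (hb ?A' \<nu> \<boxtimes> idt (W \<otimes> ?W')) \<odot> (coevA' A \<boxtimes> idt ?W')
      = ((idt ?s \<boxtimes> ?F) \<odot> (idt (?s \<otimes> ?A') \<boxtimes> evA' W)) \<odot> (hb ?A' \<nu> \<boxtimes> idt (W \<otimes> ?W')) \<odot> (coevA' A \<boxtimes> idt ?W')"
      using F' by (simp add: A_def)
    also have "\<dots> = (idt (?s \<otimes> ?V') \<boxtimes> evA' W)
        \<odot> (((idt ?s \<boxtimes> ?F) \<boxtimes> idt (W \<otimes> ?W')) \<odot> (hb ?A' \<nu> \<boxtimes> idt (W \<otimes> ?W'))) \<odot> (coevA' A \<boxtimes> idt ?W')"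
      unfolding 1 using F' by (simp add: A_def)
    also have "\<dots> = (idt (?s \<otimes> ?V') \<boxtimes> evA' W) \<odot> (hb ?V' \<nu> \<boxtimes> idt (W \<otimes> ?W'))
        \<odot> (?F \<boxtimes> idt (?s \<otimes> W \<otimes> ?W')) \<odot> (coevA' A \<boxtimes> idt ?W')"
      unfolding 2 using F' by (simp add: A_def)
    also have "(?F \<boxtimes> idt (?s \<otimes> W \<otimes> ?W')) \<odot> (coevA' A \<boxtimes> idt ?W') = ((?F \<boxtimes> idt A) \<odot> coevA' A) \<boxtimes> idt ?W'"
      using F' by (simp add: A_def whisker_right tensor_idt)
    finally show ?thesis .
  qed
  also have "(?F \<boxtimes> idt A) \<odot> coevA' A = (idt ?V' \<boxtimes> F) \<odot> coevA' V"
    using coev'_slide[OF F(1)] F by (simp add: A_def)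
  finally show ?thesis using F by (simp add: whisker_right)
qed

lemma z_duality_in_zhom:
  "sing 0 (coev C V) \<in> zhom \<one> (V \<otimes> dual C V)" "sing 0 (ev C V) \<in> zhom (dual C V \<otimes> V) \<one>"
  "sing 0 (coev' C V) \<in> zhom \<one> (dual C V \<otimes> V)" "sing 0 (ev' C V) \<in> zhom (V \<otimes> dual C V) \<one>"
  by (rule zhom_single; simp add: coev_in_Hom ev_in_Hom coev'_in_Hom ev'_in_Hom)+

lemma zmor_duality: "zmor 0 (coevA V) = sing 0 (coev C V)" "zmor 0 (evA V) = sing 0 (ev C V)"
  "zmor 0 (coevA' V) = sing 0 (coev' C V)" "zmor 0 (evA' V) = sing 0 (ev' C V)"
  by (simp_all add: zmor_def)

lemmas z_degree_zero = zmor_duality[symmetric] zmor_idt[symmetric] zcmp_degree_zero ztens_degree_zero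

lemma z_zigzags:
  "zcmp (ztens (sing 0 (Id V)) (sing 0 (ev C V))) (ztens (sing 0 (coev C V)) (sing 0 (Id V))) = sing 0 (Id V)"
  "zcmp (ztens (sing 0 (ev C V)) (sing 0 (Id (dual C V)))) (ztens (sing 0 (Id (dual C V))) (sing 0 (coev C V)))
    = sing 0 (Id (dual C V))"
  "zcmp (ztens (sing 0 (ev' C V)) (sing 0 (Id V))) (ztens (sing 0 (Id V)) (sing 0 (coev' C V))) = sing 0 (Id V)"
  "zcmp (ztens (sing 0 (Id (dual C V))) (sing 0 (ev' C V))) (ztens (sing 0 (coev' C V)) (sing 0 (Id (dual C V))))
    = sing 0 (Id (dual C V))"
  by (simp_all add: z_degree_zero zigzags)

lemma z_dual_mor_eq:
  assumes f: "f \<in> zhom V W"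
  shows "zcmp (zcmp (ztens (sing 0 (ev C W)) (sing 0 (Id (dual C V))))
        (ztens (ztens (sing 0 (Id (dual C W))) f) (sing 0 (Id (dual C V)))))
        (ztens (sing 0 (Id (dual C W))) (sing 0 (coev C V)))
    = zcmp (zcmp (ztens (sing 0 (Id (dual C V))) (sing 0 (ev' C W)))
        (ztens (ztens (sing 0 (Id (dual C V))) f) (sing 0 (Id (dual C W)))))
        (ztens (sing 0 (coev' C V)) (sing 0 (Id (dual C W))))"
  using f
proof (induction rule: zhom_induct)
  case (single \<nu> F)
  then show ?case
    using hb_dual_mor[OF single]
    by (simp add: z_degree_zero zcmp_zmor ztens_zmor hb_zero tensor_idt tensor_idt_idt whisker_right)
next
  case (add f g)
  have d: "ztens (ztens (sing 0 (Id U)) (f + g)) (sing 0 (Id U'))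
      = ztens (ztens (sing 0 (Id U)) f) (sing 0 (Id U')) + ztens (ztens (sing 0 (Id U)) g) (sing 0 (Id U'))"
      "ztens (ztens (sing 0 (Id U)) f) (sing 0 (Id U')) \<in> zhom ((U \<otimes> V) \<otimes> U') ((U \<otimes> W) \<otimes> U')"
      "ztens (ztens (sing 0 (Id U)) g) (sing 0 (Id U')) \<in> zhom ((U \<otimes> V) \<otimes> U') ((U \<otimes> W) \<otimes> U')" for U U'
    using ztens_add_right[OF zId_in_zhom add(1,2), of U]
      ztens_add_left[OF ztens_in_zhom[OF zId_in_zhom add(1)] ztens_in_zhom[OF zId_in_zhom add(2)]
        zId_in_zhom, of U U']
      ztens_in_zhom[OF ztens_in_zhom[OF zId_in_zhom add(1)] zId_in_zhom, of U U']
      ztens_in_zhom[OF ztens_in_zhom[OF zId_in_zhom add(2)]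
        zId_in_zhom, of U U'] by simp_all
  have split: "zcmp (zcmp p (ztens (ztens (sing 0 (Id U)) (f + g)) (sing 0 (Id U')))) q
      = zcmp (zcmp p (ztens (ztens (sing 0 (Id U)) f) (sing 0 (Id U')))) q
        + zcmp (zcmp p (ztens (ztens (sing 0 (Id U)) g) (sing 0 (Id U')))) q"
    if p: "p \<in> zhom ((U \<otimes> W) \<otimes> U') Z" and q: "q \<in> zhom Y ((U \<otimes> V) \<otimes> U')" for p q U U' Y Z
    unfolding d(1) zcmp_add_right[OF d(2,3) p]
    by (rule zcmp_add_left[OF q zcmp_in_zhom[OF d(2) p] zcmp_in_zhom[OF d(3) p]])
  have p: "ztens (sing 0 (ev C W)) (sing 0 (Id (dual C V))) \<in> zhom ((dual C W \<otimes> W) \<otimes> dual C V) (\<one> \<otimes> dual C V)"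
    "ztens (sing 0 (Id (dual C V))) (sing 0 (ev' C W)) \<in> zhom (dual C V \<otimes> (W \<otimes> dual C W)) (dual C V \<otimes> \<one>)"
    "ztens (sing 0 (Id (dual C W))) (sing 0 (coev C V)) \<in> zhom (dual C W \<otimes> \<one>) (dual C W \<otimes> (V \<otimes> dual C V))"
    "ztens (sing 0 (coev' C V)) (sing 0 (Id (dual C W))) \<in> zhom (\<one> \<otimes> dual C W) ((dual C V \<otimes> V) \<otimes> dual C W)"
    by (intro ztens_in_zhom z_duality_in_zhom zId_in_zhom)+
  show ?case
    using split[OF p(1) p(3)[folded tens_ob_assoc]] split[OF p(2)[folded tens_ob_assoc] p(4)] add(3,4)
    by simp
qed simp

lemma z_dual_tens_eq:
  "zcmp (zcmp (ztens (sing 0 (ev C W)) (sing 0 (Id (dual C (V \<otimes> W)))))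
        (ztens (ztens (sing 0 (Id (dual C W))) (sing 0 (ev C V))) (sing 0 (Id (W \<otimes> dual C (V \<otimes> W))))))
        (ztens (sing 0 (Id (dual C W \<otimes> dual C V))) (sing 0 (coev C (V \<otimes> W))))
    = zcmp (zcmp (ztens (sing 0 (Id (dual C (V \<otimes> W)))) (sing 0 (ev' C V)))
        (ztens (ztens (sing 0 (Id (dual C (V \<otimes> W) \<otimes> V))) (sing 0 (ev' C W))) (sing 0 (Id (dual C V)))))
        (ztens (sing 0 (coev' C (V \<otimes> W))) (sing 0 (Id (dual C W \<otimes> dual C V))))"
  using dual_tens_right[of V W] by (simp add: z_degree_zero dual_tens_def)


section \<open>Adjoints of graded morphisms\<close>

abbreviation "zdag \<equiv> CZ_dag C dag \<sigma>"

text \<open>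
  The canonical identification of the dual of \<open>\<sigma>\<^sub>\<mu>\<close> turns the coevaluation in the definition
  of the adjoint into the dimension of \<open>\<sigma>\<^sub>\<mu>\<close>, which is one.
\<close>

lemma dual_\<sigma>_coev': "(dual_\<sigma>_iso C \<sigma> (- \<mu>) \<otimes>\<^sub>m Id (\<sigma> \<mu>)) \<bullet> coev' C (\<sigma> \<mu>) = Id \<one>"
proof -
  have "(dual_\<sigma>_iso C \<sigma> (- \<mu>) \<otimes>\<^sub>m Id (\<sigma> \<mu>)) \<bullet> coev' C (\<sigma> \<mu>)
    = mor (((evA (\<sigma> \<mu>) \<boxtimes> idt (\<sigma> (- \<mu>))) \<boxtimes> idt (\<sigma> \<mu>)) \<odot> coevA' (\<sigma> \<mu>))"
    by (simp add: dual_\<sigma>_iso_def del: tensor_assoc)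
  also have "((evA (\<sigma> \<mu>) \<boxtimes> idt (\<sigma> (- \<mu>))) \<boxtimes> idt (\<sigma> \<mu>)) \<odot> coevA' (\<sigma> \<mu>) = idt \<one>"
    by (simp add: tensor_idt \<sigma>_dimension)
  finally show ?thesis by simp
qed

lemma zdag_eq:
  assumes f: "f \<in> zhom V W"
  shows "zdag f = (\<Sum>\<mu>\<in>Poly_Mapping.keys f.
    sing (- \<mu>) (Id (\<sigma> (- \<mu>)) \<otimes>\<^sub>m dag (component f \<mu>)))"
proof (cases "f = 0")
  case False
  then have t: "CZ_target C \<sigma> f = W" by (rule CZ_target_eq[OF f])
  have "(Id (\<sigma> (- \<mu>)) \<otimes>\<^sub>m dag (component f \<mu>)) \<bullet> Id W
      = Id (\<sigma> (- \<mu>)) \<otimes>\<^sub>m dag (component f \<mu>)" for \<mu>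
    using tens_in_Hom[OF Id_in_Hom dag_in_Hom[OF zhom_lookup[OF f]], of "\<sigma> (- \<mu>)" \<mu>]
    by (simp add: cmp_Id_right)
  then show ?thesis
    by (simp add: CZ_dag_def t dual_\<sigma>_coev' tens_Id)
qed (simp add: CZ_dag_def)

lemma zdag_zero [simp]: "zdag 0 = 0"
  by (simp add: CZ_dag_def)

lemma zdag_superset:
  assumes f: "f \<in> zhom V W" and A: "finite A" "Poly_Mapping.keys f \<subseteq> A"
  shows "zdag f = (\<Sum>\<mu>\<in>A. sing (- \<mu>) (Id (\<sigma> (- \<mu>)) \<otimes>\<^sub>m dag (component f \<mu>)))"
  unfolding zdag_eq[OF f]
  by (rule sum.mono_neutral_left[OF A])
     (simp add: in_keys_iff dag_zero tens_zero_right[OF Id_in_Hom])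

lemma zdag_zmor:
  assumes F: "arr F"
  shows "zdag (zmor \<mu> F) = zmor (- \<mu>) (idt (\<sigma> (- \<mu>)) \<boxtimes> adj F)"
proof -
  have "zmor \<mu> F \<in> zhom (src F) (\<sigma> (- \<mu>) \<otimes> tgt F)" using F by (simp add: zmor_in_zhom)
  from zdag_superset[OF this, of "{\<mu>}"] show ?thesis
    by (simp add: zmor_def)
qed

lemma zdag_add:
  assumes f: "f \<in> zhom V W" and g: "g \<in> zhom V W"
  shows "zdag (f + g) = zdag f + zdag g"
proof -
  let ?A = "Poly_Mapping.keys f \<union> Poly_Mapping.keys g"
  have "Id (\<sigma> (- \<mu>)) \<otimes>\<^sub>m dag (component (f + g) \<mu>)
      = Id (\<sigma> (- \<mu>)) \<otimes>\<^sub>m dag (component f \<mu>) + Id (\<sigma> (- \<mu>)) \<otimes>\<^sub>m dag (component g \<mu>)" for \<mu>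
    using dag_add[OF zhom_lookup[OF f] zhom_lookup[OF g]]
      tens_add_right[OF Id_in_Hom dag_in_Hom[OF zhom_lookup[OF f]] dag_in_Hom[OF zhom_lookup[OF g]]]
    by (simp add: lookup_add)
  then show ?thesis
    using zdag_superset[OF f, of ?A] zdag_superset[OF g, of ?A] zdag_superset[OF zhom_add[OF f g], of ?A]
      Poly_Mapping.keys_add[of f g]
    by (simp add: single_add sum.distrib)
qed

lemma zdag_in_zhom: "f \<in> zhom V W \<Longrightarrow> zdag f \<in> zhom W V"
proof (induction rule: zhom_induct)
  case (single \<nu> F)
  then show ?case by (simp add: zdag_zmor zmor_in_zhom)
qed (simp_all add: zdag_add zhom_add)

lemma zdag_zdag: "f \<in> zhom V W \<Longrightarrow> zdag (zdag f) = f"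
proof (induction rule: zhom_induct)
  case (single \<nu> F)
  then show ?case by (simp add: zdag_zmor adj_tensor tensor_idt_idt)
next
  case (add f g)
  then show ?case
    by (simp add: zdag_add[OF add(1,2)] zdag_add[OF zdag_in_zhom[OF add(1)] zdag_in_zhom[OF add(2)]])
qed simp

lemma zdag_scale: "f \<in> zhom V W \<Longrightarrow> zdag (zscale a f) = zscale (bar a) (zdag f)"
proof (induction rule: zhom_induct)
  case (single \<nu> F)
  then have F: "mor F \<in> Hom V (\<sigma> \<nu> \<otimes> W)" by (simp add: arr_def)
  have "zscale a (zmor \<nu> F) = zmor \<nu> (Arrow V (\<sigma> \<nu> \<otimes> W) (a \<cdot> mor F))"
    by (simp add: zmor_def zscale_single)
  then show ?case
    using single(1) F
    by (simp add: zdag_zmor scale_in_Hom)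
       (simp add: zmor_def zscale_single dag_scale[OF F] tens_scale_right[OF Id_in_Hom dag_in_Hom[OF F]])
next
  case (add f g)
  then show ?case
    by (simp add: zscale_add zdag_add[OF add(1,2)]
        zdag_add[OF zhom_scale[OF add(1)] zhom_scale[OF add(2)]])
qed simp

lemma zdag_cmp:
  assumes f: "f \<in> zhom U V" and g: "g \<in> zhom V W"
  shows "zdag (zcmp g f) = zcmp (zdag f) (zdag g)"
proof -
  note mem = zcmp_in_zhom[where U=U and V=V and W=W] zdag_in_zhom[where V=U and W=V]
    zdag_in_zhom[where V=V and W=W] zmor_in_zhom
  note dist = zcmp_add_left[where U=U and V=V and W=W] zcmp_add_right[where U=U and V=V and W=W]
    zcmp_add_left[where U=W and V=V and W=U] zcmp_add_right[where U=W and V=V and W=U]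
    zdag_add[where V=U and W=V] zdag_add[where V=V and W=W] zdag_add[where V=U and W=W]
  from f show ?thesis
  proof (induction rule: zhom_induct)
    case (single \<nu> F)
    note F = this
    from g show ?case
    proof (induction rule: zhom_induct)
      case (single \<mu> G)
      then show ?case using F
        by (simp add: zcmp_zmor zdag_zmor adj_comp adj_tensor whisker_left tensor_idt_idt add.commute)
    qed (use F in \<open>simp_all add: dist mem\<close>)
  qed (use g in \<open>simp_all add: dist mem\<close>)
qed

text \<open>
  The half-braidings with \<open>\<sigma>\<^sub>\<mu>\<close> and \<open>\<sigma>\<^bsub>-\<mu>\<^esub>\<close> compose to the one with \<open>\<sigma>\<^sub>0 = \<one>\<close>, hence are inverse to each
  other up to translation.
\<close>

lemma hb_inverse:
  "idt (\<sigma> \<mu>) \<boxtimes> adj (hb V (- \<mu>)) = hb V \<mu> \<boxtimes> idt (\<sigma> (- \<mu>))"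
proof -
  have i: "(idt (\<sigma> \<mu>) \<boxtimes> hb V (- \<mu>)) \<odot> (hb V \<mu> \<boxtimes> idt (\<sigma> (- \<mu>))) = idt V"
    using hb_add[of V \<mu> "- \<mu>"] by (simp add: hb_zero)
  have "idt (\<sigma> \<mu>) \<boxtimes> adj (hb V (- \<mu>))
      = (idt (\<sigma> \<mu>) \<boxtimes> adj (hb V (- \<mu>))) \<odot> (idt (\<sigma> \<mu>) \<boxtimes> hb V (- \<mu>)) \<odot> (hb V \<mu> \<boxtimes> idt (\<sigma> (- \<mu>)))"
    unfolding i by simp
  also have "\<dots> = ((idt (\<sigma> \<mu>) \<boxtimes> adj (hb V (- \<mu>))) \<odot> (idt (\<sigma> \<mu>) \<boxtimes> hb V (- \<mu>))) \<odot> (hb V \<mu> \<boxtimes> idt (\<sigma> (- \<mu>)))"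
    by simp
  also have "(idt (\<sigma> \<mu>) \<boxtimes> adj (hb V (- \<mu>))) \<odot> (idt (\<sigma> \<mu>) \<boxtimes> hb V (- \<mu>)) = idt (\<sigma> \<mu> \<otimes> V \<otimes> \<sigma> (- \<mu>))"
    by (simp add: exchange hb_adj tensor_idt)
  finally show ?thesis by simp
qed

text \<open>
  The adjoint reverses the order of half-braiding and components, and negates degrees.  Naturality
  restores the order, and the inverse half-braiding that comes with the adjoint is the one for \<open>-\<mu>\<close>.
\<close>

lemma zdag_tens:
  assumes f: "f \<in> zhom U V" and h: "h \<in> zhom U' V'"
  shows "zdag (ztens f h) = ztens (zdag f) (zdag h)"
proof -
  note mem = ztens_in_zhom[of _ U V _ U' V']
    zdag_in_zhom[where V=U and W=V] zdag_in_zhom[where V=U' and W=V'] zmor_in_zhom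
  note dist = ztens_add_left[of _ U V _ _ U' V']
    ztens_add_right[of _ U V _ U' V']
    ztens_add_left[of _ V U _ _ V' U']
    ztens_add_right[of _ V U _ V' U']
    zdag_add[where V=U and W=V] zdag_add[where V=U' and W=V']
    zdag_add[where V="U \<otimes> U'" and W="V \<otimes> V'"]
  from f show ?thesis
  proof (induction rule: zhom_induct)
    case (single \<nu> F)
    note F = this
    from h show ?case
    proof (induction rule: zhom_induct)
      case (single \<mu> H)
      note H = this
      let ?n = "\<sigma> (- \<nu>)" and ?m = "\<sigma> (- \<mu>)"
      have "(idt ?n \<boxtimes> hb U (- \<mu>) \<boxtimes> idt U') \<odot> ((idt ?n \<boxtimes> adj F) \<boxtimes> (idt ?m \<boxtimes> adj H))
        = idt ?n \<boxtimes> (hb U (- \<mu>) \<odot> (adj F \<boxtimes> idt ?m)) \<boxtimes> adj H"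
      proof -
        have "(idt ?n \<boxtimes> adj F) \<boxtimes> (idt ?m \<boxtimes> adj H) = idt ?n \<boxtimes> (adj F \<boxtimes> idt ?m) \<boxtimes> adj H"
          using F H by simp
        then show ?thesis using F H by (simp add: merge del: tensor_assoc)
      qed
      also have "hb U (- \<mu>) \<odot> (adj F \<boxtimes> idt ?m) = (idt ?m \<boxtimes> adj F) \<odot> (idt (\<sigma> \<nu>) \<boxtimes> hb V (- \<mu>))"
        using hb_natural[of "adj F" "- \<mu>"] F by (simp add: hb_\<sigma>_tens)
      also have "idt ?n \<boxtimes> \<dots> \<boxtimes> adj H = (idt ?n \<boxtimes> (idt ?m \<boxtimes> adj F) \<boxtimes> adj H)
          \<odot> (idt ?n \<boxtimes> (idt (\<sigma> \<nu>) \<boxtimes> hb V (- \<mu>)) \<boxtimes> idt (\<sigma> \<mu> \<otimes> V'))"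
        using F H by (simp add: merge del: tensor_assoc)
      also have "\<dots> = (idt (\<sigma> (- \<nu> - \<mu>)) \<boxtimes> (adj F \<boxtimes> adj H)) \<odot> ((hb V (- \<mu>) \<boxtimes> idt (\<sigma> \<mu>)) \<boxtimes> idt V')"
        using F H by (simp add: tensor_idt tensor_idt_idt)
      also have "hb V (- \<mu>) \<boxtimes> idt (\<sigma> \<mu>) = idt ?m \<boxtimes> adj (hb V \<mu>)"
        using hb_inverse[of "- \<mu>" V] by simp
      finally have "(idt ?n \<boxtimes> hb U (- \<mu>) \<boxtimes> idt U') \<odot> ((idt ?n \<boxtimes> adj F) \<boxtimes> (idt ?m \<boxtimes> adj H))
        = (idt (\<sigma> (- \<nu> - \<mu>)) \<boxtimes> (adj F \<boxtimes> adj H)) \<odot> ((idt ?m \<boxtimes> adj (hb V \<mu>)) \<boxtimes> idt V')" .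
      then show ?case using F H
        by (simp add: ztens_zmor zdag_zmor adj_comp adj_tensor whisker_left tensor_idt_idt)
    qed (use F in \<open>simp_all add: dist mem\<close>)
  qed (use h in \<open>simp_all add: dist mem\<close>)
qed

end

section \<open>Generic simple objects are projective\<close>

context generically_semisimple_category
begin

lemma generic_Hom_zero:
  "g \<notin> X \<Longrightarrow> V \<in> deg g \<Longrightarrow> W \<in> deg g \<Longrightarrow> simple C V \<Longrightarrow> simple C W \<Longrightarrow> \<not> isomorphic C V W
    \<Longrightarrow> Hom V W = {0}"
  using generic_semisimple[of g] unfolding semisimple_on_def by blast

text \<open>
  The isotypic component of a generic simple object \<open>V\<close> in \<open>B\<close> is a multiple of \<open>V\<close>: the \<open>e j\<close>
  are a basis of \<open>Hom V B\<close> and the \<open>q j\<close> the dual basis of \<open>Hom B V\<close>.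
\<close>

lemma isotypic_componentE:
  fixes B
  assumes V: "simple C V" "V \<in> deg g" "g \<notin> X"
  obtains J :: "nat set" and e q where "finite J"
    "\<And>j. j \<in> J \<Longrightarrow> e j \<in> Hom V B" "\<And>j. j \<in> J \<Longrightarrow> q j \<in> Hom B V"
    "\<And>x. x \<in> Hom V B \<Longrightarrow> x = (\<Sum>j\<in>J. e j \<bullet> (q j \<bullet> x))"
    "\<And>y. y \<in> Hom B V \<Longrightarrow> y = (\<Sum>j\<in>J. (y \<bullet> e j) \<bullet> q j)"
proof -
  obtain F W i p where F: "finite F" "\<And>h. h \<in> F \<Longrightarrow> W h \<in> deg h"
    "\<And>h. h \<in> F \<Longrightarrow> i h \<in> Hom (W h) B" "\<And>h. h \<in> F \<Longrightarrow> p h \<in> Hom B (W h)"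
    "(\<Sum>h\<in>F. i h \<bullet> p h) = Id B"
    by (rule homogeneous_componentsE[of B]) blast
  have B: "x = (\<Sum>h\<in>F. i h \<bullet> (p h \<bullet> x))" if "x \<in> Hom V B" for x
    by (rule resolution_of_identity(1)[OF F(3-5) that])
  have B': "y = (\<Sum>h\<in>F. (y \<bullet> i h) \<bullet> p h)" if "y \<in> Hom B V" for y
    by (rule resolution_of_identity(2)[OF F(3-5) that])
  have off_g: "p h \<bullet> x = 0" if "h \<in> F" "h \<noteq> g" "x \<in> Hom V B" for h x
    using that deg_Hom[OF V(2) F(2)] cmp_in_Hom[OF that(3) F(4)] by auto
  have off_g': "y \<bullet> i h = 0" if "h \<in> F" "h \<noteq> g" "y \<in> Hom B V" for h y
    using that deg_Hom[OF F(2) V(2)] cmp_in_Hom[OF F(3) that(3)] by auto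
  have x_eq: "x = (\<Sum>h\<in>F. if h = g then i g \<bullet> (p g \<bullet> x) else 0)" if x: "x \<in> Hom V B" for x
    by (rule trans[OF B[OF x]], rule sum.cong)
       (use off_g[OF _ _ x] cmp_zero_right[OF F(3)] in auto)
  have y_eq: "y = (\<Sum>h\<in>F. if h = g then (y \<bullet> i g) \<bullet> p g else 0)" if y: "y \<in> Hom B V" for y
    by (rule trans[OF B'[OF y]], rule sum.cong)
       (use off_g'[OF _ _ y] cmp_zero_left[OF F(4)] in auto)
  show thesis
  proof (cases "g \<in> F")
    case False
    have "x = 0" if "x \<in> Hom V B" for x
      by (rule trans[OF x_eq[OF that]]) (use F(1) False in simp)
    moreover have "y = 0" if "y \<in> Hom B V" for y
      by (rule trans[OF y_eq[OF that]]) (use F(1) False in simp)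
    ultimately show thesis using that[of "{}"] by simp
  next
    case True
    note Fg = F(3)[OF True] F(4)[OF True]
    obtain n :: nat and U where U: "\<forall>j<n. U j \<in> deg g \<and> simple C (U j)"
      and d: "direct_sum C (W g) {..<n} U"
      using generic_semisimple[OF V(3)] F(2)[OF True] unfolding semisimple_on_def by blast
    from d obtain \<iota> \<pi> where \<iota>\<pi>: "\<And>j. j \<in> {..<n} \<Longrightarrow> \<iota> j \<in> Hom (U j) (W g)"
      "\<And>j. j \<in> {..<n} \<Longrightarrow> \<pi> j \<in> Hom (W g) (U j)" "(\<Sum>j<n. \<iota> j \<bullet> \<pi> j) = Id (W g)"
      unfolding direct_sum_def by auto
    define J where "J = {j. j < n \<and> isomorphic C V (U j)}"
    have J: "J \<subseteq> {..<n}" by (auto simp: J_def)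
    have "\<forall>j\<in>J. \<exists>s s'. s \<in> Hom V (U j) \<and> s' \<in> Hom (U j) V \<and> s \<bullet> s' = Id (U j)"
      unfolding J_def isomorphic_def by (auto elim!: is_isoE)
    then obtain s s' where s: "\<And>j. j \<in> J \<Longrightarrow> s j \<in> Hom V (U j)"
      "\<And>j. j \<in> J \<Longrightarrow> s' j \<in> Hom (U j) V" "\<And>j. j \<in> J \<Longrightarrow> s j \<bullet> s' j = Id (U j)"
      by metis
    have off_J: "Hom V (U j) = {0}" "Hom (U j) V = {0}" if "j \<in> {..<n} - J" for j
      using that U generic_Hom_zero[OF V(3,2) _ V(1)] generic_Hom_zero[OF V(3) _ V(2) _ V(1)]
        isomorphic_sym unfolding J_def by blast+
    let ?e = "\<lambda>j. (i g \<bullet> \<iota> j) \<bullet> s j" and ?q = "\<lambda>j. s' j \<bullet> (\<pi> j \<bullet> p g)"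
    have e: "?e j \<in> Hom V B" and q: "?q j \<in> Hom B V" if "j \<in> J" for j
      using s(1,2)[OF that] \<iota>\<pi>(1,2)[of j] J that Fg cmp_in_Hom by (meson subsetD)+
    show thesis
    proof (rule that[of J ?e ?q])
      show "finite J" by (simp add: J_def)
      fix x assume x: "x \<in> Hom V B"
      have px: "p g \<bullet> x \<in> Hom V (W g)" by (rule cmp_in_Hom[OF x Fg(2)])
      have \<pi>px0: "\<pi> j \<bullet> (p g \<bullet> x) = 0" if "j \<in> {..<n} - J" for j
        using off_J(1)[OF that] cmp_in_Hom[OF px \<iota>\<pi>(2), of j] that by auto
      have "x = i g \<bullet> (p g \<bullet> x)" by (rule trans[OF x_eq[OF x]]) (use F(1) True in simp)
      also have "p g \<bullet> x = (\<Sum>j<n. \<iota> j \<bullet> (\<pi> j \<bullet> (p g \<bullet> x)))" by (rule resolution_of_identity(1)[OF \<iota>\<pi> px])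
      also have "\<dots> = (\<Sum>j\<in>J. \<iota> j \<bullet> (\<pi> j \<bullet> (p g \<bullet> x)))"
        by (rule sum.mono_neutral_right[OF _ J])
           (simp_all add: \<pi>px0 cmp_zero_right[OF \<iota>\<pi>(1)])
      also have "i g \<bullet> \<dots> = (\<Sum>j\<in>J. i g \<bullet> (\<iota> j \<bullet> (\<pi> j \<bullet> (p g \<bullet> x))))"
        by (rule cmp_sum_right[OF Fg(1), where U = V]) (meson J subsetD \<iota>\<pi> cmp_in_Hom px)
      also have "\<dots> = (\<Sum>j\<in>J. ?e j \<bullet> (?q j \<bullet> x))"
      proof (rule sum.cong[OF refl])
        fix j assume j: "j \<in> J"
        note ty = \<iota>\<pi>(1,2)[OF subsetD[OF J j]] s(1,2)[OF j] Fg
        have \<pi>px: "\<pi> j \<bullet> (p g \<bullet> x) \<in> Hom V (U j)" by (rule cmp_in_Hom[OF px ty(2)])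
        have "?e j \<bullet> (?q j \<bullet> x) = (i g \<bullet> \<iota> j) \<bullet> (s j \<bullet> (s' j \<bullet> (\<pi> j \<bullet> (p g \<bullet> x))))"
          using cmp_assoc[OF cmp_in_Hom[OF x q[OF j]] ty(3) cmp_in_Hom[OF ty(1,5)]]
            cmp_assoc[OF x cmp_in_Hom[OF ty(6,2)] ty(4)] cmp_assoc[OF x ty(6,2)] by simp
        also have "s j \<bullet> (s' j \<bullet> (\<pi> j \<bullet> (p g \<bullet> x))) = \<pi> j \<bullet> (p g \<bullet> x)"
          using cmp_assoc[OF \<pi>px ty(4,3)] s(3)[OF j] cmp_Id_left[OF \<pi>px] by simp
        finally show "i g \<bullet> (\<iota> j \<bullet> (\<pi> j \<bullet> (p g \<bullet> x))) = ?e j \<bullet> (?q j \<bullet> x)"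
          using cmp_assoc[OF \<pi>px ty(1,5)] by simp
      qed
      finally show "x = (\<Sum>j\<in>J. ?e j \<bullet> (?q j \<bullet> x))" .
    next
      fix y assume y: "y \<in> Hom B V"
      have yi: "y \<bullet> i g \<in> Hom (W g) V" by (rule cmp_in_Hom[OF Fg(1) y])
      have yi\<iota>0: "(y \<bullet> i g) \<bullet> \<iota> j = 0" if "j \<in> {..<n} - J" for j
        using off_J(2)[OF that] cmp_in_Hom[OF \<iota>\<pi>(1) yi, of j] that by auto
      have "y = (y \<bullet> i g) \<bullet> p g" by (rule trans[OF y_eq[OF y]]) (use F(1) True in simp)
      also have "y \<bullet> i g = (\<Sum>j<n. ((y \<bullet> i g) \<bullet> \<iota> j) \<bullet> \<pi> j)" by (rule resolution_of_identity(2)[OF \<iota>\<pi> yi])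
      also have "\<dots> = (\<Sum>j\<in>J. ((y \<bullet> i g) \<bullet> \<iota> j) \<bullet> \<pi> j)"
        by (rule sum.mono_neutral_right[OF _ J])
           (simp_all add: yi\<iota>0 cmp_zero_left[OF \<iota>\<pi>(2)])
      also have "\<dots> \<bullet> p g = (\<Sum>j\<in>J. (((y \<bullet> i g) \<bullet> \<iota> j) \<bullet> \<pi> j) \<bullet> p g)"
        by (rule cmp_sum_left[OF Fg(2), where W = V]) (meson J subsetD \<iota>\<pi> cmp_in_Hom yi)
      also have "\<dots> = (\<Sum>j\<in>J. (y \<bullet> ?e j) \<bullet> ?q j)"
      proof (rule sum.cong[OF refl])
        fix j assume j: "j \<in> J"
        note ty = \<iota>\<pi>(1,2)[OF subsetD[OF J j]] s(1,2)[OF j] Fg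
        have z: "(y \<bullet> i g) \<bullet> \<iota> j \<in> Hom (U j) V" by (rule cmp_in_Hom[OF ty(1) yi])
        have "y \<bullet> ?e j = ((y \<bullet> i g) \<bullet> \<iota> j) \<bullet> s j"
          using cmp_assoc[OF ty(3) cmp_in_Hom[OF ty(1,5)] y] cmp_assoc[OF ty(1,5) y] by simp
        then have "(y \<bullet> ?e j) \<bullet> ?q j = ((y \<bullet> i g) \<bullet> \<iota> j) \<bullet> (s j \<bullet> (s' j \<bullet> (\<pi> j \<bullet> p g)))"
          using cmp_assoc[OF q[OF j] ty(3) z] by simp
        also have "s j \<bullet> (s' j \<bullet> (\<pi> j \<bullet> p g)) = \<pi> j \<bullet> p g"
          using cmp_assoc[OF cmp_in_Hom[OF ty(6,2)] ty(4,3)] s(3)[OF j] cmp_Id_left[OF cmp_in_Hom[OF ty(6,2)]]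
          by simp
        finally show "(((y \<bullet> i g) \<bullet> \<iota> j) \<bullet> \<pi> j) \<bullet> p g = (y \<bullet> ?e j) \<bullet> ?q j"
          using cmp_assoc[OF ty(6,2) z] by simp
      qed
      finally show "y = (\<Sum>j\<in>J. (y \<bullet> ?e j) \<bullet> ?q j)" .
    qed (use e q in blast)+
  qed
qed

text \<open>
  A linear functional on \<open>Hom V B\<close> is composition with a morphism \<open>B \<rightarrow> V\<close>.  If \<open>f : V \<rightarrow> B\<close> did
  not lift along the epimorphism \<open>p\<close>, a functional that vanishes on all \<open>p \<bullet> h\<close> but not at \<open>f\<close>
  would give a non-zero morphism \<open>B \<rightarrow> V\<close> whose composite with \<open>p\<close> is zero.
\<close>

theorem generic_simple_projective:
  assumes "V \<in> generic_simples C deg X"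
  shows "projective C V"
  unfolding projective_def
proof (intro allI impI)
  fix A B p f assume p: "epi C A B p" and f: "f \<in> Hom V B"
  obtain g where V: "simple C V" "V \<in> deg g" "g \<notin> X"
    using assms unfolding generic_simples_def by blast
  have p': "p \<in> Hom A B" using p unfolding epi_def by blast
  let ?S = "{p \<bullet> h | h. h \<in> Hom V A}"
  have S: "vs.subspace ?S"
    unfolding vs.subspace_def
  proof (intro conjI ballI allI)
    show "0 \<in> ?S" using cmp_zero_right[OF p'] zero_in_Hom by force
    show "x + y \<in> ?S" if x: "x \<in> ?S" and y: "y \<in> ?S" for x y
    proof -
      obtain h k where "h \<in> Hom V A" "k \<in> Hom V A" "x = p \<bullet> h" "y = p \<bullet> k" using x y by blast
      then have "h + k \<in> Hom V A" "x + y = p \<bullet> (h + k)"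
        using cmp_add_right[of h V A k p B] p' by (simp_all add: add_in_Hom)
      then show ?thesis by blast
    qed
    show "a \<cdot> x \<in> ?S" if x: "x \<in> ?S" for a x
    proof -
      obtain h where "h \<in> Hom V A" "x = p \<bullet> h" using x by blast
      then have "a \<cdot> h \<in> Hom V A" "a \<cdot> x = p \<bullet> (a \<cdot> h)"
        using cmp_scale_right[of h V A p B] p' by (simp_all add: scale_in_Hom)
      then show ?thesis by blast
    qed
  qed
  show "\<exists>h\<in>Hom V A. p \<bullet> h = f"
  proof (rule ccontr)
    assume "\<not> ?thesis"
    then have fS: "f \<notin> ?S" by blast
    interpret vp: vector_space_pair "scale C" "(*) :: 'k \<Rightarrow> 'k \<Rightarrow> 'k"
      by unfold_locales (simp_all add: algebra_simps)
    obtain \<phi> where \<phi>: "Vector_Spaces.linear (scale C) (*) \<phi>" "\<phi> f = 1" "\<And>x. x \<in> ?S \<Longrightarrow> \<phi> x = 0"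
    proof -
      obtain T where T: "T \<subseteq> ?S" "vs.independent T" "?S \<subseteq> vs.span T"
        by (rule vs.maximal_independent_subset[of ?S])
      have "vs.span T \<subseteq> ?S" by (rule vs.span_minimal[OF T(1) S])
      then have fT: "f \<notin> vs.span T" using fS by (meson subsetD)
      then have ind: "vs.independent (insert f T)" using T(2) vs.independent_insertI by blast
      let ?\<phi> = "vp.construct (insert f T) (\<lambda>x. if x = f then 1 else 0)"
      have lin: "Vector_Spaces.linear (scale C) (*) ?\<phi>" by (rule vp.linear_construct[OF ind])
      have "?\<phi> x = 0" if "x \<in> vs.span T" for x
      proof (rule vp.linear_eq_0_on_span[OF lin _ that])
        fix b assume b: "b \<in> T"
        then have "b \<noteq> f" using fT vs.span_base by blast
        then show "?\<phi> b = 0" using vp.construct_basis[OF ind] b by simp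
      qed
      moreover have "?\<phi> f = 1" using vp.construct_basis[OF ind] by simp
      ultimately show thesis using that lin T(3) by blast
    qed
    obtain J :: "nat set" and e q where J: "finite J" "\<And>j. j \<in> J \<Longrightarrow> e j \<in> Hom V B"
      "\<And>j. j \<in> J \<Longrightarrow> q j \<in> Hom B V" "\<And>x. x \<in> Hom V B \<Longrightarrow> x = (\<Sum>j\<in>J. e j \<bullet> (q j \<bullet> x))"
      by (rule isotypic_componentE[OF V, of B]) blast
    obtain J' :: "nat set" and e' q' where J': "\<And>j. j \<in> J' \<Longrightarrow> e' j \<in> Hom V A"
      "\<And>j. j \<in> J' \<Longrightarrow> q' j \<in> Hom A V" "\<And>y. y \<in> Hom A V \<Longrightarrow> y = (\<Sum>j\<in>J'. (y \<bullet> e' j) \<bullet> q' j)"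
      by (rule isotypic_componentE[OF V, of A]) blast
    define a where "a = (\<Sum>j\<in>J. \<phi> (e j) \<cdot> q j)"
    have a: "a \<in> Hom B V" unfolding a_def by (intro sum_in_Hom scale_in_Hom J(3))
    have ax: "a \<bullet> x = \<phi> x \<cdot> Id V" if x: "x \<in> Hom V B" for x
    proof -
      have "\<exists>l. q j \<bullet> x = l \<cdot> Id V" if "j \<in> J" for j
        using simple_scalar[OF V(1) cmp_in_Hom[OF x J(3)[OF that]]] by metis
      then obtain l where l: "\<And>j. j \<in> J \<Longrightarrow> q j \<bullet> x = l j \<cdot> Id V" by metis
      have "x = (\<Sum>j\<in>J. e j \<bullet> (q j \<bullet> x))" by (rule J(4)[OF x])
      also have "\<dots> = (\<Sum>j\<in>J. l j \<cdot> e j)"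
        by (rule sum.cong[OF refl])
           (simp add: l cmp_scale_right[OF Id_in_Hom J(2)] cmp_Id_right[OF J(2)])
      finally have "\<phi> x = (\<Sum>j\<in>J. l j * \<phi> (e j))"
        using vp.linear_sum[OF \<phi>(1), of "\<lambda>j. l j \<cdot> e j" J] vp.linear_scale[OF \<phi>(1)] by simp
      moreover have "a \<bullet> x = (\<Sum>j\<in>J. (\<phi> (e j) * l j) \<cdot> Id V)"
        using cmp_sum_left[OF x, of J "\<lambda>j. \<phi> (e j) \<cdot> q j" V]
        by (simp add: a_def scale_in_Hom J(3) cmp_scale_left[OF x J(3)] l)
      ultimately show ?thesis by (simp add: vs.scale_sum_left mult.commute)
    qed
    have "a \<bullet> p = (\<Sum>j\<in>J'. ((a \<bullet> p) \<bullet> e' j) \<bullet> q' j)"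
      by (rule J'(3)[OF cmp_in_Hom[OF p' a]])
    also have "\<dots> = 0"
    proof (rule sum.neutral, rule ballI)
      fix j assume j: "j \<in> J'"
      have "p \<bullet> e' j \<in> ?S" using J'(1)[OF j] by blast
      then have "a \<bullet> (p \<bullet> e' j) = 0" using ax[OF cmp_in_Hom[OF J'(1)[OF j] p']] \<phi>(3) by simp
      then show "((a \<bullet> p) \<bullet> e' j) \<bullet> q' j = 0"
        using cmp_assoc[OF J'(1)[OF j] p' a] cmp_zero_left[OF J'(2)[OF j]] by simp
    qed
    finally have "a \<bullet> p = 0 \<bullet> p" using cmp_zero_left[OF p'] by simp
    then have "a = 0" using p a zero_in_Hom unfolding epi_def by blast
    then have "Id V = 0" using ax[OF f] \<phi>(2) cmp_zero_left[OF f] by simp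
    then show False using V(1) unfolding simple_def by blast
  qed
qed

end

section \<open>The orbit category is Hermitian pivotal and generically semisimple\<close>

context orbit_setting
begin

lemma translate_deg: "V \<in> deg g \<Longrightarrow> \<sigma> \<nu> \<otimes> V \<in> deg g"
  using deg_tens[OF \<sigma>_deg] by fastforce

text \<open>
  Translation by \<open>\<nu>\<close> is invertible, so it is bijective on endomorphisms.
\<close>

lemma translate_simple:
  assumes V: "simple C V"
  shows "simple C (\<sigma> \<nu> \<otimes> V)"
  unfolding simple_def
proof
  show "Id (\<sigma> \<nu> \<otimes> V) \<noteq> 0"
  proof
    assume "Id (\<sigma> \<nu> \<otimes> V) = 0"
    moreover have "mor (idt (\<sigma> (- \<nu>)) \<boxtimes> idt (\<sigma> \<nu> \<otimes> V)) = Id V"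
      by (simp add: tensor_idt del: arrow_simps(6))
    ultimately have "Id V = 0" by (simp add: tens_zero_right[OF Id_in_Hom])
    then show False using V by (simp add: simple_def)
  qed
  have "\<exists>a. f = a \<cdot> Id (\<sigma> \<nu> \<otimes> V)" if f: "f \<in> Hom (\<sigma> \<nu> \<otimes> V) (\<sigma> \<nu> \<otimes> V)" for f
  proof -
    let ?f = "Arrow (\<sigma> \<nu> \<otimes> V) (\<sigma> \<nu> \<otimes> V) f"
    have "arr (idt (\<sigma> (- \<nu>)) \<boxtimes> ?f)" using f by simp
    then have "mor (idt (\<sigma> (- \<nu>)) \<boxtimes> ?f) \<in> Hom V V" unfolding arr_def by simp
    then obtain a where a: "mor (idt (\<sigma> (- \<nu>)) \<boxtimes> ?f) = a \<cdot> Id V"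
      by (rule simple_scalar[OF V])
    have "f = mor (idt (\<sigma> \<nu>) \<boxtimes> idt (\<sigma> (- \<nu>)) \<boxtimes> ?f)"
      using f by (simp add: tensor_idt_idt del: arrow_simps(6))
    also have "\<dots> = Id (\<sigma> \<nu>) \<otimes>\<^sub>m (a \<cdot> Id V)"
      using a by simp
    finally show ?thesis
      by (auto simp: tens_scale_right[OF Id_in_Hom Id_in_Hom] tens_Id)
  qed
  then show "Hom (\<sigma> \<nu> \<otimes> V) (\<sigma> \<nu> \<otimes> V) = {a \<cdot> Id (\<sigma> \<nu> \<otimes> V) |a. True}"
    using scale_in_Hom[OF Id_in_Hom] by blast
qed

lemma translate_commute: "isomorphic C (\<sigma> \<nu> \<otimes> V) (V \<otimes> \<sigma> \<nu>)"
  using braiding_iso unfolding isomorphic_def by blast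

lemma translate_free:
  assumes "simple C V" "isomorphic C V (\<sigma> \<nu> \<otimes> V)"
  shows "\<nu> = 0"
  using \<sigma>_free[OF assms(1)] isomorphic_sym[OF isomorphic_trans[OF assms(2) translate_commute]] by blast

lemma generic_degree_exists: obtains g where "g \<notin> X"
proof -
  have "X \<noteq> UNIV"
  proof
    assume "X = UNIV"
    then have "finite {0} \<and> (\<Union>s\<in>{0}. (\<lambda>x. s + x) ` X) = UNIV" by simp
    then show False using X_small unfolding small_set_def by blast
  qed
  then show ?thesis using that by blast
qed

lemma dominated_component:
  assumes d: "dominated C V S" and V: "Id V \<noteq> 0"
  obtains U a b where "U \<in> S" "a \<in> Hom V U" "b \<in> Hom U V" "b \<bullet> a \<noteq> 0"
proof -
  have "\<exists>U\<in>S. \<exists>a\<in>Hom V U. \<exists>b\<in>Hom U V. b \<bullet> a \<noteq> 0"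
  proof (rule ccontr)
    assume "\<not> ?thesis"
    then have "{b \<bullet> a | a b U. U \<in> S \<and> a \<in> Hom V U \<and> b \<in> Hom U V} \<subseteq> {0}" by blast
    then have "vs.span {b \<bullet> a | a b U. U \<in> S \<and> a \<in> Hom V U \<and> b \<in> Hom U V} \<subseteq> {0}"
      by (rule vs.span_minimal[OF _ vs.subspace_single_0])
    then show False using d V unfolding dominated_def by blast
  qed
  then show ?thesis using that by blast
qed

text \<open>
  Let \<open>V\<close> be a generic simple object with epic evaluation.  For \<open>f : \<one> \<rightarrow> \<sigma>\<^sub>\<nu>\<close> with \<open>\<nu> \<noteq> 0\<close>
  the morphism \<open>f \<otimes> Id\<^sub>V\<close> goes between non-isomorphic simple objects of a semisimple degree, hence is
  zero; so is then \<open>f \<bullet> ev\<^sub>V\<close>, and \<open>f\<close> itself.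
\<close>

lemma Hom_unit_\<sigma>:
  assumes \<nu>: "\<nu> \<noteq> 0"
  shows "Hom \<one> (\<sigma> \<nu>) = {0}"
proof -
  obtain g where g: "g \<notin> X" by (rule generic_degree_exists)
  obtain I where I: "I \<subseteq> deg g" "\<forall>V\<in>I. simple C V \<and> epi C (dual C V \<otimes> V) \<one> (ev C V)"
    "\<forall>V\<in>deg g. dominated C V {W \<otimes> \<sigma> \<nu> | W \<nu>. W \<in> I}"
    using generic_dominated[OF g] by blast
  obtain U where U: "U \<in> deg g" "Id U \<noteq> 0" using deg_nonzero by blast
  obtain V where V: "V \<in> I" by (rule dominated_component[OF I(3)[rule_format, OF U(1)] U(2)]) blast
  then have Vs: "simple C V" "V \<in> deg g" and ev: "epi C (dual C V \<otimes> V) \<one> (ev C V)" using I by auto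
  have "f = 0" if f: "f \<in> Hom \<one> (\<sigma> \<nu>)" for f
  proof -
    let ?f = "Arrow \<one> (\<sigma> \<nu>) f"
    have "\<not> isomorphic C V (\<sigma> \<nu> \<otimes> V)" using translate_free[OF Vs(1)] \<nu> by blast
    then have "Hom V (\<sigma> \<nu> \<otimes> V) = {0}"
      using generic_Hom_zero[OF g Vs(2) translate_deg[OF Vs(2)] Vs(1) translate_simple[OF Vs(1)]] by blast
    moreover have "f \<otimes>\<^sub>m Id V \<in> Hom V (\<sigma> \<nu> \<otimes> V)"
      using tens_in_Hom[OF f Id_in_Hom, of V] by simp
    ultimately have fV: "f \<otimes>\<^sub>m Id V = 0" by auto
    have "idt V \<boxtimes> ?f = adj (brd V (\<sigma> \<nu>)) \<odot> brd V (\<sigma> \<nu>) \<odot> (idt V \<boxtimes> ?f)"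
      using f brd_adj(1)[of V "\<sigma> \<nu>"] by (simp flip: comp_assoc)
    also have "\<dots> = adj (brd V (\<sigma> \<nu>)) \<odot> (?f \<boxtimes> idt V) \<odot> brd V \<one>"
      using brd_natural[of "idt V" ?f] f by simp
    finally have "mor (idt V \<boxtimes> ?f) = mor (adj (brd V (\<sigma> \<nu>)) \<odot> (?f \<boxtimes> idt V) \<odot> brd V \<one>)"
      by simp
    then have Vf: "Id V \<otimes>\<^sub>m f = 0"
      using cmp_zero_left[OF braiding_in_Hom] cmp_zero_right[OF dag_in_Hom[OF braiding_in_Hom]]
      by (simp add: fV)
    have "?f \<odot> evA V = (evA V \<boxtimes> idt (\<sigma> \<nu>)) \<odot> (idt (dual C V) \<boxtimes> (idt V \<boxtimes> ?f))"
      using f exchange[of "evA V" "idt \<one>" "idt \<one>" ?f]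
        exchange[of "idt (dual C V \<otimes> V)" "evA V" ?f "idt (\<sigma> \<nu>)"] by (simp add: tensor_idt_idt)
    then have "mor (?f \<odot> evA V) = mor ((evA V \<boxtimes> idt (\<sigma> \<nu>)) \<odot> (idt (dual C V) \<boxtimes> (idt V \<boxtimes> ?f)))"
      by simp
    then have "f \<bullet> ev C V = 0"
      using cmp_zero_right[OF tens_in_Hom[OF ev_in_Hom Id_in_Hom]]
      by (simp add: Vf tens_zero_right[OF Id_in_Hom])
    also have "0 = 0 \<bullet> ev C V" using cmp_zero_left[OF ev_in_Hom] by simp
    finally show "f = 0" using ev f zero_in_Hom unfolding epi_def by blast
  qed
  then show ?thesis using zero_in_Hom by blast
qed

lemma zhom_concentrated:
  assumes f: "f \<in> zhom V W" and zero: "\<And>\<nu>. \<nu> \<noteq> 0 \<Longrightarrow> Hom V (\<sigma> \<nu> \<otimes> W) = {0}"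
  shows "f = sing 0 (component f 0)"
proof (rule poly_mapping_eqI)
  fix \<nu>
  show "component f \<nu> = component (sing 0 (component f 0)) \<nu>"
    using zhom_lookup[OF f, of \<nu>] zero[of \<nu>] by (cases "\<nu> = 0") (auto simp: lookup_single)
qed

text \<open>
  Graded endomorphisms of \<open>\<one>\<close> are concentrated in degree zero, where they are endomorphisms in \<open>C\<close>.
\<close>

lemma zEnd_unit: "bij_betw (\<lambda>a. zscale a (sing 0 (Id \<one>))) UNIV (zhom \<one> \<one>)"
proof -
  have inj: "inj (\<lambda>a. a \<cdot> Id \<one>)" and surj: "range (\<lambda>a. a \<cdot> Id \<one>) = Hom \<one> \<one>"
    using End_unit unfolding bij_betw_def by blast+
  have "inj (\<lambda>a. zscale a (sing 0 (Id \<one>)))"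
  proof (rule injI)
    fix a b assume "zscale a (sing 0 (Id \<one>)) = zscale b (sing 0 (Id \<one>))"
    then have "a \<cdot> Id \<one> = b \<cdot> Id \<one>" unfolding zscale_single by (metis lookup_single_eq)
    then show "a = b" by (rule injD[OF inj])
  qed
  moreover have "f \<in> range (\<lambda>a. zscale a (sing 0 (Id \<one>)))" if f: "f \<in> zhom \<one> \<one>" for f
  proof -
    have "f = sing 0 (component f 0)"
      by (rule zhom_concentrated[OF f]) (simp add: Hom_unit_\<sigma>)
    moreover have "component f 0 \<in> range (\<lambda>a. a \<cdot> Id \<one>)"
      using zhom_lookup[OF f, of 0] surj by simp
    ultimately show ?thesis unfolding zscale_single by auto
  qed
  ultimately show ?thesis
    unfolding bij_betw_def using zhom_scale[OF zId_in_zhom] by blast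
qed

lemma CZ_tensor_category: "tensor_category orbit"
proof (rule tensor_category.intro[OF CZ_linear_category], rule tensor_category_axioms.intro, unfold CZ_simps)
  show "ztens (sing 0 (Id V)) (sing 0 (Id W)) = sing 0 (Id (V \<otimes> W))" for V W
    by (simp add: z_degree_zero tensor_idt)
  show "ztens (zscale a f + zscale a' f') g = zscale a (ztens f g) + zscale a' (ztens f' g)"
    if "f \<in> zhom V W" "f' \<in> zhom V W" "g \<in> zhom V' W'" for f V W f' g V' W' a a'
    using that ztens_add_left[OF zhom_scale[OF that(1)] zhom_scale[OF that(2)] that(3)]
    by (simp add: ztens_scale)
  show "ztens f (zscale a g + zscale a' g') = zscale a (ztens f g) + zscale a' (ztens f g')"
    if "f \<in> zhom V W" "g \<in> zhom V' W'" "g' \<in> zhom V' W'" for f V W g V' W' g' a a'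
    using that ztens_add_right[OF that(1) zhom_scale[OF that(2)] zhom_scale[OF that(3)]]
    by (simp add: ztens_scale)
qed (rule tens_ob_assoc tens_ob_unit_left tens_ob_unit_right zEnd_unit
      ztens_in_zhom ztens_cmp ztens_assoc ztens_unit; assumption?)+

lemma CZ_pivotal_category: "pivotal_category orbit"
  by (rule pivotal_category.intro[OF CZ_tensor_category], rule pivotal_category_axioms.intro, unfold CZ_simps)
     (rule z_duality_in_zhom z_zigzags z_dual_mor_eq z_dual_tens_eq; assumption?)+

lemma CZ_hermitian_pivotal_category: "hermitian_pivotal_category orbit bar zdag"
proof (intro hermitian_pivotal_category.intro sesquilinear_pivotal_category.intro
    sesquilinear_pivotal_category_axioms.intro hermitian_pivotal_category_axioms.intro
    CZ_pivotal_category field_involution_axioms, unfold CZ_simps)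
  show "bij_betw zdag (zhom V W) (zhom W V)" for V W
    by (rule bij_betw_byWitness[where f' = zdag]) (auto simp: zdag_zdag zdag_in_zhom)
  show "zdag (zscale a f + zscale b g) = zscale (bar a) (zdag f) + zscale (bar b) (zdag g)"
    if "f \<in> zhom V W" "g \<in> zhom V W" for f V W g a b
    using that by (simp add: zdag_add[OF zhom_scale[OF that(1)] zhom_scale[OF that(2)]] zdag_scale)
  have d: "zdag (zmor 0 F) = zmor 0 (adj F)" if "arr F" for F
    using zdag_zmor[OF that, of 0] that by simp
  have a: "adj (coevA V) = evA' V" "adj (evA V) = coevA' V"
    "adj (coevA' V) = evA V" "adj (evA' V) = coevA V" for V
    by (intro arrow_eqI; simp add: dag_coev dag_ev dag_coev' dag_ev')+
  show "zdag (sing 0 (coev C V)) = sing 0 (ev' C V)" "zdag (sing 0 (ev C V)) = sing 0 (coev' C V)"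
    "zdag (sing 0 (coev' C V)) = sing 0 (ev C V)" "zdag (sing 0 (ev' C V)) = sing 0 (coev C V)" for V
    by (simp_all add: zmor_duality[symmetric] d a)
qed (rule zdag_tens zdag_cmp zdag_zdag; assumption)+

lemma CZ_direct_sum:
  assumes "direct_sum C V J W"
  shows "direct_sum orbit V J W"
proof -
  from assms obtain i p where J: "finite J"
    and ip: "\<And>j. j \<in> J \<Longrightarrow> i j \<in> Hom (W j) V \<and> p j \<in> Hom V (W j)"
    and pi: "\<And>j l. j \<in> J \<Longrightarrow> l \<in> J \<Longrightarrow> p j \<bullet> i l = (if j = l then Id (W j) else 0)"
    and s: "(\<Sum>j\<in>J. i j \<bullet> p j) = Id V"
    unfolding direct_sum_def by blast
  have z: "zcmp (sing 0 y) (sing 0 x) = sing 0 (y \<bullet> x)" if "x \<in> Hom A B" "y \<in> Hom B D" for x y A B D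
    using zcmp_degree_zero[of "Arrow A B x" "Arrow B D y"] that by (simp add: zmor_def)
  have "zcmp (sing 0 (p j)) (sing 0 (i l)) = (if j = l then sing 0 (Id (W j)) else 0)"
    if "j \<in> J" "l \<in> J" for j l
    using z[of "i l" "W l" V "p j" "W j"] ip that pi[OF that] by simp
  moreover have "(\<Sum>j\<in>J. zcmp (sing 0 (i j)) (sing 0 (p j))) = sing 0 (Id V)"
  proof -
    have "(\<Sum>j\<in>J. zcmp (sing 0 (i j)) (sing 0 (p j))) = (\<Sum>j\<in>J. sing 0 (i j \<bullet> p j))"
      by (rule sum.cong[OF refl]) (use z ip in blast)
    also have "\<dots> = sing 0 (\<Sum>j\<in>J. i j \<bullet> p j)"
      using J by induction (simp_all add: single_add)
    finally show ?thesis using s by simp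
  qed
  moreover have "sing 0 (i j) \<in> zhom (W j) V \<and> sing 0 (p j) \<in> zhom V (W j)" if "j \<in> J" for j
    using ip[OF that] by (auto intro!: zhom_single)
  ultimately show ?thesis
    unfolding direct_sum_def CZ_simps using J
    by (intro conjI exI[of _ "\<lambda>j. sing 0 (i j)"] exI[of _ "\<lambda>j. sing 0 (p j)"]) auto
qed

lemma CZ_simple_imp_simple:
  assumes "simple orbit V"
  shows "simple C V"
proof -
  have ne: "sing 0 (Id V) \<noteq> 0" and sc: "zhom V V = {zscale a (sing 0 (Id V)) | a. True}"
    using assms unfolding simple_def CZ_simps by blast+
  have "f \<in> {a \<cdot> Id V | a. True}" if f: "f \<in> Hom V V" for f
  proof -
    have "sing 0 f \<in> zhom V V" using f by (simp add: zhom_single)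
    then obtain a where "sing 0 f = sing 0 (a \<cdot> Id V)" using sc by (auto simp: zscale_single)
    then have "f = a \<cdot> Id V" by (metis lookup_single_eq)
    then show ?thesis by blast
  qed
  moreover have "Id V \<noteq> 0" using ne by auto
  ultimately show ?thesis
    unfolding simple_def using scale_in_Hom[OF Id_in_Hom] by blast
qed

text \<open>
  By freeness \<open>V\<close> is not isomorphic to its proper translates, which are simple objects of the same
  generic degree; so a graded endomorphism of \<open>V\<close> has no components of non-zero degree.
\<close>

lemma generic_simple_imp_CZ_simple:
  assumes g: "g \<notin> X" and V: "V \<in> deg g" "simple C V"
  shows "simple orbit V"
proof -
  have "Hom V (\<sigma> \<nu> \<otimes> V) = {0}" if "\<nu> \<noteq> 0" for \<nu>
    using generic_Hom_zero[OF g V(1) translate_deg[OF V(1)] V(2) translate_simple[OF V(2)]]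
      translate_free[OF V(2)] that by blast
  then have c: "f = sing 0 (component f 0)" if "f \<in> zhom V V" for f
    by (rule zhom_concentrated[OF that])
  have "f \<in> {zscale a (sing 0 (Id V)) | a. True}" if f: "f \<in> zhom V V" for f
  proof -
    have "component f 0 \<in> Hom V V" using zhom_lookup[OF f, of 0] by simp
    then obtain a where "component f 0 = a \<cdot> Id V" by (rule simple_scalar[OF V(2)])
    then have "f = zscale a (sing 0 (Id V))" using c[OF f] by (simp add: zscale_single)
    then show ?thesis by blast
  qed
  moreover have "sing 0 (Id V) \<noteq> 0"
    using V(2) by (metis lookup_single_eq lookup_zero simple_def)
  ultimately show ?thesis
    unfolding simple_def CZ_simps using zhom_scale[OF zId_in_zhom] by blast
qed

text \<open>
  The identity of \<open>\<sigma>\<^sub>\<nu> \<otimes> W\<close> is a graded isomorphism from \<open>\<sigma>\<^sub>\<nu> \<otimes> W\<close> to \<open>W\<close>.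
\<close>

lemma isomorphic_translate_CZ:
  assumes "isomorphic C V (\<sigma> \<nu> \<otimes> W)"
  shows "isomorphic orbit V W"
proof -
  obtain f f' where f: "f \<in> Hom V (\<sigma> \<nu> \<otimes> W)" "f' \<in> Hom (\<sigma> \<nu> \<otimes> W) V"
    "f' \<bullet> f = Id V" "f \<bullet> f' = Id (\<sigma> \<nu> \<otimes> W)"
    using assms unfolding isomorphic_def by (auto elim: is_isoE)
  let ?F = "Arrow V (\<sigma> \<nu> \<otimes> W) f" and ?F' = "Arrow (\<sigma> \<nu> \<otimes> W) V f'"
  let ?G = "idt (\<sigma> (- \<nu>)) \<boxtimes> ?F'"
  have F: "arr ?F" "arr ?F'" using f by simp_all
  have FF': "?F' \<odot> ?F = idt V" "?F \<odot> ?F' = idt (\<sigma> \<nu> \<otimes> W)"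
    by (rule arrow_eqI; simp add: f)+
  have "zcmp (zmor (- \<nu>) ?G) (zmor \<nu> ?F) = zmor 0 (?F' \<odot> ?F)"
    using F by (simp add: zcmp_zmor tensor_idt_idt)
  moreover have "zcmp (zmor \<nu> ?F) (zmor (- \<nu>) ?G) = zmor 0 (idt (\<sigma> (- \<nu>)) \<boxtimes> (?F \<odot> ?F'))"
    using F by (simp add: zcmp_zmor whisker_left)
  ultimately show ?thesis
    unfolding isomorphic_def is_iso_def CZ_simps
    using F zmor_in_zhom[of ?F V \<nu> W] zmor_in_zhom[of ?G W "- \<nu>" V]
    by (intro exI[of _ "zmor \<nu> ?F"] conjI bexI[of _ "zmor (- \<nu>) ?G"])
       (simp_all add: FF' zmor_idt tensor_idt)
qed

lemma CZ_semisimple_on: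
  assumes g: "g \<notin> X"
  shows "semisimple_on orbit (deg g)"
  unfolding semisimple_on_def
proof (intro conjI ballI impI)
  fix V assume V: "V \<in> deg g"
  obtain n :: nat and W where W: "\<forall>j<n. W j \<in> deg g \<and> simple C (W j)" and d: "direct_sum C V {..<n} W"
    using generic_semisimple[OF g] V unfolding semisimple_on_def by blast
  show "\<exists>(n::nat) W. (\<forall>j<n. W j \<in> deg g \<and> simple orbit (W j))
      \<and> direct_sum orbit V {..<n} W"
    using W generic_simple_imp_CZ_simple[OF g] CZ_direct_sum[OF d] by blast
next
  fix V W assume VW: "V \<in> deg g" "W \<in> deg g" "simple orbit V" "simple orbit W"
    and ni: "\<not> isomorphic orbit V W"
  note s = VW(3,4)[THEN CZ_simple_imp_simple]
  have "Hom V (\<sigma> \<nu> \<otimes> W) = {0}" for \<nu>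
    using generic_Hom_zero[OF g VW(1) translate_deg[OF VW(2)] s(1) translate_simple[OF s(2)]]
      isomorphic_translate_CZ ni by blast
  then have "f = 0" if "f \<in> zhom V W" for f
    using zhom_lookup[OF that] by (intro poly_mapping_eqI) simp
  then show "hom orbit V W = {0}" by auto
qed

text \<open>
  A generic simple object has a non-zero morphism to one of the dominating objects, which are
  translates of the simple objects in \<open>I\<close>; by semisimplicity this is an isomorphism.
\<close>

lemma generic_simple_translateE:
  assumes g: "g \<notin> X" and V: "V \<in> deg g" "simple C V"
    and I: "I \<subseteq> deg g" "\<forall>W\<in>I. simple C W" "dominated C V {W \<otimes> \<sigma> \<nu> | W \<nu>. W \<in> I}"
  obtains W \<nu> where "W \<in> I" "isomorphic C V (\<sigma> \<nu> \<otimes> W)"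
proof -
  have "Id V \<noteq> 0" using V(2) by (simp add: simple_def)
  from I(3) this obtain U a b where U: "U \<in> {W \<otimes> \<sigma> \<nu> | W \<nu>. W \<in> I}" "a \<in> Hom V U" "b \<in> Hom U V" "b \<bullet> a \<noteq> 0"
    by (rule dominated_component)
  then obtain W \<nu> where W: "W \<in> I" "U = W \<otimes> \<sigma> \<nu>" by blast
  have "c W (\<sigma> \<nu>) \<bullet> a \<in> Hom V (\<sigma> \<nu> \<otimes> W)"
    using cmp_in_Hom[OF U(2)[unfolded W] braiding_in_Hom] .
  moreover have "c W (\<sigma> \<nu>) \<bullet> a \<noteq> 0"
  proof
    assume z: "c W (\<sigma> \<nu>) \<bullet> a = 0"
    have d: "dag (c W (\<sigma> \<nu>)) \<in> Hom (\<sigma> \<nu> \<otimes> W) U" unfolding W by (rule dag_in_Hom[OF braiding_in_Hom])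
    have "a = dag (c W (\<sigma> \<nu>)) \<bullet> (c W (\<sigma> \<nu>) \<bullet> a)"
      using cmp_assoc[OF U(2)[unfolded W] braiding_in_Hom d[unfolded W]] dag_braiding_left cmp_Id_left[OF U(2)] W
      by simp
    then have "a = 0" using z cmp_zero_right[OF d] by simp
    then show False using U(4) cmp_zero_right[OF U(3)] by simp
  qed
  ultimately have "Hom V (\<sigma> \<nu> \<otimes> W) \<noteq> {0}" by blast
  then have "isomorphic C V (\<sigma> \<nu> \<otimes> W)"
    using generic_Hom_zero[OF g V(1) translate_deg V(2) translate_simple] I W by blast
  then show ?thesis using that W by blast
qed

lemma CZ_generically_finitely_semisimple:
  "generically_finitely_semisimple_category orbit deg X"
proof (intro generically_finitely_semisimple_category.intro generically_semisimple_category.intro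
    graded_category.intro CZ_tensor_category graded_category_axioms.intro
    generically_semisimple_category_axioms.intro generically_finitely_semisimple_category_axioms.intro
    X_symmetric X_small CZ_semisimple_on, unfold CZ_simps)
  show "\<exists>V\<in>deg g. sing 0 (Id V) \<noteq> 0" for g
    using deg_nonzero[of g] by (metis lookup_single_eq lookup_zero)
  show "\<exists>F W. (\<forall>g\<in>F. W g \<in> deg g) \<and> direct_sum orbit V F W" for V
    using deg_decomp[of V] CZ_direct_sum by blast
  show "zhom V W = {0}" if VW: "V \<in> deg g" "W \<in> deg h" "g \<noteq> h" for V g W h
  proof -
    have "f = 0" if "f \<in> zhom V W" for f
      using zhom_lookup[OF that] deg_Hom[OF VW(1) translate_deg[OF VW(2)] VW(3)]
      by (intro poly_mapping_eqI) simp
    then show ?thesis by auto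
  qed
  show "\<exists>R. finite R \<and> (\<forall>V\<in>deg g. simple orbit V \<longrightarrow> (\<exists>W\<in>R. isomorphic orbit V W))"
    if g: "g \<notin> X" for g
  proof -
    obtain I where I: "finite I" "I \<subseteq> deg g" "\<forall>V\<in>I. simple C V"
      "\<forall>V\<in>deg g. dominated C V {W \<otimes> \<sigma> \<nu> | W \<nu>. W \<in> I}"
      using generic_dominated[OF g] by blast
    have "\<exists>W\<in>I. isomorphic orbit V W" if V: "V \<in> deg g" "simple orbit V" for V
    proof -
      obtain W \<nu> where "W \<in> I" "isomorphic C V (\<sigma> \<nu> \<otimes> W)"
        by (rule generic_simple_translateE[OF g V(1) CZ_simple_imp_simple[OF V(2)] I(2,3)
              I(4)[rule_format, OF V(1)]])
      then show ?thesis using isomorphic_translate_CZ by blast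
    qed
    then show ?thesis using I(1) by blast
  qed
qed (rule deg_unit deg_tens; assumption?)+

end

section \<open>Tensor products with projective objects\<close>

context pivotal_category
begin

text \<open>
  Transposition under the adjunction between tensoring with \<open>W\<close> and tensoring with \<open>W\<^sup>*\<close> on the left.
  As both functors preserve epimorphisms, both preserve projective objects.
\<close>

definition transpose :: "'o \<Rightarrow> 'o \<Rightarrow> ('o, 'm) arrow \<Rightarrow> ('o, 'm) arrow"
  where "transpose W U f = (idt (dual C W) \<boxtimes> f) \<odot> (coevA' W \<boxtimes> idt U)"

lemma transpose_simps [simp]:
  "src (transpose W U f) = U" "tgt (transpose W U f) = dual C W \<otimes> tgt f"
  "arr f \<Longrightarrow> src f = W \<otimes> U \<Longrightarrow> arr (transpose W U f)"
  by (simp_all add: transpose_def)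

lemma untranspose:
  assumes f: "arr f" "src f = W \<otimes> U"
  shows "(evA' W \<boxtimes> idt (tgt f)) \<odot> (idt W \<boxtimes> transpose W U f) = f"
proof -
  have "(evA' W \<boxtimes> idt (tgt f)) \<odot> (idt W \<boxtimes> transpose W U f)
     = ((evA' W \<boxtimes> idt (tgt f)) \<odot> (idt (W \<otimes> dual C W) \<boxtimes> f)) \<odot> (idt W \<boxtimes> coevA' W \<boxtimes> idt U)"
    using f by (simp add: transpose_def whisker_left tensor_idt_idt)
  also have "(evA' W \<boxtimes> idt (tgt f)) \<odot> (idt (W \<otimes> dual C W) \<boxtimes> f) = f \<odot> (evA' W \<boxtimes> idt (W \<otimes> U))"
    using f exchange[of "idt (W \<otimes> dual C W)" "evA' W" f "idt (tgt f)"]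
      exchange[of "evA' W" "idt \<one>" "idt (W \<otimes> U)" f] by simp
  also have "(f \<odot> (evA' W \<boxtimes> idt (W \<otimes> U))) \<odot> (idt W \<boxtimes> coevA' W \<boxtimes> idt U)
     = f \<odot> (((evA' W \<boxtimes> idt W) \<odot> (idt W \<boxtimes> coevA' W)) \<boxtimes> idt U)"
    using f by (simp add: whisker_right tensor_idt)
  finally show ?thesis using f by (simp add: zigzags tensor_idt)
qed

lemma transpose_comp:
  assumes "arr f" "arr p" "src f = W \<otimes> tgt p"
  shows "transpose W (src p) (f \<odot> (idt W \<boxtimes> p)) = transpose W (tgt p) f \<odot> p"
proof -
  have "(idt (dual C W \<otimes> W) \<boxtimes> p) \<odot> (coevA' W \<boxtimes> idt (src p)) = (coevA' W \<boxtimes> idt (tgt p)) \<odot> p"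
    using assms exchange[of "coevA' W" "idt (dual C W \<otimes> W)" "idt (src p)" p]
      exchange[of "idt \<one>" "coevA' W" p "idt (tgt p)"] by simp
  then show ?thesis using assms by (simp add: transpose_def whisker_left tensor_idt_idt)
qed

lemma epi_tens_left:
  assumes p: "epi C A B p"
  shows "epi C (W \<otimes> A) (W \<otimes> B) (Id W \<otimes>\<^sub>m p)"
  unfolding epi_def
proof (intro conjI allI ballI impI)
  have p': "p \<in> Hom A B" using p unfolding epi_def by blast
  then show "Id W \<otimes>\<^sub>m p \<in> Hom (W \<otimes> A) (W \<otimes> B)" by (rule tens_in_Hom[OF Id_in_Hom])
  fix U a b assume a: "a \<in> Hom (W \<otimes> B) U" and b: "b \<in> Hom (W \<otimes> B) U"
    and eq: "a \<bullet> (Id W \<otimes>\<^sub>m p) = b \<bullet> (Id W \<otimes>\<^sub>m p)"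
  let ?p = "Arrow A B p" and ?a = "Arrow (W \<otimes> B) U a" and ?b = "Arrow (W \<otimes> B) U b"
  have "?a \<odot> (idt W \<boxtimes> ?p) = ?b \<odot> (idt W \<boxtimes> ?p)"
    by (rule arrow_eqI) (simp_all add: eq)
  then have "transpose W B ?a \<odot> ?p = transpose W B ?b \<odot> ?p"
    using transpose_comp[of ?a ?p W] transpose_comp[of ?b ?p W] p' a b by simp
  then have "mor (transpose W B ?a) \<bullet> p = mor (transpose W B ?b) \<bullet> p"
    by (metis arrow.sel(3) arrow_simps(3))
  moreover have "mor (transpose W B ?a) \<in> Hom B (dual C W \<otimes> U)" "mor (transpose W B ?b) \<in> Hom B (dual C W \<otimes> U)"
    using a b transpose_simps(3)[of ?a W B] transpose_simps(3)[of ?b W B] unfolding arr_def by simp_all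
  ultimately have "mor (transpose W B ?a) = mor (transpose W B ?b)"
    using p unfolding epi_def by blast
  then have "transpose W B ?a = transpose W B ?b" by (intro arrow_eqI) simp_all
  then have "?a = ?b" using untranspose[of ?a W B] untranspose[of ?b W B] a b by simp
  then show "a = b" by simp
qed

lemma projective_tens_left:
  assumes U: "projective C U"
  shows "projective C (W \<otimes> U)"
  unfolding projective_def
proof (intro allI impI)
  fix A B p f assume p: "epi C A B p" and f: "f \<in> Hom (W \<otimes> U) B"
  let ?p = "Arrow A B p" and ?f = "Arrow (W \<otimes> U) B f" and ?W' = "dual C W"
  have p': "arr ?p" "arr ?f" using p f unfolding epi_def by simp_all
  have "mor (transpose W U ?f) \<in> Hom U (?W' \<otimes> B)"
    using transpose_simps(3)[of ?f W U] p'(2) unfolding arr_def by simp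
  then obtain h where h: "h \<in> Hom U (?W' \<otimes> A)" "(Id ?W' \<otimes>\<^sub>m p) \<bullet> h = mor (transpose W U ?f)"
    using U epi_tens_left[OF p, of ?W'] unfolding projective_def by blast
  let ?h = "Arrow U (?W' \<otimes> A) h" and ?k = "(evA' W \<boxtimes> idt A) \<odot> (idt W \<boxtimes> Arrow U (dual C W \<otimes> A) h)"
  have lift: "(idt ?W' \<boxtimes> ?p) \<odot> ?h = transpose W U ?f"
    by (rule arrow_eqI) (simp_all add: h(2))
  have "?p \<odot> (evA' W \<boxtimes> idt A) = (evA' W \<boxtimes> idt B) \<odot> (idt (W \<otimes> ?W') \<boxtimes> ?p)"
    using p' exchange[of "evA' W" "idt \<one>" "idt A" ?p]
      exchange[of "idt (W \<otimes> ?W')" "evA' W" ?p "idt B"] by simp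
  then have "?p \<odot> ?k = ((evA' W \<boxtimes> idt B) \<odot> (idt (W \<otimes> ?W') \<boxtimes> ?p)) \<odot> (idt W \<boxtimes> ?h)"
    using p' h(1) by (simp flip: comp_assoc)
  also have "\<dots> = (evA' W \<boxtimes> idt B) \<odot> (idt W \<boxtimes> ((idt ?W' \<boxtimes> ?p) \<odot> ?h))"
    using p' h(1) by (simp add: whisker_left tensor_idt_idt)
  also have "\<dots> = ?f" unfolding lift using untranspose[of ?f W U] p'(2) by simp
  finally have "mor (?p \<odot> ?k) = f" by simp
  then have "p \<bullet> mor ?k = f" by simp
  moreover have "arr ?k" using h(1) by simp
  then have "mor ?k \<in> Hom (W \<otimes> U) A" unfolding arr_def by simp
  ultimately show "\<exists>h\<in>Hom (W \<otimes> U) A. p \<bullet> h = f" by blast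
qed

end


section \<open>The trace of the degree-zero component\<close>

context orbit_setting
begin

lemma lookup_zmor: "component (zmor \<nu> F) \<kappa> = (if \<nu> = \<kappa> then mor F else 0)"
  by (simp add: zmor_def lookup_single when_def)

lemma sing_zmor: "sing 0 x = zmor 0 (Arrow U V x)"
  by (simp add: zmor_def)

lemma lookup_zcmp_pre:
  assumes g: "g \<in> zhom V W" and x: "x \<in> Hom U V"
  shows "component (zcmp g (sing 0 x)) \<kappa> = component g \<kappa> \<bullet> x"
  using g
proof (induction rule: zhom_induct)
  case (single \<nu> G)
  then show ?case
    using x by (simp add: sing_zmor[of x U V] zcmp_zmor lookup_zmor cmp_zero_left[OF x])
next
  case (add f g)
  have x0: "sing 0 x \<in> zhom U V" using x by (simp add: zhom_single)
  show ?case
    using add(3,4)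
    by (simp add: zcmp_add_left[OF x0 add(1,2)] lookup_add
      cmp_add_left[OF x zhom_lookup[OF add(1)] zhom_lookup[OF add(2)]])
qed (simp add: cmp_zero_left[OF x])

lemma lookup_zcmp_post:
  assumes f: "f \<in> zhom U V" and y: "y \<in> Hom V W"
  shows "component (zcmp (sing 0 y) f) \<kappa> = (Id (\<sigma> \<kappa>) \<otimes>\<^sub>m y) \<bullet> component f \<kappa>"
  using f
proof (induction rule: zhom_induct)
  case (single \<nu> F)
  then show ?case
    using y cmp_zero_right[OF tens_in_Hom[OF Id_in_Hom y]]
    by (simp add: sing_zmor[of y V W] zcmp_zmor lookup_zmor)
next
  case (add f g)
  have y0: "sing 0 y \<in> zhom V W" using y by (simp add: zhom_single)
  show ?case
    using add(3,4)
    by (simp add: zcmp_add_right[OF add(1,2) y0] lookup_add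
      cmp_add_right[OF zhom_lookup[OF add(1)] zhom_lookup[OF add(2)] tens_in_Hom[OF Id_in_Hom y]])
qed (simp add: cmp_zero_right[OF tens_in_Hom[OF Id_in_Hom y]])

lemma lookup_ztens_Id:
  assumes f: "f \<in> zhom V W"
  shows "component (ztens f (sing 0 (Id U))) 0 = component f 0 \<otimes>\<^sub>m Id U"
    and "component (ztens (sing 0 (Id U)) f) 0 = Id U \<otimes>\<^sub>m component f 0"
proof -
  have "component (ztens f (sing 0 (Id U))) 0 = component f 0 \<otimes>\<^sub>m Id U
    \<and> component (ztens (sing 0 (Id U)) f) 0 = Id U \<otimes>\<^sub>m component f 0"
    using f
  proof (induction rule: zhom_induct)
    case (single \<nu> F)
    show ?case
    proof (cases "\<nu> = 0")
      case True
      then show ?thesis using single by (simp add: z_degree_zero lookup_zmor)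
    next
      case False
      then show ?thesis
        using single
        by (simp add: zmor_idt[symmetric] ztens_zmor lookup_zmor
            tens_zero_left[OF Id_in_Hom] tens_zero_right[OF Id_in_Hom])
    qed
  next
    case (add f g)
    then show ?case
      by (simp add: ztens_add_left[OF add(1,2) zId_in_zhom] ztens_add_right[OF zId_in_zhom add(1,2)] lookup_add
        tens_add_left[OF zhom_lookup[OF add(1)] zhom_lookup[OF add(2)] Id_in_Hom]
        tens_add_right[OF Id_in_Hom zhom_lookup[OF add(1)] zhom_lookup[OF add(2)]])
  qed (simp add: tens_zero_left[OF Id_in_Hom] tens_zero_right[OF Id_in_Hom])
  then show "component (ztens f (sing 0 (Id U))) 0 = component f 0 \<otimes>\<^sub>m Id U"
    and "component (ztens (sing 0 (Id U)) f) 0 = Id U \<otimes>\<^sub>m component f 0" by simp_all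
qed

lemma CZ_epi:
  assumes p: "epi C A B p"
  shows "epi orbit A B (sing 0 p)"
proof -
  have p': "p \<in> Hom A B" using p unfolding epi_def by blast
  have "a = b" if a: "a \<in> zhom B U" and b: "b \<in> zhom B U"
      and eq: "zcmp a (sing 0 p) = zcmp b (sing 0 p)" for U a b
  proof (rule poly_mapping_eqI)
    fix \<nu>
    have "component a \<nu> \<bullet> p = component b \<nu> \<bullet> p"
      using lookup_zcmp_pre[OF a p', of \<nu>] lookup_zcmp_pre[OF b p', of \<nu>] eq by simp
    then show "component a \<nu> = component b \<nu>"
      using p zhom_lookup[OF a] zhom_lookup[OF b] unfolding epi_def by blast
  qed
  then show ?thesis using p' by (simp add: epi_def zhom_single)
qed

text \<open>
  Epimorphisms of \<open>C\<close> stay epic in \<open>C\<^sup>Z\<close>, and the degree-zero component of a graded lift is a lift.  So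
  the trace of \<open>C\<close> is available on the projective objects of \<open>C\<^sup>Z\<close>.
\<close>

lemma CZ_projective_imp_projective:
  assumes P: "projective orbit P"
  shows "projective C P"
  unfolding projective_def
proof (intro allI impI)
  fix A B p f assume p: "epi C A B p" and f: "f \<in> Hom P B"
  have p': "p \<in> Hom A B" using p unfolding epi_def by blast
  have "sing 0 f \<in> zhom P B" using f by (simp add: zhom_single)
  then obtain h where h: "h \<in> zhom P A" "zcmp (sing 0 p) h = sing 0 f"
    using P CZ_epi[OF p] unfolding projective_def CZ_simps by blast
  have "(Id (\<sigma> 0) \<otimes>\<^sub>m p) \<bullet> component h 0 = f"
    using lookup_zcmp_post[OF h(1) p', of 0] h(2) by simp
  then have "p \<bullet> component h 0 = f" by (simp add: tens_unit_left[OF p'])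
  then show "\<exists>h\<in>Hom P A. p \<bullet> h = f" using zhom_lookup[OF h(1), of 0] by auto
qed

lemma m_trace_C: "m_trace C t"
  using trace unfolding nonzero_m_trace_def by blast

lemma t_linear: "projective C V \<Longrightarrow> f \<in> Hom V V \<Longrightarrow> g \<in> Hom V V \<Longrightarrow>
    t V (a \<cdot> f + b \<cdot> g) = a * t V f + b * t V g"
  using m_trace_C unfolding m_trace_def by blast

lemma t_cyclic: "projective C U \<Longrightarrow> projective C V \<Longrightarrow> f \<in> Hom V U \<Longrightarrow> g \<in> Hom U V \<Longrightarrow>
    t V (g \<bullet> f) = t U (f \<bullet> g)"
  using m_trace_C unfolding m_trace_def by blast

lemma t_left: "projective C U \<Longrightarrow> f \<in> Hom (W \<otimes> U) (W \<otimes> U) \<Longrightarrow>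
    t (W \<otimes> U) f = t U ((ev C W \<otimes>\<^sub>m Id U) \<bullet> (Id (dual C W) \<otimes>\<^sub>m f) \<bullet> (coev' C W \<otimes>\<^sub>m Id U))"
  using m_trace_C unfolding m_trace_def by blast

lemma t_right: "projective C U \<Longrightarrow> f \<in> Hom (U \<otimes> W) (U \<otimes> W) \<Longrightarrow>
    t (U \<otimes> W) f = t U ((Id U \<otimes>\<^sub>m ev' C W) \<bullet> (f \<otimes>\<^sub>m Id (dual C W)) \<bullet> (Id U \<otimes>\<^sub>m coev C W))"
  using m_trace_C unfolding m_trace_def by blast

lemma t_add: "projective C V \<Longrightarrow> f \<in> Hom V V \<Longrightarrow> g \<in> Hom V V \<Longrightarrow> t V (f + g) = t V f + t V g"
  using t_linear[of V f g 1 1] by simp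

lemma t_scale: "projective C V \<Longrightarrow> f \<in> Hom V V \<Longrightarrow> t V (a \<cdot> f) = a * t V f"
  using t_linear[of V f f a 0] by simp

lemma t_zero: "projective C V \<Longrightarrow> t V 0 = 0"
  using t_scale[of V 0 0] by simp

text \<open>Translation does not change traces, because \<open>\<sigma>\<^sub>\<nu>\<close> has dimension one.\<close>

lemma t_translate:
  assumes U: "projective C U" and k: "arr k" "src k = U" "tgt k = U"
  shows "t (\<sigma> \<nu> \<otimes> U) (mor (idt (\<sigma> \<nu>) \<boxtimes> k)) = t U (mor k)"
proof -
  let ?s = "\<sigma> \<nu>"
  have "arr (idt ?s \<boxtimes> k)" using k by simp
  then have h: "mor (idt ?s \<boxtimes> k) \<in> Hom (?s \<otimes> U) (?s \<otimes> U)" unfolding arr_def using k by simp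
  have "(evA ?s \<boxtimes> idt U) \<odot> (idt (dual C ?s) \<boxtimes> (idt ?s \<boxtimes> k)) \<odot> (coevA' ?s \<boxtimes> idt U)
      = (evA ?s \<boxtimes> idt U) \<odot> (idt (dual C ?s \<otimes> ?s) \<boxtimes> k) \<odot> (coevA' ?s \<boxtimes> idt U)"
    using k by (simp add: tensor_idt_idt)
  also have "\<dots> = (evA ?s \<odot> coevA' ?s) \<boxtimes> k" using k by (simp add: exchange)
  also have "\<dots> = k" using k by (simp add: \<sigma>_dimension)
  finally have "((evA ?s \<boxtimes> idt U) \<odot> (idt (dual C ?s) \<boxtimes> (idt ?s \<boxtimes> k))) \<odot> (coevA' ?s \<boxtimes> idt U) = k"
    using k by simp
  then have "mor (((evA ?s \<boxtimes> idt U) \<odot> (idt (dual C ?s) \<boxtimes> (idt ?s \<boxtimes> k))) \<odot> (coevA' ?s \<boxtimes> idt U)) = mor k"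
    by simp
  then show ?thesis using t_left[OF U h] by simp
qed

definition ztrace :: "'o \<Rightarrow> ('z \<Rightarrow>\<^sub>0 'm) \<Rightarrow> 'k"
  where "ztrace V f = t V (component f 0)"

text \<open>
  Only components of opposite degrees \<open>\<nu>\<close> and \<open>-\<nu>\<close> contribute.  For these, cyclicity in \<open>C\<close> gives the
  trace of an endomorphism of \<open>\<sigma>\<^sub>\<nu> \<otimes> U\<close> that is the translate of the required endomorphism of \<open>U\<close>.
\<close>

lemma ztrace_cyclic:
  assumes U: "projective C U" and V: "projective C V" and f: "f \<in> zhom V U" and g: "g \<in> zhom U V"
  shows "ztrace V (zcmp g f) = ztrace U (zcmp f g)"
proof -
  have h0: "component h 0 \<in> Hom W W" if "h \<in> zhom W W" for h W
    using zhom_lookup[OF that, of 0] by simp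
  have ztrace_add: "ztrace W (h + k) = ztrace W h + ztrace W k" if "projective C W" "h \<in> zhom W W" "k \<in> zhom W W" for h k W
    using that by (simp add: ztrace_def lookup_add t_add h0)
  from f show ?thesis
  proof (induction rule: zhom_induct)
    case zero
    then show ?case using U V by (simp add: ztrace_def t_zero)
  next
    case (single \<nu> F)
    note F = this
    note F' = zmor_in_zhom[OF F]
    from g show ?case
    proof (induction rule: zhom_induct)
      case zero
      then show ?case using U V by (simp add: ztrace_def t_zero)
    next
      case (single \<mu> G)
      note G = this
      show ?case
      proof (cases "\<nu> + \<mu> = 0")
        case False
        then have "\<mu> + \<nu> \<noteq> 0" by (simp add: add.commute)
        with False show ?thesis using F G U V by (simp add: ztrace_def zcmp_zmor lookup_zmor t_zero)
      next
        case True
        then have \<mu>: "\<mu> = - \<nu>" by (simp add: eq_neg_iff_add_eq_0 add.commute)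
        let ?k = "(idt (\<sigma> (- \<nu>)) \<boxtimes> F) \<odot> G"
        have k: "idt (\<sigma> \<nu>) \<boxtimes> ?k = F \<odot> (idt (\<sigma> \<nu>) \<boxtimes> G)"
          using F G \<mu> by (simp add: whisker_left tensor_idt_idt)
        have Fh: "mor F \<in> Hom V (\<sigma> \<nu> \<otimes> U)" using F by (simp add: arr_def)
        have "arr (idt (\<sigma> \<nu>) \<boxtimes> G)" using G by simp
        then have Gh: "mor (idt (\<sigma> \<nu>) \<boxtimes> G) \<in> Hom (\<sigma> \<nu> \<otimes> U) V"
          unfolding arr_def using G \<mu> by simp
        have "ztrace V (zcmp (zmor \<mu> G) (zmor \<nu> F)) = t V (mor (idt (\<sigma> \<nu>) \<boxtimes> G) \<bullet> mor F)"
          using F G \<mu> by (simp add: ztrace_def zcmp_zmor lookup_zmor)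
        also have "\<dots> = t (\<sigma> \<nu> \<otimes> U) (mor F \<bullet> mor (idt (\<sigma> \<nu>) \<boxtimes> G))"
          by (rule t_cyclic[OF projective_tens_left[OF U] V Fh Gh])
        also have "mor F \<bullet> mor (idt (\<sigma> \<nu>) \<boxtimes> G) = mor (idt (\<sigma> \<nu>) \<boxtimes> ?k)"
          unfolding k by simp
        also have "t (\<sigma> \<nu> \<otimes> U) \<dots> = t U (mor ?k)"
          by (rule t_translate[OF U]) (use F G \<mu> in simp_all)
        also have "\<dots> = ztrace U (zcmp (zmor \<nu> F) (zmor \<mu> G))"
          using F G \<mu> by (simp add: ztrace_def zcmp_zmor lookup_zmor)
        finally show ?thesis .
      qed
    next
      case (add g g')
      then show ?case
        using assms(1,2)
        by (simp add: zcmp_add_left[OF F' add(1,2)] zcmp_add_right[OF add(1,2) F']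
          ztrace_add zcmp_in_zhom[OF F' add(1)] zcmp_in_zhom[OF F' add(2)]
          zcmp_in_zhom[OF add(1) F'] zcmp_in_zhom[OF add(2) F'])
    qed
  next
    case (add f f')
    then show ?case
      using assms(1,2)
      by (simp add: zcmp_add_right[OF add(1,2) g] zcmp_add_left[OF g add(1,2)]
        ztrace_add zcmp_in_zhom[OF add(1) g] zcmp_in_zhom[OF add(2) g]
        zcmp_in_zhom[OF g add(1)] zcmp_in_zhom[OF g add(2)])
  qed
qed

lemma CZ_m_trace: "m_trace orbit ztrace"
  unfolding m_trace_def CZ_simps
proof (intro conjI allI impI)
  fix V a b f g assume "projective orbit V" and f: "f \<in> zhom V V" and g: "g \<in> zhom V V"
  then show "ztrace V (zscale a f + zscale b g) = a * ztrace V f + b * ztrace V g"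
    using CZ_projective_imp_projective t_linear zhom_lookup[OF f, of 0] zhom_lookup[OF g, of 0]
    by (simp add: ztrace_def lookup_add lookup_zscale)
next
  fix U V f g assume "projective orbit U" "projective orbit V" "f \<in> zhom V U" "g \<in> zhom U V"
  then show "ztrace V (zcmp g f) = ztrace U (zcmp f g)"
    using ztrace_cyclic CZ_projective_imp_projective by blast
next
  fix U W f assume U: "projective orbit U" and f: "f \<in> zhom (U \<otimes> W) (U \<otimes> W)"
  have p: "ztens (sing 0 (Id U)) (sing 0 (ev' C W)) = sing 0 (Id U \<otimes>\<^sub>m ev' C W)"
    "ztens (sing 0 (Id U)) (sing 0 (coev C W)) = sing 0 (Id U \<otimes>\<^sub>m coev C W)"
    by (simp_all add: z_degree_zero) (simp_all add: zmor_def)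
  have ty: "Id U \<otimes>\<^sub>m ev' C W \<in> Hom ((U \<otimes> W) \<otimes> dual C W) U" "Id U \<otimes>\<^sub>m coev C W \<in> Hom U ((U \<otimes> W) \<otimes> dual C W)"
    using tens_in_Hom[OF Id_in_Hom ev'_in_Hom, of U W] tens_in_Hom[OF Id_in_Hom coev_in_Hom, of U W] by simp_all
  have fI: "ztens f (sing 0 (Id (dual C W))) \<in> zhom ((U \<otimes> W) \<otimes> dual C W) ((U \<otimes> W) \<otimes> dual C W)"
    by (rule ztens_in_zhom[OF f zId_in_zhom])
  have "component (zcmp (zcmp (sing 0 (Id U \<otimes>\<^sub>m ev' C W)) (ztens f (sing 0 (Id (dual C W)))))
        (sing 0 (Id U \<otimes>\<^sub>m coev C W))) 0
    = (Id U \<otimes>\<^sub>m ev' C W) \<bullet> (component f 0 \<otimes>\<^sub>m Id (dual C W)) \<bullet> (Id U \<otimes>\<^sub>m coev C W)"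
    using lookup_zcmp_pre[OF zcmp_in_zhom[OF fI zhom_single] ty(2), of "Id U \<otimes>\<^sub>m ev' C W" 0 U 0] ty(1)
      lookup_zcmp_post[OF fI ty(1), of 0] lookup_ztens_Id(1)[OF f, of "dual C W"]
    by (simp add: tens_unit_left[OF ty(1)])
  then show "ztrace (U \<otimes> W) f = ztrace U (zcmp (zcmp (ztens (sing 0 (Id U)) (sing 0 (ev' C W)))
      (ztens f (sing 0 (Id (dual C W))))) (ztens (sing 0 (Id U)) (sing 0 (coev C W))))"
    using t_right[OF CZ_projective_imp_projective[OF U]] zhom_lookup[OF f, of 0]
    by (simp add: p ztrace_def)
next
  fix U W f assume U: "projective orbit U" and f: "f \<in> zhom (W \<otimes> U) (W \<otimes> U)"
  have p: "ztens (sing 0 (ev C W)) (sing 0 (Id U)) = sing 0 (ev C W \<otimes>\<^sub>m Id U)"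
    "ztens (sing 0 (coev' C W)) (sing 0 (Id U)) = sing 0 (coev' C W \<otimes>\<^sub>m Id U)"
    by (simp_all add: z_degree_zero) (simp_all add: zmor_def)
  have ty: "ev C W \<otimes>\<^sub>m Id U \<in> Hom (dual C W \<otimes> (W \<otimes> U)) U" "coev' C W \<otimes>\<^sub>m Id U \<in> Hom U (dual C W \<otimes> (W \<otimes> U))"
    using tens_in_Hom[OF ev_in_Hom Id_in_Hom, of W U] tens_in_Hom[OF coev'_in_Hom Id_in_Hom, of W U] by simp_all
  have fI: "ztens (sing 0 (Id (dual C W))) f \<in> zhom (dual C W \<otimes> (W \<otimes> U)) (dual C W \<otimes> (W \<otimes> U))"
    by (rule ztens_in_zhom[OF zId_in_zhom f])
  have "component (zcmp (zcmp (sing 0 (ev C W \<otimes>\<^sub>m Id U)) (ztens (sing 0 (Id (dual C W))) f))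
        (sing 0 (coev' C W \<otimes>\<^sub>m Id U))) 0
    = (ev C W \<otimes>\<^sub>m Id U) \<bullet> (Id (dual C W) \<otimes>\<^sub>m component f 0) \<bullet> (coev' C W \<otimes>\<^sub>m Id U)"
    using lookup_zcmp_pre[OF zcmp_in_zhom[OF fI zhom_single] ty(2), of "ev C W \<otimes>\<^sub>m Id U" 0 U 0] ty(1)
      lookup_zcmp_post[OF fI ty(1), of 0] lookup_ztens_Id(2)[OF f, of "dual C W"]
    by (simp add: tens_unit_left[OF ty(1)])
  then show "ztrace (W \<otimes> U) f = ztrace U (zcmp (zcmp (ztens (sing 0 (ev C W)) (sing 0 (Id U)))
      (ztens (sing 0 (Id (dual C W))) f)) (ztens (sing 0 (coev' C W)) (sing 0 (Id U))))"
    using t_left[OF CZ_projective_imp_projective[OF U]] zhom_lookup[OF f, of 0]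
    by (simp add: p ztrace_def)
qed

lemma lookup_zdag_zero:
  assumes f: "f \<in> zhom V W"
  shows "component (zdag f) 0 = dag (component f 0)"
  using f
proof (induction rule: zhom_induct)
  case (single \<nu> F)
  show ?case
  proof (cases "\<nu> = 0")
    case True
    then show ?thesis using single by (simp add: zdag_zmor lookup_zmor del: arrow_simps(6))
  next
    case False
    then show ?thesis using single by (simp add: zdag_zmor lookup_zmor dag_zero)
  qed
next
  case (add f g)
  then show ?case
    by (simp add: zdag_add[OF add(1,2)] lookup_add dag_add[OF zhom_lookup[OF add(1)] zhom_lookup[OF add(2)]])
qed (simp add: dag_zero)

lemma CZ_real_m_trace: "real_m_trace orbit bar zdag ztrace"
  unfolding real_m_trace_def CZ_simps
proof (intro conjI allI impI CZ_m_trace)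
  fix V f assume V: "projective orbit V" and f: "f \<in> zhom V V"
  have "component f 0 \<in> Hom V V" using zhom_lookup[OF f, of 0] by simp
  then show "ztrace V (zdag f) = bar (ztrace V f)"
    using trace_real CZ_projective_imp_projective[OF V] lookup_zdag_zero[OF f]
    unfolding real_m_trace_def ztrace_def by simp
qed


section \<open>Traces of identities of generic simple objects\<close>

text \<open>
  Let \<open>t\<^sub>P(f) \<noteq> 0\<close>.  If \<open>W\<close> is simple with epic evaluation, then \<open>Id\<^sub>P \<otimes> ev\<^sub>W\<close> is an epimorphism
  onto the projective object \<open>P\<close> and splits.  So \<open>t\<^sub>P(f)\<close> is the trace of an endomorphism
  of \<open>P \<otimes> W\<^sup>* \<otimes> W\<close>, and by the partial trace property a multiple of \<open>t\<^sub>W(Id\<^sub>W)\<close>.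
\<close>

lemma trace_Id_nonzero:
  assumes W: "simple C W" "projective C W" and ev: "epi C (dual C W \<otimes> W) \<one> (ev C W)"
  shows "t W (Id W) \<noteq> 0"
proof
  assume tW: "t W (Id W) = 0"
  obtain P f where P: "projective C P" and f: "f \<in> Hom P P" and tf: "t P f \<noteq> 0"
    using trace unfolding nonzero_m_trace_def by blast
  let ?Q = "P \<otimes> (dual C W \<otimes> W)" and ?e = "Id P \<otimes>\<^sub>m ev C W"
  have e: "epi C ?Q P ?e" using epi_tens_left[OF ev, of P] by simp
  then have e': "?e \<in> Hom ?Q P" unfolding epi_def by blast
  obtain s where s: "s \<in> Hom P ?Q" "?e \<bullet> s = Id P"
    using P e Id_in_Hom unfolding projective_def by blast
  have Q: "projective C ?Q" using projective_tens_left[OF W(2), of "P \<otimes> dual C W"] by simp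
  have sf: "s \<bullet> f \<in> Hom P ?Q" by (rule cmp_in_Hom[OF f s(1)])
  have "?e \<bullet> (s \<bullet> f) = f" using cmp_assoc[OF f s(1) e'] s(2) cmp_Id_left[OF f] by simp
  then have "t P f = t ?Q ((s \<bullet> f) \<bullet> ?e)" using t_cyclic[OF Q P sf e'] by simp
  also have "\<dots> = t ((P \<otimes> dual C W) \<otimes> W) ((s \<bullet> f) \<bullet> ?e)" by simp
  also have "\<dots> = 0"
  proof -
    let ?D = "P \<otimes> dual C W" and ?h = "(s \<bullet> f) \<bullet> ?e"
    have h: "?h \<in> Hom (?D \<otimes> W) (?D \<otimes> W)" using cmp_in_Hom[OF e' sf] by simp
    have "arr (((evA ?D \<boxtimes> idt W) \<odot> (idt (dual C ?D) \<boxtimes> Arrow (?D \<otimes> W) (?D \<otimes> W) ?h)) \<odot> (coevA' ?D \<boxtimes> idt W))"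
      using h by (simp del: comp_assoc)
    then have "(ev C ?D \<otimes>\<^sub>m Id W) \<bullet> (Id (dual C ?D) \<otimes>\<^sub>m ?h) \<bullet> (coev' C ?D \<otimes>\<^sub>m Id W) \<in> Hom W W"
      unfolding arr_def by (simp del: comp_assoc)
    then obtain a where "(ev C ?D \<otimes>\<^sub>m Id W) \<bullet> (Id (dual C ?D) \<otimes>\<^sub>m ?h) \<bullet> (coev' C ?D \<otimes>\<^sub>m Id W) = a \<cdot> Id W"
      by (rule simple_scalar[OF W(1)])
    then show ?thesis using t_left[OF W(2) h] t_scale[OF W(2) Id_in_Hom] tW by simp
  qed
  finally show False using tf by simp
qed

text \<open>
  A generic simple object is a translate of one with epic evaluation.
\<close>

lemma generic_trace_Id_nonzero:
  assumes g: "g \<notin> X" and V: "V \<in> deg g" "simple C V"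
  shows "t V (Id V) \<noteq> 0"
proof -
  obtain I where I: "I \<subseteq> deg g"
    "\<forall>V\<in>I. simple C V \<and> projective C V \<and> epi C (dual C V \<otimes> V) \<one> (ev C V)"
    "\<forall>V\<in>deg g. dominated C V {W \<otimes> \<sigma> \<nu> | W \<nu>. W \<in> I}"
    using generic_dominated[OF g] by blast
  have Is: "\<forall>W\<in>I. simple C W" using I(2) by blast
  obtain W \<nu> where W: "W \<in> I" and iso: "isomorphic C V (\<sigma> \<nu> \<otimes> W)"
    by (rule generic_simple_translateE[OF g V I(1) Is I(3)[rule_format, OF V(1)]])
  then have Wp: "projective C W" and tW: "t W (Id W) \<noteq> 0" using I(2) trace_Id_nonzero by blast+
  have Vp: "projective C V"
    by (rule generic_simple_projective) (use g V in \<open>auto simp: generic_simples_def\<close>)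
  obtain f f' where f: "f \<in> Hom V (\<sigma> \<nu> \<otimes> W)" "f' \<in> Hom (\<sigma> \<nu> \<otimes> W) V"
    "f' \<bullet> f = Id V" "f \<bullet> f' = Id (\<sigma> \<nu> \<otimes> W)"
    using iso unfolding isomorphic_def by (auto elim: is_isoE)
  have "t V (Id V) = t (\<sigma> \<nu> \<otimes> W) (Id (\<sigma> \<nu> \<otimes> W))"
    using t_cyclic[OF projective_tens_left[OF Wp] Vp f(1,2)] f(3,4) by simp
  also have "\<dots> = t W (Id W)" using t_translate[OF Wp, of "idt W" \<nu>] by (simp add: tens_Id)
  finally show ?thesis using tW by simp
qed

lemma CZ_spherical_trace: "spherical_trace orbit deg X ztrace"
  unfolding spherical_trace_def
proof (intro conjI ballI CZ_m_trace)
  interpret Z: generically_finitely_semisimple_category orbit deg X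
    by (rule CZ_generically_finitely_semisimple)
  fix V assume V: "V \<in> generic_simples orbit deg X"
  show "projective orbit V" by (rule Z.generic_simple_projective[OF V])
  from V obtain g where g: "g \<notin> X" "V \<in> deg g" and s: "simple orbit V"
    unfolding generic_simples_def by blast
  show "ztrace V (ident orbit V) \<noteq> 0"
    using generic_trace_Id_nonzero[OF g CZ_simple_imp_simple[OF s]] by (simp add: ztrace_def)
qed

end

theorem theorem4p14:
  fixes C :: "('k::field, 'o, 'm::ab_group_add) piv_cat"
    and bar :: "'k \<Rightarrow> 'k" and dag :: "'m \<Rightarrow> 'm" and c :: "'o \<Rightarrow> 'o \<Rightarrow> 'm"
    and deg :: "'g::ab_group_add \<Rightarrow> 'o set" and X :: "'g set"
    and \<sigma> :: "'z::ab_group_add \<Rightarrow> 'o" and t :: "'o \<Rightarrow> 'm \<Rightarrow> 'k"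
    and \<psi> sqrt_\<psi> :: "'g \<Rightarrow> 'z \<Rightarrow> 'k"
  assumes "relative_hermitian_premodular_category C bar dag c deg X \<sigma> t \<psi>"
    and "bilinear_pairing sqrt_\<psi>"
    and "\<And>g \<nu>. bar (sqrt_\<psi> g \<nu>) * sqrt_\<psi> g \<nu> = 1"
    and "\<And>g \<nu>. (sqrt_\<psi> g \<nu>)\<^sup>2 = \<psi> g \<nu>"
    and "\<And>\<nu> \<mu>. c (\<sigma> \<nu>) (\<sigma> \<mu>) = ident C (\<sigma> (\<nu> + \<mu>))"
    and "\<exists>b. spherical_weight (CZ C c deg \<sigma> sqrt_\<psi>) deg X b"
  shows "relative_hermitian_spherical (CZ C c deg \<sigma> sqrt_\<psi>) bar (CZ_dag C dag \<sigma>) deg X"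
proof -
  interpret orbit_setting C bar dag c deg X \<sigma> t \<psi> sqrt_\<psi>
    using assms(1-3,5) by (intro orbit_setting.intro orbit_setting_axioms.intro)
  show ?thesis
    unfolding relative_hermitian_spherical_def relative_spherical_def
    using CZ_hermitian_pivotal_category CZ_pivotal_category CZ_generically_finitely_semisimple
      CZ_spherical_trace CZ_real_m_trace assms(6) by blast
qed

end
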